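(* Let $(\mathcal{S}_k,\{M_n(\mathcal{S}_k)^+\}_{n\in\mathbb{N}},e_k)_{k\in\mathbb{N}}$ be operator systems and let $\phi_k:\mathcal{S}_k\to\mathcal{S}_{k+1}$ be unital completely positive maps, so that $\mathcal{S}_1\xrightarrow{\phi_1}\mathcal{S}_2\xrightarrow{\phi_2}\mathcal{S}_3\xrightarrow{\phi_3}\cdots$ is an inductive system in the category $\mathbf{OS}$. Let $(\mathcal{S}_\infty,\{D_n\}_{n\in\mathbb{N}},e_\infty)$ and $\phi_{k,\infty}:\mathcal{S}_k\to\mathcal{S}_\infty$ be as constructed in the context. Then $(\mathcal{S}_\infty,\{D_n\}_{n\in\mathbb{N}},e_\infty)$ (with the maps $\phi_{k,\infty}$, $k\in\mathbb{N}$) is an inductive limit of this inductive system in $\mathbf{OS}$.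
   Context: A matrix ordered $*$-vector space is a complex $*$-vector space $\mathcal{S}$ with cones $C_n\subseteq M_n(\mathcal{S})_h$ ($n\in\mathbb{N}$), $C_n\cap(-C_n)=\{0\}$, $\alpha^*C_n\alpha\subseteq C_m$ for $\alpha\in M_{n,m}(\mathbb{C})$. An element $e\in C_1$ is an Archimedean matrix order unit if, for every $n$, $e^{(n)}=\mathrm{diag}(e,\dots,e)$ is an order unit of $(M_n(\mathcal{S}),C_n)$ (for each $X\in M_n(\mathcal{S})_h$ there is $r>0$ with $re^{(n)}-X\in C_n$) and $C_n=\{X\in M_n(\mathcal{S})_h:re^{(n)}+X\in C_n\ \forall r>0\}$. An operator system (not assumed complete) is a matrix ordered $*$-vector space with an Archimedean matrix order unit. $\mathbf{OS}$ has operator systems as objects and unital completely positive maps as morphisms. $\phi^{(n)}$ denotes entrywise application of $\phi$ to $n\times n$ matrices. Inductive limit in a category: for a system $(\{A_k\},\{\alpha_k:A_k\to A_{k+1}\})$, an object $A$ with morphisms $\alpha_{k,\infty}:A_k\to A$ such that $\alpha_{k+1,\infty}\circ\alpha_k=\alpha_{k,\infty}$ and, whenever $\beta_k:A_k\to B$ are morphisms with $\beta_{k+1}\circ\alpha_k=\beta_k$ for all $k$, there is a unique morphism $\mu:A\to B$ with $\mu\circ\alpha_{k,\infty}=\beta_k$ for all $k$. Construction. For $k<l$ put $\phi_{k,l}=\phi_{l-1}\circ\cdots\circ\phi_k$, and $\phi_{k,k}=\mathrm{id}$. $\ddot{\mathcal{S}}_\infty$ is the space of sequences $(x_k)_k\in\prod_k\mathcal{S}_k$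 with $\phi_k(x_k)=x_{k+1}$ for all large $k$, modulo eventually zero sequences; $\ddot\phi_{k,\infty}(x)$ is the class of the sequence equal to $0$ at indices $i<k$ and to $\phi_{k,i}(x)$ at indices $i\ge k$; the involution is $\ddot\phi_{k,\infty}(x)^*=\ddot\phi_{k,\infty}(x^* )$; $\ddot e_\infty=\ddot\phi_{k,\infty}(e_k)$ (independent of $k$); $C_n=\{\ddot\phi_{k,\infty}^{(n)}(X):k\in\mathbb{N},\ X\in M_n(\mathcal{S}_k),\ \exists m\ge k,\ \phi_{k,m}^{(n)}(X)\in M_n(\mathcal{S}_m)^+\}$. Let $N=\{s\in\ddot{\mathcal{S}}_\infty:f(s)=0\text{ for all states }f\text{ of }(\ddot{\mathcal{S}}_\infty,C_1,\ddot e_\infty)\}$, where a state is a unital positive linear functional. Put $\mathcal{S}_\infty=\ddot{\mathcal{S}}_\infty/N$ with the quotient involution and quotient map $q_{\mathcal{S}}$, $\phi_{k,\infty}=q_{\mathcal{S}}\circ\ddot\phi_{k,\infty}$, $e_\infty=\phi_{k,\infty}(e_k)$ (independent of $k$), and let $D_n$ be the set of all $\phi_{k,\infty}^{(n)}(X)\in M_n(\mathcal{S}_\infty)_h$ ($k\in\mathbb{N}$, $X\in M_n(\mathcal{S}_k)$) such that for each $r>0$ there exist $l\in\mathbb{N}$ and $T\in M_n(\mathcal{S}_l)$ with $\ddot\phi_{l,\infty}^{(n)}(T)\in M_n(N)$ and $\ddot\phi_{k,\infty}^{(n)}(re_k^{(n)}+X)+\ddot\phi_{l,\infty}^{(n)}(T)\in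 C_n$. *)

theory Defs
  imports
    "Jordan_Normal_Form.VS_Connect"
    "HOL-Algebra.AbelCoset"
    "HOL-Library.Nonpos_Ints"
begin

text \<open>
  Complex vector spaces are modules over \<open>class_ring :: complex ring\<close>, with explicit carriers.
  The ring multiplication and the unit that the record type of modules inherits from rings play
  no role and are left \<open>undefined\<close> in the constructions below.  The cone \<open>cone V n\<close> lives in
  \<open>M_n(V)\<close> and matters only for \<open>n > 0\<close>; \<open>cone V 0\<close> is unconstrained and irrelevant.
  A sequence of spaces is a function \<open>nat \<Rightarrow> 'a opsys\<close>, where every space carries its own
  operations; the common type \<open>'a\<close> is only a supply of elements.
\<close>

record 'a star_space = "(complex, 'a) module" +
  star :: "'a \<Rightarrow> 'a"

record 'a matrix_ordered_space = "'a star_space" +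
  cone :: "nat \<Rightarrow> 'a mat set"

record 'a opsys = "'a matrix_ordered_space" +
  ounit :: 'a

locale star_vector_space = vectorspace "class_ring :: complex ring" V
  for V :: "('a, 'm) star_space_scheme" (structure) +
  assumes star_closed: "x \<in> carrier V \<Longrightarrow> star V x \<in> carrier V"
    and star_star: "x \<in> carrier V \<Longrightarrow> star V (star V x) = x"
    and star_add: "x \<in> carrier V \<Longrightarrow> y \<in> carrier V \<Longrightarrow> star V (x \<oplus>\<^bsub>V\<^esub> y) = star V x \<oplus>\<^bsub>V\<^esub> star V y"
    and star_smult: "x \<in> carrier V \<Longrightarrow> star V (c \<odot>\<^bsub>V\<^esub> x) = cnj c \<odot>\<^bsub>V\<^esub> star V x"

definition hermitian :: "('a, 'm) star_space_scheme \<Rightarrow> 'a set" where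
  "hermitian V = {x \<in> carrier V. star V x = x}"

definition matrix_space :: "('a, 'm) star_space_scheme \<Rightarrow> nat \<Rightarrow> 'a mat star_space" where
  "matrix_space V n =
    \<lparr>carrier = {X \<in> carrier_mat n n. elements_mat X \<subseteq> carrier V},
     mult = undefined,
     one = undefined,
     zero = mat n n (\<lambda>_. \<zero>\<^bsub>V\<^esub>),
     add = (\<lambda>X Y. mat n n (\<lambda>ij. X $$ ij \<oplus>\<^bsub>V\<^esub> Y $$ ij)),
     smult = (\<lambda>c. map_mat (\<lambda>x. c \<odot>\<^bsub>V\<^esub> x)),
     star = (\<lambda>X. mat n n (\<lambda>(i, j). star V (X $$ (j, i))))\<rparr>"

definition diag_of :: "('a, 'm) star_space_scheme \<Rightarrow> nat \<Rightarrow> 'a \<Rightarrow> 'a mat" where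
  "diag_of V n x = mat n n (\<lambda>(i, j). if i = j then x else \<zero>\<^bsub>V\<^esub>)"

text \<open>\<open>compression V n m \<alpha> X\<close> is $\alpha^* X \alpha$ for an $n \times m$ scalar matrix
  $\alpha$ and $X \in M_n(V)$.\<close>

definition compression ::
  "('a, 'm) star_space_scheme \<Rightarrow> nat \<Rightarrow> nat \<Rightarrow> complex mat \<Rightarrow> 'a mat \<Rightarrow> 'a mat" where
  "compression V n m \<alpha> X = mat m m (\<lambda>(i, j).
     \<Oplus>\<^bsub>V\<^esub>p\<in>{..<n}. \<Oplus>\<^bsub>V\<^esub>q\<in>{..<n}. (cnj (\<alpha> $$ (p, i)) * \<alpha> $$ (q, j)) \<odot>\<^bsub>V\<^esub> X $$ (p, q))"

definition is_cone :: "('a, 'm) star_space_scheme \<Rightarrow> 'a set \<Rightarrow> bool" where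
  "is_cone W C \<longleftrightarrow>
     C \<subseteq> hermitian W \<and>
     (\<forall>x\<in>C. \<forall>y\<in>C. x \<oplus>\<^bsub>W\<^esub> y \<in> C) \<and>
     (\<forall>r::real. 0 \<le> r \<longrightarrow> (\<forall>x\<in>C. complex_of_real r \<odot>\<^bsub>W\<^esub> x \<in> C))"

definition order_unit :: "('a, 'm) star_space_scheme \<Rightarrow> 'a set \<Rightarrow> 'a \<Rightarrow> bool" where
  "order_unit W C e \<longleftrightarrow>
     (\<forall>x\<in>hermitian W. \<exists>r::real. 0 < r \<and> (complex_of_real r \<odot>\<^bsub>W\<^esub> e) \<ominus>\<^bsub>W\<^esub> x \<in> C)"

definition archimedean :: "('a, 'm) star_space_scheme \<Rightarrow> 'a set \<Rightarrow> 'a \<Rightarrow> bool" where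
  "archimedean W C e \<longleftrightarrow>
     C = {x \<in> hermitian W. \<forall>r::real. 0 < r \<longrightarrow> (complex_of_real r \<odot>\<^bsub>W\<^esub> e) \<oplus>\<^bsub>W\<^esub> x \<in> C}"

locale matrix_ordered_star_vector_space = star_vector_space V
  for V :: "('a, 'm) matrix_ordered_space_scheme" (structure) +
  assumes cone_is_cone: "0 < n \<Longrightarrow> is_cone (matrix_space V n) (cone V n)"
    and cone_proper: "0 < n \<Longrightarrow>
      cone V n \<inter> (\<lambda>X. \<ominus>\<^bsub>matrix_space V n\<^esub> X) ` cone V n = {\<zero>\<^bsub>matrix_space V n\<^esub>}"
    and cone_compression: "0 < n \<Longrightarrow> 0 < m \<Longrightarrow> \<alpha> \<in> carrier_mat n m \<Longrightarrow> X \<in> cone V n \<Longrightarrow>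
      compression V n m \<alpha> X \<in> cone V m"

locale operator_system = matrix_ordered_star_vector_space V
  for V :: "('a, 'm) opsys_scheme" (structure) +
  assumes ounit_pos: "diag_of V 1 (ounit V) \<in> cone V 1"
    and ounit_order_unit: "0 < n \<Longrightarrow>
      order_unit (matrix_space V n) (cone V n) (diag_of V n (ounit V))"
    and ounit_archimedean: "0 < n \<Longrightarrow>
      archimedean (matrix_space V n) (cone V n) (diag_of V n (ounit V))"

definition ucp_map ::
  "('a, 'm) opsys_scheme \<Rightarrow> ('b, 'k) opsys_scheme \<Rightarrow> ('a \<Rightarrow> 'b) \<Rightarrow> bool" where
  "ucp_map V W f \<longleftrightarrow>
     f \<in> LinearCombinations.module_hom (class_ring :: complex ring) V W \<and>
     f (ounit V) = ounit W \<and>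
     (\<forall>n>0. \<forall>X\<in>cone V n. map_mat f X \<in> cone W n)"

definition OS_inductive_system :: "(nat \<Rightarrow> 'a opsys) \<Rightarrow> (nat \<Rightarrow> 'a \<Rightarrow> 'a) \<Rightarrow> bool" where
  "OS_inductive_system S \<phi> \<longleftrightarrow>
     (\<forall>k. operator_system (S k)) \<and> (\<forall>k. ucp_map (S k) (S (Suc k)) (\<phi> k))"

text \<open>
  The test objects \<open>B\<close> of the universal property range over the operator systems whose
  elements are taken from the type \<open>'c\<close>; a theorem in which \<open>'c\<close> is a type variable covers all of
  them.  Morphisms only matter on carriers, so the mediating one is normalised to be
  \<open>undefined\<close> outside the carrier to make its uniqueness an equality of functions.
\<close>

definition OS_inductive_limit ::
  "'c itself \<Rightarrow> (nat \<Rightarrow> 'a opsys) \<Rightarrow> (nat \<Rightarrow> 'a \<Rightarrow> 'a) \<Rightarrow> 'b opsys \<Rightarrow> (nat \<Rightarrow> 'a \<Rightarrow> 'b) \<Rightarrow> bool" where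
  "OS_inductive_limit _ S \<phi> A \<psi> \<longleftrightarrow>
     operator_system A \<and>
     (\<forall>k. ucp_map (S k) A (\<psi> k)) \<and>
     (\<forall>k. \<forall>x\<in>carrier (S k). \<psi> (Suc k) (\<phi> k x) = \<psi> k x) \<and>
     (\<forall>(B :: 'c opsys) \<beta>.
        operator_system B \<and>
        (\<forall>k. ucp_map (S k) B (\<beta> k)) \<and>
        (\<forall>k. \<forall>x\<in>carrier (S k). \<beta> (Suc k) (\<phi> k x) = \<beta> k x) \<longrightarrow>
        (\<exists>!\<mu>. \<mu> \<in> extensional (carrier A) \<and> ucp_map A B \<mu> \<and>
              (\<forall>k. \<forall>x\<in>carrier (S k). \<mu> (\<psi> k x) = \<beta> k x)))"

definition quotient_module :: "(complex, 'a, 'm) module_scheme \<Rightarrow> 'a set \<Rightarrow> (complex, 'a set) module"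
  where
  "quotient_module V N =
    \<lparr>carrier = a_rcosets\<^bsub>V\<^esub> N,
     mult = undefined,
     one = undefined,
     zero = N,
     add = (\<lambda>A B. A <+>\<^bsub>V\<^esub> B),
     smult = (\<lambda>c A. \<Union>x\<in>A. N +>\<^bsub>V\<^esub> (c \<odot>\<^bsub>V\<^esub> x))\<rparr>"

definition complex_module :: "(complex, complex) module" where
  "complex_module =
    \<lparr>carrier = UNIV, mult = (*), one = 1, zero = 0, add = (+), smult = (*)\<rparr>"

definition is_state :: "('a, 'm) opsys_scheme \<Rightarrow> ('a \<Rightarrow> complex) \<Rightarrow> bool" where
  "is_state V f \<longleftrightarrow>
     f \<in> LinearCombinations.module_hom (class_ring :: complex ring) V complex_module \<and>
     (\<forall>X\<in>cone V 1. f (X $$ (0, 0)) \<in> \<real>\<^sub>\<ge>\<^sub>0) \<and>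
     f (ounit V) = 1"

definition connecting :: "(nat \<Rightarrow> 'a \<Rightarrow> 'a) \<Rightarrow> nat \<Rightarrow> nat \<Rightarrow> 'a \<Rightarrow> 'a" where
  "connecting \<phi> k l = fold \<phi> [k..<l]"

definition seq_module :: "(nat \<Rightarrow> 'a opsys) \<Rightarrow> (nat \<Rightarrow> 'a \<Rightarrow> 'a) \<Rightarrow> (complex, nat \<Rightarrow> 'a) module" where
  "seq_module S \<phi> =
    \<lparr>carrier = {x. (\<forall>k. x k \<in> carrier (S k)) \<and> (\<exists>K. \<forall>k\<ge>K. \<phi> k (x k) = x (Suc k))},
     mult = undefined,
     one = undefined,
     zero = (\<lambda>k. \<zero>\<^bsub>S k\<^esub>),
     add = (\<lambda>x y k. x k \<oplus>\<^bsub>S k\<^esub> y k),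
     smult = (\<lambda>c x k. c \<odot>\<^bsub>S k\<^esub> x k)\<rparr>"

definition null_seqs :: "(nat \<Rightarrow> 'a opsys) \<Rightarrow> (nat \<Rightarrow> 'a \<Rightarrow> 'a) \<Rightarrow> (nat \<Rightarrow> 'a) set" where
  "null_seqs S \<phi> = {x \<in> carrier (seq_module S \<phi>). \<exists>K. \<forall>k\<ge>K. x k = \<zero>\<^bsub>S k\<^esub>}"

definition ddot_map ::
  "(nat \<Rightarrow> 'a opsys) \<Rightarrow> (nat \<Rightarrow> 'a \<Rightarrow> 'a) \<Rightarrow> nat \<Rightarrow> 'a \<Rightarrow> (nat \<Rightarrow> 'a) set" where
  "ddot_map S \<phi> k x =
     null_seqs S \<phi> +>\<^bsub>seq_module S \<phi>\<^esub> (\<lambda>i. if i < k then \<zero>\<^bsub>S i\<^esub> else connecting \<phi> k i x)"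

definition ddot_star ::
  "(nat \<Rightarrow> 'a opsys) \<Rightarrow> (nat \<Rightarrow> 'a \<Rightarrow> 'a) \<Rightarrow> (nat \<Rightarrow> 'a) set \<Rightarrow> (nat \<Rightarrow> 'a) set" where
  "ddot_star S \<phi> s =
     (THE t. \<exists>k. \<exists>x\<in>carrier (S k). s = ddot_map S \<phi> k x \<and> t = ddot_map S \<phi> k (star (S k) x))"

definition ddot_cone ::
  "(nat \<Rightarrow> 'a opsys) \<Rightarrow> (nat \<Rightarrow> 'a \<Rightarrow> 'a) \<Rightarrow> nat \<Rightarrow> (nat \<Rightarrow> 'a) set mat set" where
  "ddot_cone S \<phi> n =
     {map_mat (ddot_map S \<phi> k) X | k X.
        X \<in> carrier (matrix_space (S k) n) \<and>
        (\<exists>m\<ge>k. map_mat (connecting \<phi> k m) X \<in> cone (S m) n)}"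

text \<open>The units \<open>ddot_map S \<phi> k (ounit (S k))\<close> agree for all \<open>k\<close>, as the connecting maps are
  unital.\<close>

definition ddot_system :: "(nat \<Rightarrow> 'a opsys) \<Rightarrow> (nat \<Rightarrow> 'a \<Rightarrow> 'a) \<Rightarrow> (nat \<Rightarrow> 'a) set opsys" where
  "ddot_system S \<phi> =
    (let Q = quotient_module (seq_module S \<phi>) (null_seqs S \<phi>) in
     \<lparr>carrier = carrier Q, mult = mult Q, one = one Q, zero = zero Q, add = add Q,
      smult = smult Q,
      star = ddot_star S \<phi>,
      cone = ddot_cone S \<phi>,
      ounit = ddot_map S \<phi> 0 (ounit (S 0))\<rparr>)"

definition state_null :: "(nat \<Rightarrow> 'a opsys) \<Rightarrow> (nat \<Rightarrow> 'a \<Rightarrow> 'a) \<Rightarrow> (nat \<Rightarrow> 'a) set set" where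
  "state_null S \<phi> =
     {s \<in> carrier (ddot_system S \<phi>). \<forall>f. is_state (ddot_system S \<phi>) f \<longrightarrow> f s = 0}"

definition lim_map ::
  "(nat \<Rightarrow> 'a opsys) \<Rightarrow> (nat \<Rightarrow> 'a \<Rightarrow> 'a) \<Rightarrow> nat \<Rightarrow> 'a \<Rightarrow> (nat \<Rightarrow> 'a) set set" where
  "lim_map S \<phi> k x = state_null S \<phi> +>\<^bsub>ddot_system S \<phi>\<^esub> ddot_map S \<phi> k x"

definition lim_star_space ::
  "(nat \<Rightarrow> 'a opsys) \<Rightarrow> (nat \<Rightarrow> 'a \<Rightarrow> 'a) \<Rightarrow> (nat \<Rightarrow> 'a) set set star_space" where
  "lim_star_space S \<phi> =
    (let V = ddot_system S \<phi>; N = state_null S \<phi>; Q = quotient_module V N in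
     \<lparr>carrier = carrier Q, mult = mult Q, one = one Q, zero = zero Q, add = add Q,
      smult = smult Q,
      star = (\<lambda>A. \<Union>s\<in>A. N +>\<^bsub>V\<^esub> star V s)\<rparr>)"

definition lim_cone ::
  "(nat \<Rightarrow> 'a opsys) \<Rightarrow> (nat \<Rightarrow> 'a \<Rightarrow> 'a) \<Rightarrow> nat \<Rightarrow> (nat \<Rightarrow> 'a) set set mat set" where
  "lim_cone S \<phi> n =
     {map_mat (lim_map S \<phi> k) X | k X.
        X \<in> carrier (matrix_space (S k) n) \<and>
        map_mat (lim_map S \<phi> k) X \<in> hermitian (matrix_space (lim_star_space S \<phi>) n) \<and>
        (\<forall>r::real. 0 < r \<longrightarrow>
          (\<exists>l T. T \<in> carrier (matrix_space (S l) n) \<and>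
             elements_mat (map_mat (ddot_map S \<phi> l) T) \<subseteq> state_null S \<phi> \<and>
             map_mat (ddot_map S \<phi> k)
               ((complex_of_real r \<odot>\<^bsub>matrix_space (S k) n\<^esub> diag_of (S k) n (ounit (S k)))
                  \<oplus>\<^bsub>matrix_space (S k) n\<^esub> X)
             \<oplus>\<^bsub>matrix_space (ddot_system S \<phi>) n\<^esub> map_mat (ddot_map S \<phi> l) T
             \<in> cone (ddot_system S \<phi>) n))}"

definition lim_system ::
  "(nat \<Rightarrow> 'a opsys) \<Rightarrow> (nat \<Rightarrow> 'a \<Rightarrow> 'a) \<Rightarrow> (nat \<Rightarrow> 'a) set set opsys" where
  "lim_system S \<phi> =
    (let Q = lim_star_space S \<phi> in
     \<lparr>carrier = carrier Q, mult = mult Q, one = one Q, zero = zero Q, add = add Q,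
      smult = smult Q,
      star = star Q,
      cone = lim_cone S \<phi>,
      ounit = lim_map S \<phi> 0 (ounit (S 0))\<rparr>)"

end

theory Submission
  imports Defs
begin

text \<open>
  States of an operator system separate its points: a maximal cone that contains the positive
  cone and omits \<open>-e\<close> is the positive cone of a state.  Hence a unital completely positive map
  from $\ddot{S}_\infty$ into an operator system kills \<open>N\<close>, since composing it with the states of
  the target gives states of $\ddot{S}_\infty$.  The cones $D_n$ consist of those \<open>Y\<close> for which
  every \<open>r e + Y\<close> with \<open>r > 0\<close> is the image of a positive element of $\ddot{S}_\infty$, so
  positivity of the induced map on $D_n$ is the Archimedean property of the target.  That $D_n$ is
  proper follows by applying states to compressions by vectors and polarizing.
\<close>

section \<open>Complex vector spaces and matrices over them\<close>

text \<open>In the algebraic limit a matrix is positive when it becomes positive at some finite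
  level. For the matrices \<open>r e + X\<close> this level may depend on \<open>r\<close>, so the
  unit stays an order unit but can lose the Archimedean property; and order norms may decrease to
  zero along the system, so that nonzero elements can be invisible to every state. Both defects are
  repaired by one construction, carried out for an arbitrary space \<open>V\<close> that satisfies
  the surviving axioms: divide by the common kernel of the states, then enlarge the image cones. The
  correction \<open>T\<close> in the definition of D_n is the difference of two lifts of one matrix
  over the quotient. The involution takes care of itself: an order unit makes every hermitian
  element a difference of positive ones, so positive linear maps and states respect the star. The
  zero space counts as an operator system and has no states, which is why \<open>e = 0\<close> needs
  its own case when points are separated.\<close>

lemma complex_vectorspaceI:
  fixes V :: "(complex, 'a, 'm) module_scheme" (structure)
  assumes zero: "\<zero> \<in> carrier V"
    and add: "\<And>x y. x \<in> carrier V \<Longrightarrow> y \<in> carrier V \<Longrightarrow> x \<oplus> y \<in> carrier V"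
    and smult: "\<And>c x. x \<in> carrier V \<Longrightarrow> c \<odot> x \<in> carrier V"
    and assoc: "\<And>x y z. x \<in> carrier V \<Longrightarrow> y \<in> carrier V \<Longrightarrow> z \<in> carrier V \<Longrightarrow>
      (x \<oplus> y) \<oplus> z = x \<oplus> (y \<oplus> z)"
    and comm: "\<And>x y. x \<in> carrier V \<Longrightarrow> y \<in> carrier V \<Longrightarrow> x \<oplus> y = y \<oplus> x"
    and l_zero: "\<And>x. x \<in> carrier V \<Longrightarrow> \<zero> \<oplus> x = x"
    and smult_zero: "\<And>x. x \<in> carrier V \<Longrightarrow> 0 \<odot> x = \<zero>"
    and smult_one: "\<And>x. x \<in> carrier V \<Longrightarrow> 1 \<odot> x = x"
    and smult_add_l: "\<And>a b x. x \<in> carrier V \<Longrightarrow> (a + b) \<odot> x = a \<odot> x \<oplus> b \<odot> x"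
    and smult_add_r: "\<And>a x y. x \<in> carrier V \<Longrightarrow> y \<in> carrier V \<Longrightarrow> a \<odot> (x \<oplus> y) = a \<odot> x \<oplus> a \<odot> y"
    and smult_smult: "\<And>a b x. x \<in> carrier V \<Longrightarrow> (a * b) \<odot> x = a \<odot> (b \<odot> x)"
  shows "vectorspace class_ring V"
proof -
  \<comment> \<open>Negatives are multiples by the scalar \<open>-1\<close>, so the premises list no
    inverses.\<close>
  have inv: "\<exists>y\<in>carrier V. y \<oplus> x = \<zero>" if x: "x \<in> carrier V" for x
  proof
    show "(-1) \<odot> x \<in> carrier V" using x by (rule smult)
    show "(-1) \<odot> x \<oplus> x = \<zero>"
      using smult_add_l[OF x, of "-1" 1] x by (simp add: smult_one smult_zero)
  qed
  have "abelian_group V"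
    by (rule abelian_groupI) (use assms inv in auto)
  moreover have "cring (class_ring :: complex ring)"
    using class_field unfolding field_def domain_def by blast
  ultimately have "Module.module class_ring V"
    by (intro moduleI) (use assms in auto)
  then show ?thesis
    using class_field by (simp add: vectorspace_def)
qed

text \<open>The scalar laws are restated with the operations of the complex numbers instead of those
  of \<open>class_ring\<close>, so that they work as rewrite rules. Subtraction is always turned
  into \<open>x \<oplus> (-1) \<odot> y\<close>, which leaves only linear identities to
  check.\<close>

locale complex_vs = vectorspace "class_ring :: complex ring" V
  for V :: "(complex, 'a, 'm) module_scheme" (structure)
begin

lemma zero_in [simp]: "\<zero> \<in> carrier V"
  by simp

lemma add_in [simp]: "x \<in> carrier V \<Longrightarrow> y \<in> carrier V \<Longrightarrow> x \<oplus> y \<in> carrier V"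
  by simp

lemma smult_in [simp]: "x \<in> carrier V \<Longrightarrow> c \<odot> x \<in> carrier V"
  by simp

lemma smult_add_l: "x \<in> carrier V \<Longrightarrow> (a + b) \<odot> x = a \<odot> x \<oplus> b \<odot> x"
  using smult_l_distr[of a b x] by simp

lemma smult_add_r: "x \<in> carrier V \<Longrightarrow> y \<in> carrier V \<Longrightarrow> a \<odot> (x \<oplus> y) = a \<odot> x \<oplus> a \<odot> y"
  using smult_r_distr[of a x y] by simp

lemma smult_smult: "x \<in> carrier V \<Longrightarrow> a \<odot> (b \<odot> x) = (a * b) \<odot> x"
  using smult_assoc1[of a b x] by simp

lemma smult_1 [simp]: "x \<in> carrier V \<Longrightarrow> 1 \<odot> x = x"
  using smult_one[of x] by simp

lemma smult_0 [simp]: "x \<in> carrier V \<Longrightarrow> 0 \<odot> x = \<zero>"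
  using smult_l_null[of x] by simp

lemma smult_zero [simp]: "c \<odot> \<zero> = \<zero>"
  using smult_r_null[of c] by simp

lemma uminus_smult: "x \<in> carrier V \<Longrightarrow> \<ominus> x = (-1) \<odot> x"
  using smult_l_minus[of 1 x] by (simp add: class_ring_simps)

lemma minus_smult: "x \<in> carrier V \<Longrightarrow> y \<in> carrier V \<Longrightarrow> x \<ominus> y = x \<oplus> (-1) \<odot> y"
  using uminus_smult[of y] by (simp add: a_minus_def)

lemma add_neg [simp]: "x \<in> carrier V \<Longrightarrow> x \<oplus> (-1) \<odot> x = \<zero>"
  using smult_add_l[of x 1 "-1"] by simp

lemma neg_add [simp]: "x \<in> carrier V \<Longrightarrow> (-1) \<odot> x \<oplus> x = \<zero>"
  using smult_add_l[of x "-1" 1] by simp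

lemma add_assoc: "x \<in> carrier V \<Longrightarrow> y \<in> carrier V \<Longrightarrow> z \<in> carrier V \<Longrightarrow>
    (x \<oplus> y) \<oplus> z = x \<oplus> (y \<oplus> z)"
  by (rule M.a_assoc)

lemma add_comm: "x \<in> carrier V \<Longrightarrow> y \<in> carrier V \<Longrightarrow> x \<oplus> y = y \<oplus> x"
  by (rule M.a_comm)

lemma add_lcomm: "x \<in> carrier V \<Longrightarrow> y \<in> carrier V \<Longrightarrow> z \<in> carrier V \<Longrightarrow>
    x \<oplus> (y \<oplus> z) = y \<oplus> (x \<oplus> z)"
  by (rule M.a_lcomm)

lemmas add_ac = add_assoc add_comm add_lcomm

lemma neg_add_cancel [simp]: "x \<in> carrier V \<Longrightarrow> y \<in> carrier V \<Longrightarrow> (-1) \<odot> x \<oplus> (x \<oplus> y) = y"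
  "x \<in> carrier V \<Longrightarrow> y \<in> carrier V \<Longrightarrow> x \<oplus> ((-1) \<odot> x \<oplus> y) = y"
  by (simp_all flip: add_assoc)

lemma eq_iff_diff_zero:
  assumes "x \<in> carrier V" "y \<in> carrier V"
  shows "x = y \<longleftrightarrow> x \<oplus> (-1) \<odot> y = \<zero>"
proof
  assume "x \<oplus> (-1) \<odot> y = \<zero>"
  then have "(x \<oplus> (-1) \<odot> y) \<oplus> y = y" using assms by simp
  then show "x = y" using assms by (simp add: add_assoc)
qed (use assms in simp)

lemma finsum_in: "(\<And>i. i \<in> A \<Longrightarrow> f i \<in> carrier V) \<Longrightarrow> finsum V f A \<in> carrier V"
  by (intro M.finsum_closed) auto

lemma finsum_add: "(\<And>i. i \<in> A \<Longrightarrow> f i \<in> carrier V) \<Longrightarrow> (\<And>i. i \<in> A \<Longrightarrow> g i \<in> carrier V) \<Longrightarrow>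
    finsum V (\<lambda>i. f i \<oplus> g i) A = finsum V f A \<oplus> finsum V g A"
  by (intro M.finsum_addf) auto

lemma finsum_smult: "finite A \<Longrightarrow> (\<And>i. i \<in> A \<Longrightarrow> f i \<in> carrier V) \<Longrightarrow>
    finsum V (\<lambda>i. c \<odot> f i) A = c \<odot> finsum V f A"
  using finsum_smult_ldistr[of A c f] by (simp add: Pi_def)

lemma finsum_cong_in: "(\<And>i. i \<in> A \<Longrightarrow> f i \<in> carrier V) \<Longrightarrow> (\<And>i. i \<in> A \<Longrightarrow> f i = g i) \<Longrightarrow>
    finsum V f A = finsum V g A"
  by (intro M.finsum_cong') auto

text \<open>Entries of a \<open>compression\<close> are double sums; the rules for them are
  collected here so that membership in the carrier is discharged once per summand.\<close>

lemma finsum2_add: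
  assumes "\<And>p q. p \<in> A \<Longrightarrow> q \<in> B \<Longrightarrow> f p q \<in> carrier V"
    and "\<And>p q. p \<in> A \<Longrightarrow> q \<in> B \<Longrightarrow> g p q \<in> carrier V"
  shows "(\<Oplus>p\<in>A. \<Oplus>q\<in>B. f p q \<oplus> g p q) = (\<Oplus>p\<in>A. \<Oplus>q\<in>B. f p q) \<oplus> (\<Oplus>p\<in>A. \<Oplus>q\<in>B. g p q)"
proof -
  have "(\<Oplus>p\<in>A. \<Oplus>q\<in>B. f p q \<oplus> g p q) = (\<Oplus>p\<in>A. (\<Oplus>q\<in>B. f p q) \<oplus> (\<Oplus>q\<in>B. g p q))"
    using assms by (intro finsum_cong_in finsum_add finsum_in add_in) auto
  also have "\<dots> = (\<Oplus>p\<in>A. \<Oplus>q\<in>B. f p q) \<oplus> (\<Oplus>p\<in>A. \<Oplus>q\<in>B. g p q)"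
    using assms by (intro finsum_add finsum_in) auto
  finally show ?thesis .
qed

lemma finsum2_smult:
  assumes "finite A" "finite B" "\<And>p q. p \<in> A \<Longrightarrow> q \<in> B \<Longrightarrow> f p q \<in> carrier V"
  shows "(\<Oplus>p\<in>A. \<Oplus>q\<in>B. c \<odot> f p q) = c \<odot> (\<Oplus>p\<in>A. \<Oplus>q\<in>B. f p q)"
proof -
  have "(\<Oplus>p\<in>A. \<Oplus>q\<in>B. c \<odot> f p q) = (\<Oplus>p\<in>A. c \<odot> (\<Oplus>q\<in>B. f p q))"
    using assms by (intro finsum_cong_in finsum_smult finsum_in smult_in) auto
  also have "\<dots> = c \<odot> (\<Oplus>p\<in>A. \<Oplus>q\<in>B. f p q)"
    using assms by (intro finsum_smult finsum_in) auto
  finally show ?thesis .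
qed

lemma finsum2_cong:
  assumes "\<And>p q. p \<in> A \<Longrightarrow> q \<in> B \<Longrightarrow> f p q \<in> carrier V"
    and "\<And>p q. p \<in> A \<Longrightarrow> q \<in> B \<Longrightarrow> f p q = g p q"
  shows "(\<Oplus>p\<in>A. \<Oplus>q\<in>B. f p q) = (\<Oplus>p\<in>A. \<Oplus>q\<in>B. g p q)"
  using assms by (intro finsum_cong_in finsum_in) auto

end

sublocale star_vector_space \<subseteq> complex_vs V
  by unfold_locales

text \<open>A surjection that respects the operations carries every identity from \<open>V\<close>
  to \<open>W\<close>. It is meant for coset maps, where the elements of \<open>W\<close> are sets
  and a direct check would be clumsy.\<close>

lemma complex_vs_image:
  fixes V :: "(complex, 'a, 'm) module_scheme" and W :: "(complex, 'b, 'k) module_scheme"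
  assumes "complex_vs V"
    and carr: "carrier W = q ` carrier V"
    and zero: "q \<zero>\<^bsub>V\<^esub> = \<zero>\<^bsub>W\<^esub>"
    and add: "\<And>x y. x \<in> carrier V \<Longrightarrow> y \<in> carrier V \<Longrightarrow> q x \<oplus>\<^bsub>W\<^esub> q y = q (x \<oplus>\<^bsub>V\<^esub> y)"
    and smult: "\<And>c x. x \<in> carrier V \<Longrightarrow> c \<odot>\<^bsub>W\<^esub> q x = q (c \<odot>\<^bsub>V\<^esub> x)"
  shows "complex_vs W"
proof -
  interpret V: complex_vs V by fact
  note zero [symmetric, simp] add [simp] smult [simp]
  show ?thesis
    unfolding complex_vs_def
    by (rule complex_vectorspaceI)
      (auto simp: carr V.add_assoc V.smult_add_l V.smult_add_r V.smult_smult
        intro!: arg_cong[of _ _ q] V.add_comm)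
qed

lemma star_vector_space_image:
  fixes V :: "('a, 'm) star_space_scheme" and W :: "('b, 'k) star_space_scheme"
  assumes "star_vector_space V" "complex_vs W"
    and carr: "carrier W = q ` carrier V"
    and add: "\<And>x y. x \<in> carrier V \<Longrightarrow> y \<in> carrier V \<Longrightarrow> q x \<oplus>\<^bsub>W\<^esub> q y = q (x \<oplus>\<^bsub>V\<^esub> y)"
    and smult: "\<And>c x. x \<in> carrier V \<Longrightarrow> c \<odot>\<^bsub>W\<^esub> q x = q (c \<odot>\<^bsub>V\<^esub> x)"
    and star: "\<And>x. x \<in> carrier V \<Longrightarrow> star W (q x) = q (star V x)"
  shows "star_vector_space W"
proof -
  interpret V: star_vector_space V by fact
  interpret W: complex_vs W by fact
  note add [simp] smult [simp] star [simp]
  show ?thesis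
    by unfold_locales (auto simp: carr V.star_closed V.star_star V.star_add V.star_smult)
qed

lemma class_ring_hom_iff:
  "f \<in> LinearCombinations.module_hom (class_ring :: complex ring) V W \<longleftrightarrow>
     (\<forall>x\<in>carrier V. f x \<in> carrier W) \<and>
     (\<forall>x\<in>carrier V. \<forall>y\<in>carrier V. f (x \<oplus>\<^bsub>V\<^esub> y) = f x \<oplus>\<^bsub>W\<^esub> f y) \<and>
     (\<forall>c. \<forall>x\<in>carrier V. f (c \<odot>\<^bsub>V\<^esub> x) = c \<odot>\<^bsub>W\<^esub> f x)"
  unfolding LinearCombinations.module_hom_def by auto

locale complex_hom = V: complex_vs V + W: complex_vs W
  for V :: "(complex, 'a, 'm) module_scheme" and W :: "(complex, 'b, 'k) module_scheme" +
  fixes f :: "'a \<Rightarrow> 'b"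
  assumes hom: "f \<in> LinearCombinations.module_hom (class_ring :: complex ring) V W"
begin

lemma hom_in [simp]: "x \<in> carrier V \<Longrightarrow> f x \<in> carrier W"
  and hom_add: "x \<in> carrier V \<Longrightarrow> y \<in> carrier V \<Longrightarrow> f (x \<oplus>\<^bsub>V\<^esub> y) = f x \<oplus>\<^bsub>W\<^esub> f y"
  and hom_smult: "x \<in> carrier V \<Longrightarrow> f (c \<odot>\<^bsub>V\<^esub> x) = c \<odot>\<^bsub>W\<^esub> f x"
  using hom unfolding class_ring_hom_iff by auto

lemma hom_zero [simp]: "f \<zero>\<^bsub>V\<^esub> = \<zero>\<^bsub>W\<^esub>"
  using hom_smult[of "\<zero>\<^bsub>V\<^esub>" 0] by simp

lemma hom_finsum: "finite A \<Longrightarrow> (\<And>i. i \<in> A \<Longrightarrow> g i \<in> carrier V) \<Longrightarrow>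
    f (finsum V g A) = finsum W (\<lambda>i. f (g i)) A"
proof (induction A rule: finite_induct)
  case (insert a A)
  then show ?case
    using V.finsum_in[of A g]
    by (subst V.M.finsum_insert W.M.finsum_insert; auto simp: hom_add Pi_def)+
qed simp

lemma hom_finsum2:
  assumes "finite A" "finite B" "\<And>p q. p \<in> A \<Longrightarrow> q \<in> B \<Longrightarrow> g p q \<in> carrier V"
  shows "f (\<Oplus>\<^bsub>V\<^esub>p\<in>A. \<Oplus>\<^bsub>V\<^esub>q\<in>B. g p q) = (\<Oplus>\<^bsub>W\<^esub>p\<in>A. \<Oplus>\<^bsub>W\<^esub>q\<in>B. f (g p q))"
proof -
  have "f (\<Oplus>\<^bsub>V\<^esub>p\<in>A. \<Oplus>\<^bsub>V\<^esub>q\<in>B. g p q) = (\<Oplus>\<^bsub>W\<^esub>p\<in>A. f (\<Oplus>\<^bsub>V\<^esub>q\<in>B. g p q))"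
    using assms by (intro hom_finsum V.finsum_in) auto
  also have "\<dots> = (\<Oplus>\<^bsub>W\<^esub>p\<in>A. \<Oplus>\<^bsub>W\<^esub>q\<in>B. f (g p q))"
    using assms by (intro W.finsum_cong_in hom_finsum hom_in V.finsum_in) auto
  finally show ?thesis .
qed

end

section \<open>Matrices over a space, entrywise maps and compressions\<close>

lemma mem_matrix_space_iff:
  "X \<in> carrier (matrix_space V n) \<longleftrightarrow>
     dim_row X = n \<and> dim_col X = n \<and> (\<forall>i<n. \<forall>j<n. X $$ (i, j) \<in> carrier V)"
  by (fastforce simp: matrix_space_def elements_mat_def)

lemma matrix_space_simps:
  "\<zero>\<^bsub>matrix_space V n\<^esub> = mat n n (\<lambda>_. \<zero>\<^bsub>V\<^esub>)"
  "X \<oplus>\<^bsub>matrix_space V n\<^esub> Y = mat n n (\<lambda>ij. X $$ ij \<oplus>\<^bsub>V\<^esub> Y $$ ij)"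
  "c \<odot>\<^bsub>matrix_space V n\<^esub> X = map_mat (\<lambda>x. c \<odot>\<^bsub>V\<^esub> x) X"
  "star (matrix_space V n) X = mat n n (\<lambda>(i, j). star V (X $$ (j, i)))"
  by (simp_all add: matrix_space_def)

lemma matrix_spaceD:
  assumes "X \<in> carrier (matrix_space V n)"
  shows "dim_row X = n" "dim_col X = n" "i < n \<Longrightarrow> j < n \<Longrightarrow> X $$ (i, j) \<in> carrier V"
  using assms by (auto simp: mem_matrix_space_iff)

lemma elements_mat_subset_iff:
  "elements_mat X \<subseteq> A \<longleftrightarrow> (\<forall>i<dim_row X. \<forall>j<dim_col X. X $$ (i, j) \<in> A)"
  by (fastforce simp: elements_mat_def)

lemma complex_vs_matrix_space:
  assumes "complex_vs V"
  shows "complex_vs (matrix_space V n)"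
proof -
  interpret complex_vs V by fact
  show ?thesis
    unfolding complex_vs_def
    by (rule complex_vectorspaceI)
      (auto simp: mem_matrix_space_iff matrix_space_simps smult_add_l smult_add_r smult_smult
        add_assoc intro!: eq_matI, auto intro: add_comm)
qed

lemma star_vector_space_matrix_space:
  assumes "star_vector_space V"
  shows "star_vector_space (matrix_space V n)"
proof -
  interpret star_vector_space V by fact
  interpret M: complex_vs "matrix_space V n"
    by (rule complex_vs_matrix_space) unfold_locales
  show ?thesis
    by unfold_locales
      (auto simp: mem_matrix_space_iff matrix_space_simps star_closed star_star star_add star_smult
        intro!: eq_matI)
qed

lemma diag_of_in: "complex_vs V \<Longrightarrow> x \<in> carrier V \<Longrightarrow> diag_of V n x \<in> carrier (matrix_space V n)"
  using complex_vs.zero_in by (auto simp: mem_matrix_space_iff diag_of_def)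

text \<open>The content is that of \<open>complex_hom\<close>, at the record types that
  \<open>matrix_space\<close> and \<open>diag_of\<close> expect. Compatibility with the star is not
  part of it; for positive maps it is derived.\<close>

locale entrywise_hom = complex_hom V W f
  for V :: "('a, 'm) star_space_scheme" and W :: "('b, 'k) star_space_scheme" and f
begin

lemma map_mat_hom:
  "map_mat f \<in> LinearCombinations.module_hom (class_ring :: complex ring)
     (matrix_space V n) (matrix_space W n)"
  unfolding class_ring_hom_iff
  by (auto simp: mem_matrix_space_iff matrix_space_simps hom_add hom_smult intro!: eq_matI)

lemma complex_hom_map_mat: "complex_hom (matrix_space V n) (matrix_space W n) (map_mat f)"
  unfolding complex_hom_def complex_hom_axioms_def
  by (intro conjI map_mat_hom complex_vs_matrix_space V.complex_vs_axioms W.complex_vs_axioms)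

lemma map_mat_diag_of: "map_mat f (diag_of V n x) = diag_of W n (f x)"
  by (rule eq_matI) (auto simp: diag_of_def)

text \<open>Each entry of a compression is a linear combination of entries of \<open>X\<close>, and
  \<open>f\<close> is linear.\<close>

lemma map_mat_compression:
  assumes "X \<in> carrier (matrix_space V n)"
  shows "map_mat f (compression V n m \<alpha> X) = compression W n m \<alpha> (map_mat f X)"
proof (rule eq_matI)
  note X = matrix_spaceD[OF assms]
  fix i j assume "i < dim_row (compression W n m \<alpha> (map_mat f X))"
    "j < dim_col (compression W n m \<alpha> (map_mat f X))"
  then have ij: "i < m" "j < m" by (simp_all add: compression_def)
  have "f (\<Oplus>\<^bsub>V\<^esub>p\<in>{..<n}. \<Oplus>\<^bsub>V\<^esub>q\<in>{..<n}. (cnj (\<alpha> $$ (p, i)) * \<alpha> $$ (q, j)) \<odot>\<^bsub>V\<^esub> X $$ (p, q)) =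
      (\<Oplus>\<^bsub>W\<^esub>p\<in>{..<n}. \<Oplus>\<^bsub>W\<^esub>q\<in>{..<n}.
        f ((cnj (\<alpha> $$ (p, i)) * \<alpha> $$ (q, j)) \<odot>\<^bsub>V\<^esub> X $$ (p, q)))"
    using X by (intro hom_finsum2) auto
  also have "\<dots> = (\<Oplus>\<^bsub>W\<^esub>p\<in>{..<n}. \<Oplus>\<^bsub>W\<^esub>q\<in>{..<n}.
        (cnj (\<alpha> $$ (p, i)) * \<alpha> $$ (q, j)) \<odot>\<^bsub>W\<^esub> map_mat f X $$ (p, q))"
    using X by (intro W.finsum2_cong) (auto simp: hom_smult)
  finally show "map_mat f (compression V n m \<alpha> X) $$ (i, j) =
      compression W n m \<alpha> (map_mat f X) $$ (i, j)"
    using ij by (simp add: compression_def)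
qed (simp_all add: compression_def)

end

lemma compression_in:
  assumes "complex_vs V" "X \<in> carrier (matrix_space V n)"
  shows "compression V n m \<alpha> X \<in> carrier (matrix_space V m)"
proof -
  interpret complex_vs V by fact
  show ?thesis
    using matrix_spaceD[OF assms(2)]
    by (auto simp: compression_def mem_matrix_space_iff intro!: finsum_in)
qed

lemma complex_hom_compression:
  assumes "complex_vs V"
  shows "complex_hom (matrix_space V n) (matrix_space V m) (compression V n m \<alpha>)"
proof -
  interpret V: complex_vs V by fact
  have 1: "compression V n m \<alpha> (X \<oplus>\<^bsub>matrix_space V n\<^esub> Y) =
      compression V n m \<alpha> X \<oplus>\<^bsub>matrix_space V m\<^esub> compression V n m \<alpha> Y"
    if "X \<in> carrier (matrix_space V n)" "Y \<in> carrier (matrix_space V n)" for X Y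
  proof (rule eq_matI)
    note D = matrix_spaceD[OF that(1)] matrix_spaceD[OF that(2)]
    fix i j
    assume "i < dim_row (compression V n m \<alpha> X \<oplus>\<^bsub>matrix_space V m\<^esub> compression V n m \<alpha> Y)"
      "j < dim_col (compression V n m \<alpha> X \<oplus>\<^bsub>matrix_space V m\<^esub> compression V n m \<alpha> Y)"
    then have ij: "i < m" "j < m" by (simp_all add: matrix_space_simps)
    let ?c = "\<lambda>p q. cnj (\<alpha> $$ (p, i)) * \<alpha> $$ (q, j)"
    have "(\<Oplus>\<^bsub>V\<^esub>p\<in>{..<n}. \<Oplus>\<^bsub>V\<^esub>q\<in>{..<n}. ?c p q \<odot>\<^bsub>V\<^esub> (X $$ (p, q) \<oplus>\<^bsub>V\<^esub> Y $$ (p, q))) =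
        (\<Oplus>\<^bsub>V\<^esub>p\<in>{..<n}. \<Oplus>\<^bsub>V\<^esub>q\<in>{..<n}. ?c p q \<odot>\<^bsub>V\<^esub> X $$ (p, q) \<oplus>\<^bsub>V\<^esub> ?c p q \<odot>\<^bsub>V\<^esub> Y $$ (p, q))"
      using D by (intro V.finsum2_cong) (auto simp: V.smult_add_r)
    also have "\<dots> = (\<Oplus>\<^bsub>V\<^esub>p\<in>{..<n}. \<Oplus>\<^bsub>V\<^esub>q\<in>{..<n}. ?c p q \<odot>\<^bsub>V\<^esub> X $$ (p, q)) \<oplus>\<^bsub>V\<^esub>
        (\<Oplus>\<^bsub>V\<^esub>p\<in>{..<n}. \<Oplus>\<^bsub>V\<^esub>q\<in>{..<n}. ?c p q \<odot>\<^bsub>V\<^esub> Y $$ (p, q))"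
      using D by (intro V.finsum2_add) auto
    also have "(\<Oplus>\<^bsub>V\<^esub>p\<in>{..<n}. \<Oplus>\<^bsub>V\<^esub>q\<in>{..<n}. ?c p q \<odot>\<^bsub>V\<^esub> (X $$ (p, q) \<oplus>\<^bsub>V\<^esub> Y $$ (p, q))) =
        (\<Oplus>\<^bsub>V\<^esub>p\<in>{..<n}. \<Oplus>\<^bsub>V\<^esub>q\<in>{..<n}. ?c p q \<odot>\<^bsub>V\<^esub> (X \<oplus>\<^bsub>matrix_space V n\<^esub> Y) $$ (p, q))"
      using D by (intro V.finsum2_cong) (auto simp: matrix_space_simps)
    finally show "compression V n m \<alpha> (X \<oplus>\<^bsub>matrix_space V n\<^esub> Y) $$ (i, j) =
        (compression V n m \<alpha> X \<oplus>\<^bsub>matrix_space V m\<^esub> compression V n m \<alpha> Y) $$ (i, j)"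
      using ij by (simp add: compression_def matrix_space_simps(2)[of V m])
  qed (simp_all add: compression_def matrix_space_simps)
  have 2: "compression V n m \<alpha> (c \<odot>\<^bsub>matrix_space V n\<^esub> X) =
      c \<odot>\<^bsub>matrix_space V m\<^esub> compression V n m \<alpha> X"
    if "X \<in> carrier (matrix_space V n)" for X c
  proof (rule eq_matI)
    note D = matrix_spaceD[OF that]
    fix i j
    assume "i < dim_row (c \<odot>\<^bsub>matrix_space V m\<^esub> compression V n m \<alpha> X)"
      "j < dim_col (c \<odot>\<^bsub>matrix_space V m\<^esub> compression V n m \<alpha> X)"
    then have ij: "i < m" "j < m" by (simp_all add: matrix_space_simps compression_def)
    let ?c = "\<lambda>p q. cnj (\<alpha> $$ (p, i)) * \<alpha> $$ (q, j)"
    have "(\<Oplus>\<^bsub>V\<^esub>p\<in>{..<n}. \<Oplus>\<^bsub>V\<^esub>q\<in>{..<n}. ?c p q \<odot>\<^bsub>V\<^esub> (c \<odot>\<^bsub>matrix_space V n\<^esub> X) $$ (p, q)) =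
        (\<Oplus>\<^bsub>V\<^esub>p\<in>{..<n}. \<Oplus>\<^bsub>V\<^esub>q\<in>{..<n}. c \<odot>\<^bsub>V\<^esub> (?c p q \<odot>\<^bsub>V\<^esub> X $$ (p, q)))"
      using D by (intro V.finsum2_cong) (auto simp: matrix_space_simps V.smult_smult mult_ac)
    also have "\<dots> = c \<odot>\<^bsub>V\<^esub> (\<Oplus>\<^bsub>V\<^esub>p\<in>{..<n}. \<Oplus>\<^bsub>V\<^esub>q\<in>{..<n}. ?c p q \<odot>\<^bsub>V\<^esub> X $$ (p, q))"
      using D by (intro V.finsum2_smult) auto
    finally show "compression V n m \<alpha> (c \<odot>\<^bsub>matrix_space V n\<^esub> X) $$ (i, j) =
        (c \<odot>\<^bsub>matrix_space V m\<^esub> compression V n m \<alpha> X) $$ (i, j)"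
      using ij by (simp add: compression_def matrix_space_simps(3)[of V m])
  qed (simp_all add: compression_def matrix_space_simps)
  show ?thesis
    unfolding complex_hom_def complex_hom_axioms_def class_ring_hom_iff
    using complex_vs_matrix_space[OF assms] 1 2 compression_in[OF assms] by blast
qed

section \<open>Extension of positive functionals\<close>

context complex_vs
begin

text \<open>The order arguments combine multiples of the unit with multiples of one further vector.
  These rules do the bookkeeping of coefficients; the last one adds bounds such as
  \<open>r e - x\<close> and \<open>s e - y\<close>, with the common coefficient \<open>b\<close>
  being \<open>1\<close> or \<open>-1\<close>.\<close>

lemma lin2_add: "x \<in> carrier V \<Longrightarrow> y \<in> carrier V \<Longrightarrow>
    (a \<odot> x \<oplus> b \<odot> y) \<oplus> (c \<odot> x \<oplus> d \<odot> y) = (a + c) \<odot> x \<oplus> (b + d) \<odot> y"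
  by (simp add: smult_add_l add_ac)

lemma lin2_smult: "x \<in> carrier V \<Longrightarrow> y \<in> carrier V \<Longrightarrow>
    c \<odot> (a \<odot> x \<oplus> b \<odot> y) = (c * a) \<odot> x \<oplus> (c * b) \<odot> y"
  by (simp add: smult_add_r smult_smult)

lemma lin2_add': "x \<in> carrier V \<Longrightarrow> y \<in> carrier V \<Longrightarrow> z \<in> carrier V \<Longrightarrow>
    (a \<odot> z \<oplus> b \<odot> x) \<oplus> (c \<odot> z \<oplus> b \<odot> y) = (a + c) \<odot> z \<oplus> b \<odot> (x \<oplus> y)"
  by (simp add: smult_add_l smult_add_r add_ac)

end

context star_vector_space
begin

lemma hermitianD: "x \<in> hermitian V \<Longrightarrow> x \<in> carrier V" "x \<in> hermitian V \<Longrightarrow> star V x = x"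
  by (auto simp: hermitian_def)

lemma star_zero [simp]: "star V \<zero> = \<zero>"
  using star_smult[of \<zero> 0] star_closed[of \<zero>] by simp

lemma hermitian_zero [simp]: "\<zero> \<in> hermitian V"
  by (simp add: hermitian_def)

lemma hermitian_add: "x \<in> hermitian V \<Longrightarrow> y \<in> hermitian V \<Longrightarrow> x \<oplus> y \<in> hermitian V"
  by (simp add: hermitian_def star_add)

lemma hermitian_smult: "x \<in> hermitian V \<Longrightarrow> complex_of_real r \<odot> x \<in> hermitian V"
  by (simp add: hermitian_def star_smult)

lemma hermitian_neg: "x \<in> hermitian V \<Longrightarrow> (-1) \<odot> x \<in> hermitian V"
  using hermitian_smult[of x "-1"] by simp

definition re_part :: "'a \<Rightarrow> 'a" where
  "re_part x = (1/2) \<odot> x \<oplus> (1/2) \<odot> star V x"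

definition im_part :: "'a \<Rightarrow> 'a" where
  "im_part x = (-\<i>/2) \<odot> x \<oplus> (\<i>/2) \<odot> star V x"

lemma re_im_hermitian:
  assumes "x \<in> carrier V"
  shows "re_part x \<in> hermitian V" "im_part x \<in> hermitian V"
  using assms
  by (auto simp: re_part_def im_part_def hermitian_def star_closed star_add star_smult star_star
      add_comm)

lemma re_im_decomp:
  assumes "x \<in> carrier V"
  shows "x = re_part x \<oplus> \<i> \<odot> im_part x"
  using assms
  by (simp add: re_part_def im_part_def lin2_add lin2_smult star_closed)

lemma re_im_add:
  assumes "x \<in> carrier V" "y \<in> carrier V"
  shows "re_part (x \<oplus> y) = re_part x \<oplus> re_part y" "im_part (x \<oplus> y) = im_part x \<oplus> im_part y"
  using assms
  by (simp_all add: re_part_def im_part_def star_closed star_add smult_add_r add_ac)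

text \<open>This is the multiplication rule (a + ib)(u + iv) = (au - bv) + i(bu + av). It makes the
  complex extension of a real functional on the hermitian elements complex linear.\<close>

lemma re_im_smult:
  assumes "x \<in> carrier V"
  shows "re_part (c \<odot> x) = complex_of_real (Re c) \<odot> re_part x \<oplus> complex_of_real (- Im c) \<odot> im_part x"
    and "im_part (c \<odot> x) = complex_of_real (Im c) \<odot> re_part x \<oplus> complex_of_real (Re c) \<odot> im_part x"
proof -
  \<comment> \<open>The coefficients of \<open>x\<close> and of its star on the two sides of both
    claims.\<close>
  have *: "c / 2 = complex_of_real (Re c) * (1/2) + complex_of_real (- Im c) * (- \<i>/2)"
    "cnj c / 2 = complex_of_real (Re c) * (1/2) + complex_of_real (- Im c) * (\<i>/2)"
    "-\<i>/2 * c = complex_of_real (Im c) * (1/2) + complex_of_real (Re c) * (- \<i>/2)"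
    "\<i>/2 * cnj c = complex_of_real (Im c) * (1/2) + complex_of_real (Re c) * (\<i>/2)"
    by (simp_all add: complex_eq_iff)
  show "re_part (c \<odot> x) = complex_of_real (Re c) \<odot> re_part x \<oplus> complex_of_real (- Im c) \<odot> im_part x"
    unfolding re_part_def im_part_def using assms
    by (simp only: lin2_smult lin2_add star_closed star_smult smult_in smult_smult *[symmetric]) simp
  show "im_part (c \<odot> x) = complex_of_real (Im c) \<odot> re_part x \<oplus> complex_of_real (Re c) \<odot> im_part x"
    unfolding re_part_def im_part_def using assms
    by (simp only: lin2_smult lin2_add star_closed star_smult smult_in smult_smult *[symmetric])
qed

lemma re_part_hermitian: "x \<in> hermitian V \<Longrightarrow> re_part x = x"
  by (simp add: re_part_def hermitianD flip: smult_add_l)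

lemma im_part_hermitian: "x \<in> hermitian V \<Longrightarrow> im_part x = \<zero>"
  by (simp add: im_part_def hermitianD flip: smult_add_l)

text \<open>A maximal cone \<open>P\<close> above \<open>C\<close> that omits \<open>-e\<close> satisfies $P \cup -P = V_h$, so that it
  is the positive cone of the functional \<open>x \<mapsto> inf {r. r e - x \<in> P}\<close>.\<close>

lemma positive_functional_exists:
  assumes CH: "C \<subseteq> hermitian V"
    and C_add: "\<And>x y. x \<in> C \<Longrightarrow> y \<in> C \<Longrightarrow> x \<oplus> y \<in> C"
    and C_smult: "\<And>r x. 0 \<le> r \<Longrightarrow> x \<in> C \<Longrightarrow> complex_of_real r \<odot> x \<in> C"
    and e: "e \<in> C"
    and unit: "\<And>x. x \<in> hermitian V \<Longrightarrow> \<exists>r::real. 0 < r \<and> complex_of_real r \<odot> e \<oplus> (-1) \<odot> x \<in> C"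
    and proper: "(-1) \<odot> e \<notin> C"
  obtains g :: "'a \<Rightarrow> real" where
    "\<And>x y. x \<in> hermitian V \<Longrightarrow> y \<in> hermitian V \<Longrightarrow> g (x \<oplus> y) = g x + g y"
    "\<And>r x. x \<in> hermitian V \<Longrightarrow> g (complex_of_real r \<odot> x) = r * g x"
    "\<And>x. x \<in> C \<Longrightarrow> 0 \<le> g x"
    "g e = 1"
proof -
  define F where "F = {P. C \<subseteq> P \<and> P \<subseteq> hermitian V \<and> (\<forall>x\<in>P. \<forall>y\<in>P. x \<oplus> y \<in> P) \<and>
    (\<forall>r::real. 0 \<le> r \<longrightarrow> (\<forall>x\<in>P. complex_of_real r \<odot> x \<in> P)) \<and> (-1) \<odot> e \<notin> P}"
  have "\<exists>M\<in>F. \<forall>X\<in>F. M \<subseteq> X \<longrightarrow> X = M"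
  proof (rule subset_Zorn_nonempty)
    have "C \<in> F" using CH C_add C_smult proper unfolding F_def by blast
    then show "F \<noteq> {}" by blast
  next
    fix \<C> assume ne: "\<C> \<noteq> {}" and chain: "subset.chain F \<C>"
    have sub: "\<And>P. P \<in> \<C> \<Longrightarrow> P \<in> F" and lin: "\<And>P Q. P \<in> \<C> \<Longrightarrow> Q \<in> \<C> \<Longrightarrow> P \<subseteq> Q \<or> Q \<subseteq> P"
      using chain by (auto simp: subset_chain_def)
    have "x \<oplus> y \<in> \<Union>\<C>" if "x \<in> \<Union>\<C>" "y \<in> \<Union>\<C>" for x y
    proof -
      from that obtain P Q where PQ: "P \<in> \<C>" "Q \<in> \<C>" "x \<in> P" "y \<in> Q" by auto
      then obtain R where "R \<in> \<C>" "x \<in> R" "y \<in> R" using lin[of P Q] by auto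
      then show ?thesis using sub[of R] unfolding F_def by blast
    qed
    then show "\<Union>\<C> \<in> F" using sub ne unfolding F_def by blast
  qed
  then obtain P where PF: "P \<in> F" and max: "\<And>X. X \<in> F \<Longrightarrow> P \<subseteq> X \<Longrightarrow> X = P" by auto
  have CP: "x \<in> C \<Longrightarrow> x \<in> P"
    and PH: "x \<in> P \<Longrightarrow> x \<in> hermitian V"
    and P_add: "x \<in> P \<Longrightarrow> y \<in> P \<Longrightarrow> x \<oplus> y \<in> P"
    and P_smult: "0 \<le> r \<Longrightarrow> x \<in> P \<Longrightarrow> complex_of_real r \<odot> x \<in> P"
    and P_proper: "(-1) \<odot> e \<notin> P" for x y r
    using PF by (auto simp: F_def)
  have eH: "e \<in> hermitian V" using e CH by auto
  note in_carrier = hermitianD(1)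
  have ein [simp]: "e \<in> carrier V" using eH by (rule in_carrier)
  \<comment> \<open>A negative multiple of \<open>e\<close> in \<open>P\<close> could be rescaled to
    \<open>-e\<close>.\<close>
  have eP: "complex_of_real r \<odot> e \<in> P \<longleftrightarrow> 0 \<le> r" for r
  proof
    assume *: "complex_of_real r \<odot> e \<in> P"
    show "0 \<le> r"
    proof (rule ccontr)
      assume "\<not> 0 \<le> r"
      then have "complex_of_real (1 / - r) \<odot> (complex_of_real r \<odot> e) \<in> P"
        using * by (intro P_smult[OF _ *]) auto
      also have "complex_of_real (1 / - r) \<odot> (complex_of_real r \<odot> e) = (-1) \<odot> e"
        using \<open>\<not> 0 \<le> r\<close> by (simp add: smult_smult)
      finally show False using P_proper by simp
    qed
  qed (use e CP P_smult in auto)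
  have total: "x \<in> P \<or> (-1) \<odot> x \<in> P" if x: "x \<in> hermitian V" for x
  proof (cases "x \<in> P")
    case nx: False
    \<comment> \<open>The cone generated by \<open>P\<close> and \<open>x\<close>. If it omitted
      \<open>-e\<close>, maximality would give \<open>Q = P\<close> and hence put \<open>x\<close>
      into \<open>P\<close>.\<close>
    define Q where "Q = {p \<oplus> complex_of_real t \<odot> x | p t. p \<in> P \<and> 0 \<le> t}"
    have xc [simp]: "x \<in> carrier V" using x by (rule in_carrier)
    have zP: "\<zero> \<in> P" using P_smult[of 0 e] CP[OF e] by simp
    have "P \<subseteq> Q"
      unfolding Q_def
    proof
      fix p assume "p \<in> P"
      moreover from this have "p = p \<oplus> complex_of_real 0 \<odot> x" using PH in_carrier by simp
      ultimately show "p \<in> {p \<oplus> complex_of_real t \<odot> x | p t. p \<in> P \<and> 0 \<le> t}" by blast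
    qed
    moreover have "x \<in> Q"
    proof -
      have "x = \<zero> \<oplus> complex_of_real 1 \<odot> x" "0 \<le> (1::real)" by simp_all
      then show ?thesis unfolding Q_def using zP by blast
    qed
    moreover have Q_add: "a \<oplus> b \<in> Q" if ab: "a \<in> Q" "b \<in> Q" for a b
    proof -
      from ab obtain p q t s where *: "a = p \<oplus> complex_of_real t \<odot> x" "b = q \<oplus> complex_of_real s \<odot> x"
        "p \<in> P" "q \<in> P" "0 \<le> t" "0 \<le> s" by (auto simp: Q_def)
      have "a \<oplus> b = (p \<oplus> q) \<oplus> complex_of_real (t + s) \<odot> x"
        using PH in_carrier * by (simp add: smult_add_l add_ac)
      moreover have "p \<oplus> q \<in> P" "0 \<le> t + s" using * P_add by auto
      ultimately show ?thesis unfolding Q_def by blast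
    qed
    moreover have Q_smult: "complex_of_real r \<odot> a \<in> Q" if ra: "0 \<le> r" "a \<in> Q" for r a
    proof -
      from ra obtain p t where *: "a = p \<oplus> complex_of_real t \<odot> x" "p \<in> P" "0 \<le> t" by (auto simp: Q_def)
      have "complex_of_real r \<odot> a = complex_of_real r \<odot> p \<oplus> complex_of_real (r * t) \<odot> x"
        using PH in_carrier * by (simp add: smult_add_r smult_smult)
      moreover have "complex_of_real r \<odot> p \<in> P" "0 \<le> r * t" using * P_smult ra by auto
      ultimately show ?thesis unfolding Q_def by blast
    qed
    moreover have "Q \<subseteq> hermitian V"
      using PH x by (auto simp: Q_def intro!: hermitian_add hermitian_smult)
    moreover from \<open>P \<subseteq> Q\<close> have "C \<subseteq> Q" using CP by auto
    ultimately have "Q \<in> F" if "(-1) \<odot> e \<notin> Q"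
      unfolding F_def mem_Collect_eq using that by (intro conjI ballI allI impI)
    then have "(-1) \<odot> e \<in> Q"
      using max[of Q] nx \<open>P \<subseteq> Q\<close> \<open>x \<in> Q\<close> by auto
    then obtain p t where pt: "(-1) \<odot> e = p \<oplus> complex_of_real t \<odot> x" "p \<in> P" "0 \<le> t"
      by (auto simp: Q_def)
    have pc: "p \<in> carrier V" using PH in_carrier pt by auto
    have "t \<noteq> 0" using pt P_proper pc by auto
    \<comment> \<open>Solving \<open>-e = p + t x\<close> for \<open>x\<close> gives
      \<open>-x = (e + p) / t\<close>, which lies in \<open>P\<close>.\<close>
    have "e \<oplus> p \<in> P" using pt CP e P_add by auto
    then have "complex_of_real (1 / t) \<odot> (e \<oplus> p) \<in> P" using pt by (intro P_smult) auto
    also have "e \<oplus> p = complex_of_real (- t) \<odot> x"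
    proof -
      have "e \<oplus> p = e \<oplus> ((p \<oplus> complex_of_real t \<odot> x) \<oplus> complex_of_real (- t) \<odot> x)"
        using pc by (simp add: add_assoc flip: smult_add_l)
      also have "\<dots> = complex_of_real (- t) \<odot> x"
        unfolding pt(1)[symmetric] by simp
      finally show ?thesis .
    qed
    also have "complex_of_real (1 / t) \<odot> (complex_of_real (- t) \<odot> x) = (-1) \<odot> x"
      using \<open>t \<noteq> 0\<close> by (simp add: smult_smult)
    finally show ?thesis ..
  qed simp
  define A where "A = (\<lambda>x. {r. complex_of_real r \<odot> e \<oplus> (-1) \<odot> x \<in> P})"
  define g where "g = (\<lambda>x. Inf (A x))"
  have bounds: "A x \<noteq> {}" "bdd_below (A x)" if x: "x \<in> hermitian V" for x
  proof -
    have xc [simp]: "x \<in> carrier V" using x by (rule in_carrier)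
    show "A x \<noteq> {}" using unit[OF x] CP by (auto simp: A_def)
    obtain R where R: "complex_of_real R \<odot> e \<oplus> (-1) \<odot> ((-1) \<odot> x) \<in> P"
      using unit[OF hermitian_neg[OF x]] CP by auto
    \<comment> \<open>Adding \<open>R e + x\<close> and \<open>r e - x\<close> gives
      \<open>(R + r) e\<close> in \<open>P\<close>, and \<open>eP\<close> applies.\<close>
    have "- R \<le> r" if "r \<in> A x" for r
    proof -
      have "(complex_of_real R \<odot> e \<oplus> 1 \<odot> x) \<oplus> (complex_of_real r \<odot> e \<oplus> (-1) \<odot> x) \<in> P"
        using R that P_add by (simp add: A_def smult_smult)
      then have "complex_of_real (R + r) \<odot> e \<in> P"
        unfolding lin2_add[OF ein xc] by simp
      then show ?thesis unfolding eP by simp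
    qed
    then show "bdd_below (A x)" by (rule bdd_belowI)
  qed
  have upper: "g x \<le> r" if "x \<in> hermitian V" "complex_of_real r \<odot> e \<oplus> (-1) \<odot> x \<in> P" for x r
    unfolding g_def using bounds(2)[OF that(1)] that(2) by (intro cInf_lower) (auto simp: A_def)
  \<comment> \<open>The infimum need not be attained, but above it \<open>P\<close> absorbs
    nonnegative multiples of \<open>e\<close>.\<close>
  have upperD: "complex_of_real r \<odot> e \<oplus> (-1) \<odot> x \<in> P" if x: "x \<in> hermitian V" and r: "g x < r" for x r
  proof -
    have xc [simp]: "x \<in> carrier V" using x by (rule in_carrier)
    obtain s where s: "s \<in> A x" "s < r"
      using r cInf_less_iff[OF bounds[OF x], of r] unfolding g_def by blast
    have "(complex_of_real s \<odot> e \<oplus> (-1) \<odot> x) \<oplus> complex_of_real (r - s) \<odot> e \<in> P"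
      using s unfolding A_def by (intro P_add[OF _ iffD2[OF eP]]) simp_all
    also have "(complex_of_real s \<odot> e \<oplus> (-1) \<odot> x) \<oplus> complex_of_real (r - s) \<odot> e =
        (complex_of_real s \<odot> e \<oplus> (-1) \<odot> x) \<oplus> (complex_of_real (r - s) \<odot> e \<oplus> (-1) \<odot> \<zero>)"
      by simp
    also have "\<dots> = complex_of_real r \<odot> e \<oplus> (-1) \<odot> x"
      by (subst lin2_add') (auto simp del: of_real_diff simp flip: of_real_add)
    finally show ?thesis .
  qed
  have lower: "r \<le> g x" if x: "x \<in> hermitian V" and r: "complex_of_real (- r) \<odot> e \<oplus> x \<in> P" for x r
  proof (rule ccontr)
    assume "\<not> r \<le> g x"
    then have "g x < r" by simp
    from dense[OF this] obtain s where s: "g x < s" "s < r" by blast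
    have xc [simp]: "x \<in> carrier V" using x by (rule in_carrier)
    have "(complex_of_real (- r) \<odot> e \<oplus> 1 \<odot> x) \<oplus> (complex_of_real s \<odot> e \<oplus> (-1) \<odot> x) \<in> P"
      using r upperD[OF x s(1)] P_add by simp
    then have "complex_of_real (- r + s) \<odot> e \<in> P"
      unfolding lin2_add[OF ein xc] by simp
    then show False unfolding eP using s by simp
  qed
  \<comment> \<open>Here totality of \<open>P\<close> enters: below the infimum
    \<open>r e - x\<close> is not in \<open>P\<close>, so its negative is. Thus \<open>g x\<close>
    is also the supremum of the lower bounds of \<open>x\<close>.\<close>
  have lowerD: "complex_of_real (- r) \<odot> e \<oplus> x \<in> P" if x: "x \<in> hermitian V" and r: "r < g x" for x r
  proof -
    have xc [simp]: "x \<in> carrier V" using x by (rule in_carrier)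
    have "complex_of_real r \<odot> e \<oplus> (-1) \<odot> x \<notin> P" using upper[OF x, of r] r by auto
    moreover have "complex_of_real r \<odot> e \<oplus> (-1) \<odot> x \<in> hermitian V"
      using x eH by (intro hermitian_add hermitian_smult hermitian_neg)
    ultimately have "(-1) \<odot> (complex_of_real r \<odot> e \<oplus> (-1) \<odot> x) \<in> P" using total by blast
    then show ?thesis by (simp add: lin2_smult)
  qed
  \<comment> \<open>Adding upper bounds gives subadditivity, adding lower bounds gives
    superadditivity. The slack \<epsilon>/2 avoids evaluating the bounds at \<open>g x\<close>
    itself.\<close>
  have g_add: "g (x \<oplus> y) = g x + g y" if x: "x \<in> hermitian V" and y: "y \<in> hermitian V" for x y
  proof (rule antisym)
    have c [simp]: "x \<in> carrier V" "y \<in> carrier V" using x y in_carrier by auto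
    have xy: "x \<oplus> y \<in> hermitian V" using x y by (rule hermitian_add)
    show "g (x \<oplus> y) \<le> g x + g y"
    proof (rule field_le_epsilon)
      fix \<epsilon> :: real assume "0 < \<epsilon>"
      then have "(complex_of_real (g x + \<epsilon>/2) \<odot> e \<oplus> (-1) \<odot> x) \<oplus>
          (complex_of_real (g y + \<epsilon>/2) \<odot> e \<oplus> (-1) \<odot> y) \<in> P" (is "?l \<in> _")
        by (intro P_add[OF upperD upperD] x y) simp_all
      also have "?l = complex_of_real ((g x + \<epsilon>/2) + (g y + \<epsilon>/2)) \<odot> e \<oplus> (-1) \<odot> (x \<oplus> y)"
        unfolding of_real_add[of "g x + \<epsilon>/2" "g y + \<epsilon>/2"] by (rule lin2_add') simp_all
      finally have "g (x \<oplus> y) \<le> (g x + \<epsilon>/2) + (g y + \<epsilon>/2)" by (rule upper[OF xy])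
      then show "g (x \<oplus> y) \<le> g x + g y + \<epsilon>" by simp
    qed
    show "g x + g y \<le> g (x \<oplus> y)"
    proof (rule field_le_epsilon)
      fix \<epsilon> :: real assume "0 < \<epsilon>"
      then have "(complex_of_real (- (g x - \<epsilon>/2)) \<odot> e \<oplus> 1 \<odot> x) \<oplus>
          (complex_of_real (- (g y - \<epsilon>/2)) \<odot> e \<oplus> 1 \<odot> y) \<in> P" (is "?l \<in> _")
        unfolding smult_1[OF c(1)] smult_1[OF c(2)] by (intro P_add[OF lowerD lowerD] x y) simp_all
      also have "?l = complex_of_real (- (g x - \<epsilon>/2) + - (g y - \<epsilon>/2)) \<odot> e \<oplus> 1 \<odot> (x \<oplus> y)"
        unfolding of_real_add[of "- (g x - \<epsilon>/2)" "- (g y - \<epsilon>/2)"] by (rule lin2_add') simp_all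
      also have "\<dots> = complex_of_real (- ((g x - \<epsilon>/2) + (g y - \<epsilon>/2))) \<odot> e \<oplus> (x \<oplus> y)"
        by (simp add: algebra_simps)
      finally have "(g x - \<epsilon>/2) + (g y - \<epsilon>/2) \<le> g (x \<oplus> y)" by (rule lower[OF xy])
      then show "g x + g y \<le> g (x \<oplus> y) + \<epsilon>" by simp
    qed
  qed
  have g_zero: "g \<zero> = 0" using g_add[of \<zero> \<zero>] by simp
  have g_pos: "g (complex_of_real t \<odot> x) = t * g x" if x: "x \<in> hermitian V" and t: "0 < t" for x t
  proof (rule antisym)
    have c [simp]: "x \<in> carrier V" using x in_carrier by auto
    have tx: "complex_of_real t \<odot> x \<in> hermitian V" using x by (rule hermitian_smult)
    have "g (complex_of_real t \<odot> x) / t \<le> r" if r: "g x < r" for r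
    proof -
      have "complex_of_real t \<odot> (complex_of_real r \<odot> e \<oplus> (-1) \<odot> x) \<in> P" (is "?l \<in> _")
        using t by (intro P_smult[OF _ upperD[OF x r]]) simp
      also have "?l = complex_of_real (t * r) \<odot> e \<oplus> (-1) \<odot> (complex_of_real t \<odot> x)"
        by (simp add: lin2_smult smult_smult)
      finally have "g (complex_of_real t \<odot> x) \<le> t * r" by (rule upper[OF tx])
      then show ?thesis using t by (simp add: field_simps)
    qed
    then have "g (complex_of_real t \<odot> x) / t \<le> g x" by (rule dense_ge)
    then show "g (complex_of_real t \<odot> x) \<le> t * g x" using t by (simp add: field_simps)
    have "r \<le> g (complex_of_real t \<odot> x) / t" if r: "r < g x" for r
    proof -
      have "complex_of_real t \<odot> (complex_of_real (- r) \<odot> e \<oplus> x) \<in> P" (is "?l \<in> _")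
        using t by (intro P_smult[OF _ lowerD[OF x r]]) simp
      also have "?l = complex_of_real (- (t * r)) \<odot> e \<oplus> complex_of_real t \<odot> x"
        by (simp add: smult_add_r smult_smult)
      finally have "t * r \<le> g (complex_of_real t \<odot> x)" by (rule lower[OF tx])
      then show ?thesis using t by (simp add: field_simps)
    qed
    then have "g x \<le> g (complex_of_real t \<odot> x) / t" by (rule dense_le)
    then show "t * g x \<le> g (complex_of_real t \<odot> x)" using t by (simp add: field_simps)
  qed
  have g_neg: "g ((-1) \<odot> x) = - g x" if x: "x \<in> hermitian V" for x
    using g_add[OF x hermitian_neg[OF x]] g_zero in_carrier[OF x] by simp
  have "g (complex_of_real t \<odot> x) = t * g x" if x: "x \<in> hermitian V" for x t
  proof -
    have c: "x \<in> carrier V" using x in_carrier by auto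
    consider "t = 0" | "0 < t" | "0 < - t" by linarith
    then show ?thesis
    proof cases
      case 3
      have "complex_of_real t \<odot> x = (-1) \<odot> (complex_of_real (- t) \<odot> x)"
        using c by (simp add: smult_smult)
      then show ?thesis
        using g_neg[OF hermitian_smult[OF x, of "- t"]] g_pos[OF x 3] by simp
    qed (use c g_zero g_pos[OF x] in auto)
  qed
  moreover have "0 \<le> g x" if "x \<in> C" for x
    using lower[of x 0] CP[OF that] PH in_carrier by simp
  moreover have "g e = 1"
  proof (rule antisym)
    show "g e \<le> 1" using upper[OF eH, of 1] eP[of 0] by simp
    show "1 \<le> g e" using lower[OF eH, of 1] eP[of 0] by simp
  qed
  ultimately show ?thesis by (intro that[of g] g_add)
qed

end

section \<open>Matrix ordered spaces and states\<close>

lemma complex_vs_complex_module: "complex_vs complex_module"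
  unfolding complex_vs_def
  by (rule complex_vectorspaceI) (auto simp: complex_module_def algebra_simps)

lemma complex_module_simps [simp]:
  "carrier complex_module = UNIV"
  "\<zero>\<^bsub>complex_module\<^esub> = 0"
  "x \<oplus>\<^bsub>complex_module\<^esub> y = x + y"
  "c \<odot>\<^bsub>complex_module\<^esub> x = c * x"
  by (simp_all add: complex_module_def)

lemma finsum_complex_module: "finite A \<Longrightarrow> finsum complex_module f A = sum f A"
proof (induction A rule: finite_induct)
  interpret complex_vs complex_module by (rule complex_vs_complex_module)
  {
    case empty
    show ?case by simp
  next
    case (insert a A)
    then show ?case by (subst M.finsum_insert) auto
  }
qed

text \<open>Both sides are antilinear in \<open>x\<close>, so agreement on the two hermitian parts
  of \<open>x\<close> suffices. The conjugation \<open>J\<close> is a parameter because it is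
  complex conjugation for states and the star of the target for maps into another space.\<close>

lemma (in star_vector_space) hom_star:
  assumes "complex_hom V W f"
    and J_add: "\<And>x y. x \<in> carrier W \<Longrightarrow> y \<in> carrier W \<Longrightarrow> J (x \<oplus>\<^bsub>W\<^esub> y) = J x \<oplus>\<^bsub>W\<^esub> J y"
    and J_smult: "\<And>c x. x \<in> carrier W \<Longrightarrow> J (c \<odot>\<^bsub>W\<^esub> x) = cnj c \<odot>\<^bsub>W\<^esub> J x"
    and herm: "\<And>x. x \<in> hermitian V \<Longrightarrow> J (f x) = f x"
    and x: "x \<in> carrier V"
  shows "f (star V x) = J (f x)"
proof -
  interpret complex_hom V W f by fact
  note h = re_im_hermitian[OF x]
  note c = hermitianD(1)[OF h(1)] hermitianD(1)[OF h(2)]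
  have "star V x = re_part x \<oplus> (-\<i>) \<odot> im_part x"
    using c h by (subst re_im_decomp[OF x]) (simp add: star_add star_smult hermitianD(2))
  then have "f (star V x) = f (re_part x) \<oplus>\<^bsub>W\<^esub> (-\<i>) \<odot>\<^bsub>W\<^esub> f (im_part x)"
    using c by (simp add: hom_add hom_smult)
  also have "\<dots> = J (f (re_part x) \<oplus>\<^bsub>W\<^esub> \<i> \<odot>\<^bsub>W\<^esub> f (im_part x))"
    using c h herm by (simp add: J_add J_smult)
  also have "\<dots> = J (f x)"
    using c by (subst (3) re_im_decomp[OF x]) (simp add: hom_add hom_smult)
  finally show ?thesis .
qed

text \<open>The real functional \<open>g\<close> on hermitian elements extends to
  \<open>g (re_part x) + i g (im_part x)\<close>. The cone is a parameter since the application uses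
  one that is larger than the positive cone of the space.\<close>

lemma (in star_vector_space) state_on_cone_exists:
  assumes CH: "C \<subseteq> hermitian V"
    and C_add: "\<And>x y. x \<in> C \<Longrightarrow> y \<in> C \<Longrightarrow> x \<oplus> y \<in> C"
    and C_smult: "\<And>r x. 0 \<le> r \<Longrightarrow> x \<in> C \<Longrightarrow> complex_of_real r \<odot> x \<in> C"
    and e: "e \<in> C"
    and unit: "\<And>x. x \<in> hermitian V \<Longrightarrow> \<exists>r::real. 0 < r \<and> complex_of_real r \<odot> e \<oplus> (-1) \<odot> x \<in> C"
    and proper: "(-1) \<odot> e \<notin> C"
  obtains f where
    "f \<in> LinearCombinations.module_hom (class_ring :: complex ring) V complex_module"
    "\<And>x. x \<in> C \<Longrightarrow> f x \<in> \<real>\<^sub>\<ge>\<^sub>0"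
    "f e = 1"
proof -
  obtain g where g: "\<And>x y. x \<in> hermitian V \<Longrightarrow> y \<in> hermitian V \<Longrightarrow> g (x \<oplus> y) = g x + g y"
    "\<And>r x. x \<in> hermitian V \<Longrightarrow> g (complex_of_real r \<odot> x) = r * g x"
    "\<And>x. x \<in> C \<Longrightarrow> 0 \<le> g x"
    "g e = 1"
    by (rule positive_functional_exists[OF assms]) (assumption, blast+)
  have g0: "g \<zero> = 0" using g(2)[of \<zero> 0] by simp
  define f where "f x = Complex (g (re_part x)) (g (im_part x))" for x
  have fH: "f x = complex_of_real (g x)" if "x \<in> hermitian V" for x
    using that by (simp add: f_def re_part_hermitian im_part_hermitian g0 complex_eq_iff)
  show ?thesis
  proof (rule that[of f])
    show "f \<in> LinearCombinations.module_hom (class_ring :: complex ring) V complex_module"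
      unfolding class_ring_hom_iff
      by (auto simp: f_def re_im_add re_im_smult re_im_hermitian g(1) g(2) hermitian_smult
          complex_eq_iff simp del: of_real_minus)
    show "f x \<in> \<real>\<^sub>\<ge>\<^sub>0" if "x \<in> C" for x
      using fH[of x] that CH g(3)[OF that] by auto
    show "f e = 1" using fH[of e] e CH g(4) by auto
  qed
qed

text \<open>The axioms of an operator system without properness and the Archimedean property, so
  that the given systems and their algebraic limit are both instances.\<close>

locale matrix_preordered = star_vector_space V
  for V :: "('a, 'm) opsys_scheme" (structure) +
  assumes is_cone_cone: "0 < n \<Longrightarrow> is_cone (matrix_space V n) (cone V n)"
    and compression_cone: "0 < n \<Longrightarrow> 0 < m \<Longrightarrow> \<alpha> \<in> carrier_mat n m \<Longrightarrow> X \<in> cone V n \<Longrightarrow>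
      compression V n m \<alpha> X \<in> cone V m"
    and unit_cone_1: "diag_of V 1 (ounit V) \<in> cone V 1"
    and order_unit_ounit: "0 < n \<Longrightarrow>
      order_unit (matrix_space V n) (cone V n) (diag_of V n (ounit V))"

sublocale operator_system \<subseteq> matrix_preordered
  by unfold_locales (fact cone_is_cone cone_compression ounit_pos ounit_order_unit)+

lemma complex_hom_diag_of:
  assumes "complex_vs V"
  shows "complex_hom V (matrix_space V n) (diag_of V n)"
proof -
  interpret complex_vs V by fact
  show ?thesis
    unfolding complex_hom_def complex_hom_axioms_def class_ring_hom_iff
    by (intro conjI assms complex_vs_matrix_space ballI allI diag_of_in)
      (auto simp: diag_of_def matrix_space_simps intro!: eq_matI)
qed

lemma mem_matrix_space_1:
  assumes "X \<in> carrier (matrix_space V 1)"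
  shows "X = diag_of V 1 (X $$ (0, 0))"
  using matrix_spaceD[OF assms] by (auto simp: diag_of_def intro!: eq_matI)

context matrix_preordered
begin

abbreviation "M \<equiv> matrix_space V"

lemma star_vector_space_M: "star_vector_space (M n)"
  by (rule star_vector_space_matrix_space) unfold_locales

sublocale M: star_vector_space "matrix_space V n" for n
  by (rule star_vector_space_M)

sublocale diag: complex_hom V "matrix_space V n" "diag_of V n" for n
  by (rule complex_hom_diag_of) unfold_locales

sublocale compr: complex_hom "matrix_space V n" "matrix_space V m" "compression V n m \<alpha>" for n m \<alpha>
  by (rule complex_hom_compression) unfold_locales

lemma cone_hermitian: "0 < n \<Longrightarrow> X \<in> cone V n \<Longrightarrow> X \<in> hermitian (M n)"
  and cone_add: "0 < n \<Longrightarrow> X \<in> cone V n \<Longrightarrow> Y \<in> cone V n \<Longrightarrow> X \<oplus>\<^bsub>M n\<^esub> Y \<in> cone V n"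
  and cone_smult: "0 < n \<Longrightarrow> 0 \<le> r \<Longrightarrow> X \<in> cone V n \<Longrightarrow> complex_of_real r \<odot>\<^bsub>M n\<^esub> X \<in> cone V n"
  using is_cone_cone[of n] unfolding is_cone_def by auto

lemma cone_in: "0 < n \<Longrightarrow> X \<in> cone V n \<Longrightarrow> X \<in> carrier (M n)"
  by (rule M.hermitianD(1)[OF cone_hermitian])

lemma ounit_in [simp]: "ounit V \<in> carrier V"
  using matrix_spaceD(3)[OF cone_in[OF _ unit_cone_1], of 0 0] by (simp add: diag_of_def)

lemma order_unitD:
  assumes "0 < n" "X \<in> hermitian (M n)"
  shows "\<exists>r::real. 0 < r \<and>
    complex_of_real r \<odot>\<^bsub>M n\<^esub> diag_of V n (ounit V) \<oplus>\<^bsub>M n\<^esub> (-1) \<odot>\<^bsub>M n\<^esub> X \<in> cone V n"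
proof -
  obtain r :: real where "0 < r"
    "complex_of_real r \<odot>\<^bsub>M n\<^esub> diag_of V n (ounit V) \<ominus>\<^bsub>M n\<^esub> X \<in> cone V n"
    using order_unit_ounit[OF assms(1)] assms(2) unfolding order_unit_def by blast
  then show ?thesis using M.hermitianD(1)[OF assms(2)] by (auto simp: M.minus_smult)
qed

text \<open>The order unit property at \<open>0\<close> puts some \<open>r e\<close> with
  \<open>r > 0\<close> into the cone, and division by \<open>r\<close> stays there.\<close>

lemma diag_ounit_cone: "0 < n \<Longrightarrow> diag_of V n (ounit V) \<in> cone V n"
proof -
  assume n: "0 < n"
  then obtain r :: real where r: "0 < r" and
    c: "complex_of_real r \<odot>\<^bsub>M n\<^esub> diag_of V n (ounit V) \<oplus>\<^bsub>M n\<^esub> (-1) \<odot>\<^bsub>M n\<^esub> \<zero>\<^bsub>M n\<^esub> \<in> cone V n"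
    using order_unitD[of n "\<zero>\<^bsub>M n\<^esub>"] by auto
  have "complex_of_real r \<odot>\<^bsub>M n\<^esub> diag_of V n (ounit V) \<in> cone V n" using c by simp
  then have "complex_of_real (1 / r) \<odot>\<^bsub>M n\<^esub> (complex_of_real r \<odot>\<^bsub>M n\<^esub> diag_of V n (ounit V)) \<in> cone V n"
    using r by (intro cone_smult[OF n _ \<open>complex_of_real r \<odot>\<^bsub>M n\<^esub> diag_of V n (ounit V) \<in> cone V n\<close>]) simp
  then show ?thesis using r by (simp add: M.smult_smult)
qed

lemma diag_ounit_hermitian: "0 < n \<Longrightarrow> diag_of V n (ounit V) \<in> hermitian (M n)"
  by (rule cone_hermitian[OF _ diag_ounit_cone])

lemma zero_cone: "0 < n \<Longrightarrow> \<zero>\<^bsub>M n\<^esub> \<in> cone V n"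
  using cone_smult[of n 0, OF _ _ diag_ounit_cone] by simp

lemma diag_1_inject: "diag_of V 1 x = diag_of V 1 y \<longleftrightarrow> x = y"
proof
  assume "diag_of V 1 x = diag_of V 1 y"
  then have "diag_of V 1 x $$ (0, 0) = diag_of V 1 y $$ (0, 0)" by simp
  then show "x = y" by (simp add: diag_of_def)
qed simp

lemma star_diag: "x \<in> carrier V \<Longrightarrow> star (M n) (diag_of V n x) = diag_of V n (star V x)"
  by (rule eq_matI) (auto simp: matrix_space_simps diag_of_def)

lemma diag_1_hermitian_iff: "diag_of V 1 x \<in> hermitian (M 1) \<longleftrightarrow> x \<in> hermitian V"
proof -
  have "diag_of V 1 x \<in> carrier (M 1) \<longleftrightarrow> x \<in> carrier V"
    by (auto simp: mem_matrix_space_iff diag_of_def)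
  then show ?thesis
    by (auto simp: hermitian_def star_diag diag_1_inject simp del: One_nat_def)
qed

text \<open>The cone at level one, moved into \<open>V\<close> by identifying a 1 by 1 matrix with
  its entry. Positivity of states refers to this set only.\<close>

definition positives :: "'a set" where
  "positives = {x. diag_of V 1 x \<in> cone V 1}"

lemma positives_hermitian: "x \<in> positives \<Longrightarrow> x \<in> hermitian V"
  using cone_hermitian[of 1 "diag_of V 1 x"] unfolding positives_def diag_1_hermitian_iff by simp

lemma positives_in: "x \<in> positives \<Longrightarrow> x \<in> carrier V"
  by (rule hermitianD(1)[OF positives_hermitian])

lemma positives_add: "x \<in> positives \<Longrightarrow> y \<in> positives \<Longrightarrow> x \<oplus> y \<in> positives"
  using cone_add[of 1] positives_in unfolding positives_def by (simp add: diag.hom_add)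

lemma positives_smult: "0 \<le> r \<Longrightarrow> x \<in> positives \<Longrightarrow> complex_of_real r \<odot> x \<in> positives"
  using cone_smult[of 1] positives_in unfolding positives_def by (simp add: diag.hom_smult)

lemma ounit_positive: "ounit V \<in> positives"
  using unit_cone_1 by (simp add: positives_def)

lemma ounit_hermitian: "ounit V \<in> hermitian V"
  by (rule positives_hermitian[OF ounit_positive])

lemma positives_order_unit:
  assumes "x \<in> hermitian V"
  shows "\<exists>r::real. 0 < r \<and> complex_of_real r \<odot> ounit V \<oplus> (-1) \<odot> x \<in> positives"
  using order_unitD[of 1 "diag_of V 1 x"] assms hermitianD(1)[OF assms]
  unfolding diag_1_hermitian_iff positives_def by (simp add: diag.hom_add diag.hom_smult)

lemma cone_1_entry: "X \<in> cone V 1 \<Longrightarrow> X $$ (0, 0) \<in> positives"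
  using mem_matrix_space_1[OF cone_in[of 1 X], symmetric] unfolding positives_def by simp

lemma is_state_iff:
  "is_state V f \<longleftrightarrow>
     f \<in> LinearCombinations.module_hom (class_ring :: complex ring) V complex_module \<and>
     (\<forall>x\<in>positives. f x \<in> \<real>\<^sub>\<ge>\<^sub>0) \<and> f (ounit V) = 1"
proof -
  have "(\<forall>X\<in>cone V 1. f (X $$ (0, 0)) \<in> \<real>\<^sub>\<ge>\<^sub>0) \<longleftrightarrow> (\<forall>x\<in>positives. f x \<in> \<real>\<^sub>\<ge>\<^sub>0)"
  proof
    assume *: "\<forall>X\<in>cone V 1. f (X $$ (0, 0)) \<in> \<real>\<^sub>\<ge>\<^sub>0"
    show "\<forall>x\<in>positives. f x \<in> \<real>\<^sub>\<ge>\<^sub>0"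
    proof
      fix x assume "x \<in> positives"
      then have "diag_of V 1 x \<in> cone V 1" by (simp add: positives_def)
      with * have "f (diag_of V 1 x $$ (0, 0)) \<in> \<real>\<^sub>\<ge>\<^sub>0" by blast
      then show "f x \<in> \<real>\<^sub>\<ge>\<^sub>0" by (simp add: diag_of_def)
    qed
  qed (use cone_1_entry in blast)
  then show ?thesis unfolding is_state_def by simp
qed

text \<open>Write \<open>x = r e - (r e - x)\<close> with \<open>r\<close> taken from the order unit
  property.\<close>

lemma hermitian_diff_positives:
  assumes "x \<in> hermitian V"
  obtains p q where "p \<in> positives" "q \<in> positives" "x = p \<oplus> (-1) \<odot> q"
proof -
  obtain r where r: "0 < r" "complex_of_real r \<odot> ounit V \<oplus> (-1) \<odot> x \<in> positives"
    using positives_order_unit[OF assms] by auto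
  have x: "x \<in> carrier V" using assms hermitianD by auto
  define u where "u = complex_of_real r \<odot> ounit V"
  have u: "u \<in> carrier V" by (simp add: u_def)
  have "x = u \<oplus> (-1) \<odot> (u \<oplus> (-1) \<odot> x)"
    using x u by (simp add: smult_add_r smult_smult flip: add_assoc)
  moreover have "u \<in> positives"
    using r(1) positives_smult[OF _ ounit_positive, of r] by (simp add: u_def)
  ultimately show ?thesis using that r(2) by (auto simp: u_def)
qed

text \<open>Hermitian elements are differences of positive ones, so it is enough that
  \<open>J\<close> fixes the images of positive elements.\<close>

lemma positive_hom_star:
  assumes "complex_hom V W f"
    and J_add: "\<And>x y. x \<in> carrier W \<Longrightarrow> y \<in> carrier W \<Longrightarrow> J (x \<oplus>\<^bsub>W\<^esub> y) = J x \<oplus>\<^bsub>W\<^esub> J y"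
    and J_smult: "\<And>c x. x \<in> carrier W \<Longrightarrow> J (c \<odot>\<^bsub>W\<^esub> x) = cnj c \<odot>\<^bsub>W\<^esub> J x"
    and pos: "\<And>x. x \<in> positives \<Longrightarrow> J (f x) = f x"
    and x: "x \<in> carrier V"
  shows "f (star V x) = J (f x)"
proof (rule hom_star[OF assms(1) J_add J_smult _ x])
  interpret complex_hom V W f by fact
  fix h assume "h \<in> hermitian V"
  then obtain p q where *: "p \<in> positives" "q \<in> positives" "h = p \<oplus> (-1) \<odot> q"
    using hermitian_diff_positives by blast
  then show "J (f h) = f h"
    using positives_in by (simp add: hom_add hom_smult J_add J_smult pos)
qed

lemma complex_hom_state: "is_state V f \<Longrightarrow> complex_hom V complex_module f"
  by (intro complex_hom.intro complex_hom_axioms.intro complex_vs_axioms complex_vs_complex_module)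
    (simp add: is_state_def)

lemma state_star:
  assumes "is_state V f" "x \<in> carrier V"
  shows "f (star V x) = cnj (f x)"
proof (rule positive_hom_star[where J = cnj, OF complex_hom_state[OF assms(1)] _ _ _ assms(2)])
  show "cnj (f x) = f x" if "x \<in> positives" for x
  proof -
    have "f x \<in> \<real>\<^sub>\<ge>\<^sub>0" using assms(1) that unfolding is_state_iff by blast
    then show ?thesis by (auto elim: nonneg_Reals_cases)
  qed
qed simp_all

text \<open>The vector \<open>v\<close>, read as an \<open>n\<close> by 1 matrix, compresses
  \<open>X\<close> to a positive element of level one. So the scalar matrix of the values
  \<open>f (X $$ (p, q))\<close> is positive semidefinite.\<close>

lemma state_cone:
  assumes f: "is_state V f" and X: "X \<in> cone V n" and n: "0 < n"
  shows "(\<Sum>p<n. \<Sum>q<n. cnj (v p) * v q * f (X $$ (p, q))) \<in> \<real>\<^sub>\<ge>\<^sub>0"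
proof -
  interpret f: complex_hom V complex_module f by (rule complex_hom_state[OF f])
  note Xc = matrix_spaceD[OF cone_in[OF n X]]
  define \<alpha> where "\<alpha> = mat n 1 (\<lambda>(p, _). v p)"
  have "compression V n 1 \<alpha> X \<in> cone V 1"
    using n X by (intro compression_cone) (auto simp: \<alpha>_def)
  then have "f (compression V n 1 \<alpha> X $$ (0, 0)) \<in> \<real>\<^sub>\<ge>\<^sub>0"
    using f unfolding is_state_def by blast
  also have "compression V n 1 \<alpha> X $$ (0, 0) =
      (\<Oplus>p\<in>{..<n}. \<Oplus>q\<in>{..<n}. (cnj (v p) * v q) \<odot> X $$ (p, q))"
    using Xc by (simp add: compression_def, intro finsum2_cong) (auto simp: \<alpha>_def)
  also have "f \<dots> = (\<Sum>p<n. \<Sum>q<n. f ((cnj (v p) * v q) \<odot> X $$ (p, q)))"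
    using Xc by (subst f.hom_finsum2) (auto simp: finsum_complex_module)
  also have "\<dots> = (\<Sum>p<n. \<Sum>q<n. cnj (v p) * v q * f (X $$ (p, q)))"
    using Xc by (intro sum.cong refl) (simp add: f.hom_smult)
  finally show ?thesis .
qed

end

section \<open>Separation of points by states\<close>

context operator_system
begin

text \<open>The Archimedean property is an equation with the cone on both sides, so it is used for
  one substitution and not as a rewrite rule.\<close>

lemma archimedeanD:
  assumes "0 < n" "X \<in> hermitian (M n)"
    and "\<And>r::real. 0 < r \<Longrightarrow> complex_of_real r \<odot>\<^bsub>M n\<^esub> diag_of V n (ounit V) \<oplus>\<^bsub>M n\<^esub> X \<in> cone V n"
  shows "X \<in> cone V n"
  using ounit_archimedean[OF assms(1), unfolded archimedean_def]
  by (rule ssubst) (use assms(2,3) in blast)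

lemma cone_antisym:
  assumes "0 < n" "X \<in> cone V n" "(-1) \<odot>\<^bsub>M n\<^esub> X \<in> cone V n"
  shows "X = \<zero>\<^bsub>M n\<^esub>"
proof -
  have X: "X \<in> carrier (M n)" using assms cone_in by auto
  then have "X = \<ominus>\<^bsub>M n\<^esub> ((-1) \<odot>\<^bsub>M n\<^esub> X)" by (simp add: M.uminus_smult M.smult_smult)
  then show ?thesis using cone_proper[OF assms(1)] assms(2,3) by blast
qed

lemma positives_archimedean:
  assumes "x \<in> hermitian V"
    and "\<And>r::real. 0 < r \<Longrightarrow> complex_of_real r \<odot> ounit V \<oplus> x \<in> positives"
  shows "x \<in> positives"
  using archimedeanD[of 1 "diag_of V 1 x"] assms hermitianD(1)[OF assms(1)]
  unfolding diag_1_hermitian_iff positives_def by (simp add: diag.hom_add diag.hom_smult)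

lemma positives_antisym:
  assumes "x \<in> positives" "(-1) \<odot> x \<in> positives"
  shows "x = \<zero>"
proof -
  have "diag_of V 1 x = diag_of V 1 \<zero>"
    using cone_antisym[of 1 "diag_of V 1 x"] assms positives_in[OF assms(1)]
    by (simp add: positives_def diag.hom_smult)
  then show ?thesis by (simp only: diag_1_inject)
qed

text \<open>If \<open>y = s e + x\<close> is not positive, adjoining \<open>-y\<close> to the positive cone keeps it
  proper, and a state of the enlarged cone is negative at \<open>x\<close>.\<close>

lemma hermitian_not_positive_state:
  assumes x: "x \<in> hermitian V" and nx: "x \<notin> positives"
  obtains f where "is_state V f" "f x \<noteq> 0"
proof -
  \<comment> \<open>The Archimedean property read backwards: if all \<open>s e + x\<close> were
    positive, so would be \<open>x\<close>. The gap \<open>s\<close> is what makes the value at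
    \<open>x\<close> strictly negative in the end.\<close>
  obtain s :: real where s: "0 < s" and ns: "complex_of_real s \<odot> ounit V \<oplus> x \<notin> positives"
    using positives_archimedean[OF x] nx by blast
  define y where "y = complex_of_real s \<odot> ounit V \<oplus> x"
  have xc [simp]: "x \<in> carrier V" using x hermitianD by auto
  have yH: "y \<in> hermitian V" unfolding y_def
    by (intro hermitian_add hermitian_smult ounit_hermitian x)
  have yc [simp]: "y \<in> carrier V" using yH hermitianD by auto
  \<comment> \<open>The cone generated by the positive elements and \<open>-y\<close>.\<close>
  define C where "C = {p \<oplus> complex_of_real (- t) \<odot> y | p t. p \<in> positives \<and> 0 \<le> t}"
  have zP: "\<zero> \<in> positives" using positives_smult[of 0 "ounit V"] ounit_positive by simp
  have CI: "p \<oplus> complex_of_real (- t) \<odot> y \<in> C" if "p \<in> positives" "0 \<le> t" for p t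
    using that unfolding C_def by blast
  have posC: "p \<in> C" if "p \<in> positives" for p
    using CI[OF that, of 0] positives_in[OF that] by simp
  have unit: "\<exists>r::real. 0 < r \<and> complex_of_real r \<odot> ounit V \<oplus> (-1) \<odot> z \<in> C" if "z \<in> hermitian V" for z
    using positives_order_unit[OF that] posC by blast
  have CH: "C \<subseteq> hermitian V"
    unfolding C_def using positives_hermitian yH by (auto intro!: hermitian_add hermitian_smult simp del: of_real_minus)
  have C_add: "a \<oplus> b \<in> C" if ab: "a \<in> C" "b \<in> C" for a b
  proof -
    from ab obtain p q t u where *: "a = p \<oplus> complex_of_real (- t) \<odot> y"
      "b = q \<oplus> complex_of_real (- u) \<odot> y" "p \<in> positives" "q \<in> positives" "0 \<le> t" "0 \<le> u"
      unfolding C_def by blast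
    have "a \<oplus> b = (p \<oplus> q) \<oplus> complex_of_real (- (t + u)) \<odot> y"
      using positives_in * smult_add_l[of y "- complex_of_real t" "- complex_of_real u"]
      by (simp add: add_ac)
    then show ?thesis using CI[of "p \<oplus> q" "t + u"] * positives_add by simp
  qed
  have C_smult: "complex_of_real r \<odot> a \<in> C" if ra: "0 \<le> r" "a \<in> C" for r a
  proof -
    from ra obtain p t where *: "a = p \<oplus> complex_of_real (- t) \<odot> y" "p \<in> positives" "0 \<le> t"
      unfolding C_def by blast
    have "complex_of_real r \<odot> a = complex_of_real r \<odot> p \<oplus> complex_of_real (- (r * t)) \<odot> y"
      using positives_in * by (simp add: smult_add_r smult_smult)
    then show ?thesis using CI[of "complex_of_real r \<odot> p" "r * t"] * positives_smult ra by simp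
  qed
  have proper: "(-1) \<odot> ounit V \<notin> C"
  proof
    assume "(-1) \<odot> ounit V \<in> C"
    then obtain p t where pt: "(-1) \<odot> ounit V = p \<oplus> complex_of_real (- t) \<odot> y" "p \<in> positives" "0 \<le> t"
      unfolding C_def by blast
    have pc [simp]: "p \<in> carrier V" using pt positives_in by auto
    \<comment> \<open>From \<open>-e = p - t y\<close> one gets \<open>t y = e + p\<close>, a
      positive element. For \<open>t > 0\<close> this makes \<open>y\<close> positive, against its
      choice.\<close>
    have eq: "ounit V \<oplus> p = complex_of_real t \<odot> y"
    proof -
      have "ounit V \<oplus> p = ounit V \<oplus> ((p \<oplus> complex_of_real (- t) \<odot> y) \<oplus> complex_of_real t \<odot> y)"
        by (simp add: add_assoc flip: smult_add_l)
      also have "\<dots> = complex_of_real t \<odot> y"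
        unfolding pt(1)[symmetric] by simp
      finally show ?thesis .
    qed
    have pos: "ounit V \<oplus> p \<in> positives" using pt ounit_positive positives_add by auto
    show False
    proof (cases "t = 0")
      case True
      have "p = (-1) \<odot> ounit V" using pt(1) True by simp
      \<comment> \<open>The degenerate case: \<open>e\<close> and \<open>-e\<close> are both
        positive, so \<open>e = 0\<close>, and then the order unit property makes every hermitian
        element positive, \<open>y\<close> included.\<close>
      then have "ounit V = \<zero>" using positives_antisym[of "ounit V"] pt(2) ounit_positive by simp
      then have "(-1) \<odot> y \<in> positives" "(-1) \<odot> ((-1) \<odot> y) \<in> positives"
        using positives_order_unit[OF yH] positives_order_unit[OF hermitian_neg[OF yH]] by simp_all
      then show False using ns by (simp add: y_def smult_smult)
    next
      case False
      have "complex_of_real (1 / t) \<odot> (ounit V \<oplus> p) \<in> positives"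
        using pt by (intro positives_smult[OF _ pos]) simp
      then show False using ns False unfolding eq y_def[symmetric] by (simp add: smult_smult)
    qed
  qed
  obtain f where f: "f \<in> LinearCombinations.module_hom (class_ring :: complex ring) V complex_module"
    "\<And>x. x \<in> C \<Longrightarrow> f x \<in> \<real>\<^sub>\<ge>\<^sub>0" "f (ounit V) = 1"
    using state_on_cone_exists[OF CH C_add C_smult posC[OF ounit_positive] unit proper] by blast
  then have st: "is_state V f" using posC by (auto simp: is_state_iff)
  interpret f: complex_hom V complex_module f by (rule complex_hom_state[OF st])
  \<comment> \<open>Since \<open>-y\<close> lies in \<open>C\<close>, the number
    \<open>s + f x\<close> is at most 0, and therefore \<open>f x\<close> is at most
    \<open>-s\<close>.\<close>
  have "f ((-1) \<odot> y) \<in> \<real>\<^sub>\<ge>\<^sub>0"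
    using f(2)[OF CI[OF zP, of 1]] by simp
  then have "- (complex_of_real s + f x) \<in> \<real>\<^sub>\<ge>\<^sub>0"
    by (simp add: y_def f.hom_smult f.hom_add f(3))
  then have "f x \<noteq> 0" using s by (auto simp: complex_nonneg_Reals_iff)
  then show ?thesis using that st by blast
qed

text \<open>A hermitian element killed by all states is positive together with its negative, hence
  zero. States respect the star, so they kill the hermitian parts of \<open>x\<close> along with
  \<open>x\<close>.\<close>

lemma states_separate:
  assumes x: "x \<in> carrier V" and null: "\<And>f. is_state V f \<Longrightarrow> f x = 0"
  shows "x = \<zero>"
proof -
  have H: "h = \<zero>" if h: "h \<in> hermitian V" "\<And>f. is_state V f \<Longrightarrow> f h = 0" for h
  proof -
    have "h \<in> positives" using hermitian_not_positive_state[OF h(1)] h(2) by blast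
    moreover have "f ((-1) \<odot> h) = 0" if f: "is_state V f" for f
    proof -
      interpret f: complex_hom V complex_module f by (rule complex_hom_state[OF f])
      show ?thesis using h f hermitianD(1)[OF h(1)] by (simp add: f.hom_smult)
    qed
    then have "(-1) \<odot> h \<in> positives"
      using hermitian_not_positive_state[OF hermitian_neg[OF h(1)]] by blast
    ultimately show ?thesis by (rule positives_antisym)
  qed
  have parts: "f (re_part x) = 0" "f (im_part x) = 0" if f: "is_state V f" for f
  proof -
    interpret f: complex_hom V complex_module f by (rule complex_hom_state[OF f])
    show "f (re_part x) = 0" "f (im_part x) = 0"
      using null[OF f] state_star[OF f x] x star_closed[OF x]
      by (simp_all add: re_part_def im_part_def f.hom_add f.hom_smult)
  qed
  have "re_part x = \<zero>" "im_part x = \<zero>"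
    by (rule H[OF re_im_hermitian(1)[OF x]], erule parts, rule H[OF re_im_hermitian(2)[OF x]], erule parts)
  then show ?thesis using re_im_decomp[OF x] by simp
qed

end

section \<open>Archimedeanization\<close>

text \<open>A sesquilinear form over the complex numbers that vanishes on the diagonal is zero, and
  unit vectors pick out its coefficients.\<close>

lemma polarization:
  fixes a :: "nat \<Rightarrow> nat \<Rightarrow> complex"
  assumes null: "\<And>v. (\<Sum>p<n. \<Sum>q<n. cnj (v p) * v q * a p q) = 0"
    and ij: "i < n" "j < n"
  shows "a i j = 0"
proof -
  define B where "B u v = (\<Sum>p<n. \<Sum>q<n. cnj (u p) * v q * a p q)" for u v
  have B0: "B v v = 0" for v using null by (simp add: B_def)
  have B_l: "B (\<lambda>p. u p + t * v p) w = B u w + cnj t * B v w" for u v w t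
    by (simp add: B_def algebra_simps sum.distrib sum_distrib_left)
  have B_r: "B w (\<lambda>p. u p + t * v p) = B w u + t * B w v" for u v w t
    by (simp add: B_def algebra_simps sum.distrib sum_distrib_left)
  \<comment> \<open>Expanding \<open>B\<close> at \<open>u + t v\<close> leaves only the mixed
    terms. The values \<open>t = 1\<close> and \<open>t = \<i>\<close> then separate
    \<open>B u v\<close> from \<open>B v u\<close>.\<close>
  have *: "t * B u v + cnj t * B v u = 0" for u v t
    using B0[of "\<lambda>p. u p + t * v p"] unfolding B_l B_r using B0[of u] B0[of v] by simp
  have "B u v = 0" for u v
    using *[of 1 u v] *[of \<i> u v] by (simp add: complex_eq_iff)
  then have "B (\<lambda>p. if p = i then 1 else 0) (\<lambda>q. if q = j then 1 else 0) = 0" .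
  moreover have "B (\<lambda>p. if p = i then 1 else 0) (\<lambda>q. if q = j then 1 else 0) =
      (\<Sum>p<n. \<Sum>q<n. if p = i \<and> q = j then a i j else 0)"
    unfolding B_def by (intro sum.cong refl) auto
  moreover have "(\<Sum>q<n. if p = i \<and> q = j then a i j else 0) = (if p = i then a i j else 0)" for p
    by (cases "p = i") (use ij in simp_all)
  ultimately show ?thesis using ij by simp
qed

lemma nonneg_Reals_limit:
  fixes a b :: complex
  assumes b: "b \<in> \<real>\<^sub>\<ge>\<^sub>0" and ab: "\<And>r::real. 0 < r \<Longrightarrow> complex_of_real r * b + a \<in> \<real>\<^sub>\<ge>\<^sub>0"
  shows "a \<in> \<real>\<^sub>\<ge>\<^sub>0"
proof -
  have b': "0 \<le> Re b" "Im b = 0" using b by (auto simp: complex_nonneg_Reals_iff)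
  have ab': "0 \<le> r * Re b + Re a" "r * Im b + Im a = 0" if "0 < r" for r
    using ab[OF that] by (auto simp: complex_nonneg_Reals_iff)
  have "0 \<le> Re a"
  proof (rule field_le_epsilon)
    fix \<epsilon> :: real assume \<epsilon>: "0 < \<epsilon>"
    \<comment> \<open>The factor \<epsilon>/(Re b + 1) is a legitimate \<open>r\<close> even for
      \<open>Re b = 0\<close>, and its product with \<open>Re b\<close> is at most
      \<epsilon>.\<close>
    have "0 \<le> \<epsilon> / (Re b + 1) * Re b + Re a" using \<epsilon> b' by (intro ab') simp
    moreover have "\<epsilon> / (Re b + 1) * Re b \<le> \<epsilon>" using \<epsilon> b' by (simp add: field_simps)
    ultimately show "0 \<le> Re a + \<epsilon>" by linarith
  qed
  moreover have "Im a = 0" using ab'(2)[of 1] b' by simp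
  ultimately show ?thesis by (simp add: complex_nonneg_Reals_iff)
qed

section \<open>Completely positive maps and pullback of states\<close>

lemma ucp_mapD:
  assumes "ucp_map V W f"
  shows "f \<in> LinearCombinations.module_hom (class_ring :: complex ring) V W"
    and "f (ounit V) = ounit W"
    and "0 < n \<Longrightarrow> X \<in> cone V n \<Longrightarrow> map_mat f X \<in> cone W n"
  using assms by (auto simp: ucp_map_def)

lemma ucp_map_entrywise_hom:
  assumes "ucp_map V W f" "complex_vs V" "complex_vs W"
  shows "entrywise_hom V W f"
  using assms by (intro entrywise_hom.intro complex_hom.intro complex_hom_axioms.intro ucp_mapD(1))

lemma ucp_map_comp:
  assumes "ucp_map U V f" "ucp_map V W g"
  shows "ucp_map U W (\<lambda>x. g (f x))"
proof -
  have "map_mat (\<lambda>x. g (f x)) X = map_mat g (map_mat f X)" for X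
    by (rule eq_matI) auto
  then show ?thesis
    using assms by (auto simp: ucp_map_def class_ring_hom_iff)
qed

text \<open>Pulling states back means that an element killed by all states of \<open>V\<close> is
  sent to one killed by all states of \<open>W\<close>.\<close>

lemma is_state_comp_ucp:
  assumes f: "ucp_map V W f" and g: "is_state W g"
    and V: "matrix_preordered V" and W: "matrix_preordered W"
  shows "is_state V (\<lambda>x. g (f x))"
proof -
  interpret V: matrix_preordered V by fact
  interpret W: matrix_preordered W by fact
  interpret f: entrywise_hom V W f
    by (rule ucp_map_entrywise_hom[OF f V.complex_vs_axioms W.complex_vs_axioms])
  have "f x \<in> W.positives" if "x \<in> V.positives" for x
    using ucp_mapD(3)[OF f, of 1 "diag_of V 1 x"] that
    unfolding V.positives_def W.positives_def f.map_mat_diag_of by simp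
  then show ?thesis
    using g ucp_mapD(2)[OF f] f.hom_in f.hom_add f.hom_smult
    unfolding V.is_state_iff W.is_state_iff class_ring_hom_iff by simp
qed

lemma (in star_vector_space) hermitian_cancel:
  assumes "x \<in> carrier V" "y \<in> hermitian V" "y \<oplus> x \<in> hermitian V"
  shows "x \<in> hermitian V"
proof -
  have "x = (-1) \<odot> y \<oplus> (y \<oplus> x)" using assms(1) hermitianD(1)[OF assms(2)] by simp
  also have "\<dots> \<in> hermitian V" by (intro hermitian_add hermitian_neg assms)
  finally show ?thesis .
qed

text \<open>The quotient by the common kernel of the states, described by a surjection
  \<open>q\<close> so that no argument has to handle cosets. The cones of \<open>W\<close> are still
  arbitrary here.\<close>

locale state_quotient = V: matrix_preordered V + q: entrywise_hom V W q
  for V :: "('a, 'm) opsys_scheme" and W :: "('b, 'k) opsys_scheme" and q :: "'a \<Rightarrow> 'b" +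
  assumes carrier_W: "carrier W = q ` carrier V"
    and star_W: "x \<in> carrier V \<Longrightarrow> star W (q x) = q (star V x)"
    and kernel: "x \<in> carrier V \<Longrightarrow> q x = \<zero>\<^bsub>W\<^esub> \<longleftrightarrow> (\<forall>f. is_state V f \<longrightarrow> f x = 0)"
    and ounit_W: "ounit W = q (ounit V)"
begin

lemma star_vector_space_W: "star_vector_space W"
  by (rule star_vector_space_image[OF V.star_vector_space_axioms q.W.complex_vs_axioms carrier_W])
    (simp_all add: q.hom_add q.hom_smult star_W)

sublocale W: star_vector_space W
  by (rule star_vector_space_W)

sublocale MW: star_vector_space "matrix_space W n" for n
  by (rule star_vector_space_matrix_space[OF star_vector_space_W])

sublocale mq: complex_hom "matrix_space V n" "matrix_space W n" "map_mat q" for n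
  by (rule q.complex_hom_map_mat)

sublocale compr_W: complex_hom "matrix_space W n" "matrix_space W m" "compression W n m \<alpha>" for n m \<alpha>
  by (rule complex_hom_compression[OF q.W.complex_vs_axioms])

abbreviation "E n \<equiv> diag_of V n (ounit V)"
abbreviation "EW n \<equiv> diag_of W n (ounit W)"

lemma map_mat_unit: "map_mat q (E n) = EW n"
  by (simp add: q.map_mat_diag_of ounit_W)

lemma EW_in [simp]: "EW n \<in> carrier (matrix_space W n)"
  by (simp flip: map_mat_unit)

lemma map_mat_surj:
  assumes "Y \<in> carrier (matrix_space W n)"
  obtains Z where "Z \<in> carrier (matrix_space V n)" "Y = map_mat q Z"
proof -
  note Y = matrix_spaceD[OF assms]
  define Z where "Z = mat n n (\<lambda>ij. SOME x. x \<in> carrier V \<and> q x = Y $$ ij)"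
  have *: "Z $$ (i, j) \<in> carrier V \<and> q (Z $$ (i, j)) = Y $$ (i, j)" if ij: "i < n" "j < n" for i j
  proof -
    have "\<exists>x. x \<in> carrier V \<and> q x = Y $$ (i, j)"
      using Y(3)[OF ij] unfolding carrier_W by force
    from someI_ex[OF this] show ?thesis using ij by (simp add: Z_def)
  qed
  show ?thesis
  proof (rule that)
    show "Z \<in> carrier (matrix_space V n)"
      using * by (simp add: mem_matrix_space_iff) (simp add: Z_def)
    show "Y = map_mat q Z"
      using * Y by (intro eq_matI) (auto simp: Z_def)
  qed
qed

lemma map_mat_star:
  assumes "Z \<in> carrier (matrix_space V n)"
  shows "map_mat q (star (matrix_space V n) Z) = star (matrix_space W n) (map_mat q Z)"
  using matrix_spaceD[OF assms] by (intro eq_matI) (auto simp: matrix_space_simps star_W)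

lemma map_mat_hermitian: "Z \<in> hermitian (matrix_space V n) \<Longrightarrow> map_mat q Z \<in> hermitian (matrix_space W n)"
  unfolding hermitian_def by (simp flip: map_mat_star)

text \<open>An arbitrary lift of a hermitian matrix need not be hermitian, but its real part is, and
  it is still a lift because \<open>q\<close> commutes with the star.\<close>

lemma hermitian_lift:
  assumes "Y \<in> hermitian (matrix_space W n)"
  obtains Z where "Z \<in> hermitian (matrix_space V n)" "Y = map_mat q Z"
proof -
  obtain Z where Z: "Z \<in> carrier (matrix_space V n)" "Y = map_mat q Z"
    using map_mat_surj MW.hermitianD(1)[OF assms] by blast
  have "map_mat q (V.M.re_part n Z) = MW.re_part n Y"
    using Z V.M.star_closed
    by (simp add: V.M.re_part_def MW.re_part_def mq.hom_add mq.hom_smult map_mat_star)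
  then show ?thesis
    using that V.M.re_im_hermitian(1)[OF Z(1)] MW.re_part_hermitian[OF assms] by metis
qed

lemma EW_hermitian: "0 < n \<Longrightarrow> EW n \<in> hermitian (matrix_space W n)"
  using map_mat_hermitian[OF V.diag_ounit_hermitian] by (simp add: map_mat_unit)

lemma map_cone_add: "0 < n \<Longrightarrow> Y \<in> map_mat q ` cone V n \<Longrightarrow> Y' \<in> map_mat q ` cone V n \<Longrightarrow>
    Y \<oplus>\<^bsub>matrix_space W n\<^esub> Y' \<in> map_mat q ` cone V n"
  using V.cone_add[of n] V.cone_in[of n] by (auto simp flip: mq.hom_add)

lemma map_cone_smult: "0 < n \<Longrightarrow> 0 \<le> r \<Longrightarrow> Y \<in> map_mat q ` cone V n \<Longrightarrow>
    complex_of_real r \<odot>\<^bsub>matrix_space W n\<^esub> Y \<in> map_mat q ` cone V n"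
  using V.cone_smult[of n r] V.cone_in[of n] by (auto simp flip: mq.hom_smult)

text \<open>For \<open>r = 1\<close>, the matrix \<open>e + Y\<close> is the image of a positive,
  hence hermitian matrix; subtract \<open>e\<close>.\<close>

lemma hermitian_if_image_cone:
  assumes n: "0 < n" and Y: "Y \<in> carrier (matrix_space W n)"
    and *: "\<And>r::real. 0 < r \<Longrightarrow> complex_of_real r \<odot>\<^bsub>matrix_space W n\<^esub> EW n
      \<oplus>\<^bsub>matrix_space W n\<^esub> Y \<in> map_mat q ` cone V n"
  shows "Y \<in> hermitian (matrix_space W n)"
proof (rule MW.hermitian_cancel[OF Y EW_hermitian[OF n]])
  have "complex_of_real 1 \<odot>\<^bsub>matrix_space W n\<^esub> EW n \<oplus>\<^bsub>matrix_space W n\<^esub> Y \<in> map_mat q ` cone V n"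
    by (rule *) simp
  then show "EW n \<oplus>\<^bsub>matrix_space W n\<^esub> Y \<in> hermitian (matrix_space W n)"
    using V.cone_hermitian[OF n] map_mat_hermitian by auto
qed

end

text \<open>The cones of \<open>W\<close> are the smallest ones that contain the image of the cones of \<open>V\<close> and
  for which the unit is Archimedean.\<close>

locale archimedeanization = state_quotient +
  assumes mem_cone_W: "0 < n \<Longrightarrow> Y \<in> cone W n \<longleftrightarrow> Y \<in> carrier (matrix_space W n) \<and>
      (\<forall>r::real. 0 < r \<longrightarrow> complex_of_real r \<odot>\<^bsub>matrix_space W n\<^esub> EW n
        \<oplus>\<^bsub>matrix_space W n\<^esub> Y \<in> map_mat q ` cone V n)"
begin

lemma map_cone_subset:
  assumes n: "0 < n" and Z: "Z \<in> cone V n"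
  shows "map_mat q Z \<in> cone W n"
  unfolding mem_cone_W[OF n]
proof (intro conjI allI impI)
  fix r :: real assume "0 < r"
  then have "complex_of_real r \<odot>\<^bsub>matrix_space V n\<^esub> E n \<oplus>\<^bsub>matrix_space V n\<^esub> Z \<in> cone V n"
    by (intro V.cone_add V.cone_smult V.diag_ounit_cone n Z) simp
  from imageI[OF this, of "map_mat q"]
  show "complex_of_real r \<odot>\<^bsub>matrix_space W n\<^esub> EW n \<oplus>\<^bsub>matrix_space W n\<^esub> map_mat q Z
      \<in> map_mat q ` cone V n"
    using V.cone_in[OF n Z] by (simp add: mq.hom_add mq.hom_smult map_mat_unit)
qed (use V.cone_in[OF n Z] in simp)

lemma cone_W_in: "0 < n \<Longrightarrow> Y \<in> cone W n \<Longrightarrow> Y \<in> carrier (matrix_space W n)"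
  by (simp add: mem_cone_W)

lemma cone_W_D: "0 < n \<Longrightarrow> Y \<in> cone W n \<Longrightarrow> 0 < r \<Longrightarrow>
    complex_of_real r \<odot>\<^bsub>matrix_space W n\<^esub> EW n \<oplus>\<^bsub>matrix_space W n\<^esub> Y \<in> map_mat q ` cone V n"
  by (simp add: mem_cone_W)

lemma cone_W_hermitian: "0 < n \<Longrightarrow> Y \<in> cone W n \<Longrightarrow> Y \<in> hermitian (matrix_space W n)"
  by (rule hermitian_if_image_cone[OF _ cone_W_in cone_W_D])

lemma cone_W_add:
  assumes n: "0 < n" and Y: "Y \<in> cone W n" and Y': "Y' \<in> cone W n"
  shows "Y \<oplus>\<^bsub>matrix_space W n\<^esub> Y' \<in> cone W n"
  unfolding mem_cone_W[OF n]
proof (intro conjI allI impI)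
  note c = cone_W_in[OF n Y] cone_W_in[OF n Y']
  show "Y \<oplus>\<^bsub>matrix_space W n\<^esub> Y' \<in> carrier (matrix_space W n)" using c by simp
  fix r :: real assume r: "0 < r"
  \<comment> \<open>The unit is split evenly between the summands; the factors \<open>1\<close> give
    the shape that \<open>lin2_add'\<close> rewrites.\<close>
  have "(complex_of_real (r/2) \<odot>\<^bsub>matrix_space W n\<^esub> EW n \<oplus>\<^bsub>matrix_space W n\<^esub> 1 \<odot>\<^bsub>matrix_space W n\<^esub> Y)
      \<oplus>\<^bsub>matrix_space W n\<^esub>
      (complex_of_real (r/2) \<odot>\<^bsub>matrix_space W n\<^esub> EW n \<oplus>\<^bsub>matrix_space W n\<^esub> 1 \<odot>\<^bsub>matrix_space W n\<^esub> Y')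
      \<in> map_mat q ` cone V n"
    unfolding MW.smult_1[OF c(1)] MW.smult_1[OF c(2)]
    using r by (intro map_cone_add[OF n cone_W_D[OF n Y] cone_W_D[OF n Y']]) simp_all
  then show "complex_of_real r \<odot>\<^bsub>matrix_space W n\<^esub> EW n \<oplus>\<^bsub>matrix_space W n\<^esub>
      (Y \<oplus>\<^bsub>matrix_space W n\<^esub> Y') \<in> map_mat q ` cone V n"
    unfolding MW.lin2_add'[OF c EW_in] using c by (simp flip: of_real_add)
qed

lemma cone_W_smult:
  assumes n: "0 < n" and t: "0 \<le> t" and Y: "Y \<in> cone W n"
  shows "complex_of_real t \<odot>\<^bsub>matrix_space W n\<^esub> Y \<in> cone W n"
proof (cases "t = 0")
  case True
  then show ?thesis
    using map_cone_subset[OF n V.zero_cone[OF n]] cone_W_in[OF n Y] by simp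
next
  case False
  then have t: "0 < t" using t by simp
  note c = cone_W_in[OF n Y]
  show ?thesis
    unfolding mem_cone_W[OF n]
  proof (intro conjI allI impI)
    fix r :: real assume r: "0 < r"
    \<comment> \<open>The bound is taken at \<open>r / t\<close> so that scaling by \<open>t\<close>
      returns \<open>r e\<close>; this is why \<open>t = 0\<close> is treated apart.\<close>
    have "complex_of_real t \<odot>\<^bsub>matrix_space W n\<^esub>
        (complex_of_real (r / t) \<odot>\<^bsub>matrix_space W n\<^esub> EW n \<oplus>\<^bsub>matrix_space W n\<^esub> Y) \<in> map_mat q ` cone V n"
      using r t by (intro map_cone_smult[OF n] cone_W_D[OF n Y]) simp_all
    then show "complex_of_real r \<odot>\<^bsub>matrix_space W n\<^esub> EW n \<oplus>\<^bsub>matrix_space W n\<^esub>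
        complex_of_real t \<odot>\<^bsub>matrix_space W n\<^esub> Y \<in> map_mat q ` cone V n"
      using c t by (simp add: MW.smult_add_r MW.smult_smult)
  qed (use c in simp)
qed

text \<open>The compression of the unit need not be a multiple of the unit, but \<alpha>* e \<alpha>
  is dominated by some \<open>R e\<close>. Then r e + \<alpha>* Y \<alpha> = (r/R) (R e - \<alpha>*
  e \<alpha>) + \<alpha>* ((r/R) e + Y) \<alpha>, and both summands are images of positive
  matrices.\<close>

lemma cone_W_compression:
  assumes n: "0 < n" and m: "0 < m" and \<alpha>: "\<alpha> \<in> carrier_mat n m" and Y: "Y \<in> cone W n"
  shows "compression W n m \<alpha> Y \<in> cone W m"
  unfolding mem_cone_W[OF m]
proof (intro conjI allI impI)
  note c = cone_W_in[OF n Y]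
  show "compression W n m \<alpha> Y \<in> carrier (matrix_space W m)" using c by simp
  fix r :: real assume r: "0 < r"
  define F where "F = compression V n m \<alpha> (E n)"
  have F: "F \<in> cone V m"
    unfolding F_def by (intro V.compression_cone n m \<alpha> V.diag_ounit_cone)
  note Fc = V.cone_in[OF m F]
  obtain R where R: "0 < R" and
    pos: "complex_of_real R \<odot>\<^bsub>matrix_space V m\<^esub> E m \<oplus>\<^bsub>matrix_space V m\<^esub> (-1) \<odot>\<^bsub>matrix_space V m\<^esub> F \<in> cone V m"
    using V.order_unitD[OF m V.cone_hermitian[OF m F]] by blast
  have FW: "map_mat q F = compression W n m \<alpha> (EW n)"
    unfolding F_def by (subst q.map_mat_compression) (simp_all add: map_mat_unit)
  define G where "G = map_mat q F"
  have Gc: "G \<in> carrier (matrix_space W m)" using Fc by (simp add: G_def)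
  have posW: "complex_of_real R \<odot>\<^bsub>matrix_space W m\<^esub> EW m \<oplus>\<^bsub>matrix_space W m\<^esub>
      (-1) \<odot>\<^bsub>matrix_space W m\<^esub> G \<in> map_mat q ` cone V m"
    using imageI[OF pos, of "map_mat q"] Fc
    by (simp add: G_def mq.hom_add mq.hom_smult map_mat_unit)
  have "compression W n m \<alpha> (complex_of_real (r / R) \<odot>\<^bsub>matrix_space W n\<^esub> EW n \<oplus>\<^bsub>matrix_space W n\<^esub> Y)
      \<in> map_mat q ` cone V m"
  proof -
    obtain Z where Z: "Z \<in> cone V n"
      "complex_of_real (r / R) \<odot>\<^bsub>matrix_space W n\<^esub> EW n \<oplus>\<^bsub>matrix_space W n\<^esub> Y = map_mat q Z"
      using cone_W_D[OF n Y, of "r / R"] r R by auto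
    have "compression V n m \<alpha> Z \<in> cone V m" by (intro V.compression_cone n m \<alpha> Z)
    then show ?thesis
      unfolding Z(2) using q.map_mat_compression[OF V.cone_in[OF n Z(1)]] by (metis imageI)
  qed
  moreover have "complex_of_real (r / R) \<odot>\<^bsub>matrix_space W m\<^esub>
      (complex_of_real R \<odot>\<^bsub>matrix_space W m\<^esub> EW m \<oplus>\<^bsub>matrix_space W m\<^esub> (-1) \<odot>\<^bsub>matrix_space W m\<^esub> G)
      \<in> map_mat q ` cone V m"
    using r R by (intro map_cone_smult[OF m _ posW]) simp
  ultimately have "complex_of_real (r / R) \<odot>\<^bsub>matrix_space W m\<^esub>
      (complex_of_real R \<odot>\<^bsub>matrix_space W m\<^esub> EW m \<oplus>\<^bsub>matrix_space W m\<^esub> (-1) \<odot>\<^bsub>matrix_space W m\<^esub> G)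
      \<oplus>\<^bsub>matrix_space W m\<^esub>
      compression W n m \<alpha> (complex_of_real (r / R) \<odot>\<^bsub>matrix_space W n\<^esub> EW n \<oplus>\<^bsub>matrix_space W n\<^esub> Y)
      \<in> map_mat q ` cone V m" (is "?l \<in> _")
    by (intro map_cone_add[OF m])
  also have "?l = complex_of_real r \<odot>\<^bsub>matrix_space W m\<^esub> EW m \<oplus>\<^bsub>matrix_space W m\<^esub>
      ((complex_of_real (r / R) * -1) \<odot>\<^bsub>matrix_space W m\<^esub> G \<oplus>\<^bsub>matrix_space W m\<^esub>
        (complex_of_real (r / R) \<odot>\<^bsub>matrix_space W m\<^esub> G \<oplus>\<^bsub>matrix_space W m\<^esub> compression W n m \<alpha> Y))"
    using c R Gc
    by (simp add: MW.smult_add_r MW.smult_smult compr_W.hom_add compr_W.hom_smult MW.add_assoc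
        flip: FW G_def)
  also have "(complex_of_real (r / R) * -1) \<odot>\<^bsub>matrix_space W m\<^esub> G \<oplus>\<^bsub>matrix_space W m\<^esub>
        (complex_of_real (r / R) \<odot>\<^bsub>matrix_space W m\<^esub> G \<oplus>\<^bsub>matrix_space W m\<^esub> compression W n m \<alpha> Y)
      = compression W n m \<alpha> Y"
    using c Gc MW.smult_add_l[OF Gc, of "complex_of_real (r / R) * -1" "complex_of_real (r / R)"]
    by (simp flip: MW.add_assoc)
  finally show "complex_of_real r \<odot>\<^bsub>matrix_space W m\<^esub> EW m \<oplus>\<^bsub>matrix_space W m\<^esub>
      compression W n m \<alpha> Y \<in> map_mat q ` cone V m" .
qed

lemma cone_W_antisym:
  assumes n: "0 < n" and Y: "Y \<in> cone W n" and Y': "(-1) \<odot>\<^bsub>matrix_space W n\<^esub> Y \<in> cone W n"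
  shows "Y = \<zero>\<^bsub>matrix_space W n\<^esub>"
proof -
  obtain Z where Z: "Z \<in> carrier (matrix_space V n)" and YZ: "Y = map_mat q Z"
    using map_mat_surj cone_W_in[OF n Y] by blast
  have null: "f (Z $$ (i, j)) = 0" if f: "is_state V f" and ij: "i < n" "j < n" for f i j
  proof -
    interpret f: complex_hom V complex_module f by (rule V.complex_hom_state[OF f])
    \<comment> \<open>The quadratic form at \<open>v\<close> of the scalar matrix obtained by
      applying \<open>f\<close> to the entries of \<open>X\<close>.\<close>
    define F where "F v X = (\<Sum>p<n. \<Sum>q<n. cnj (v p) * v q * f (X $$ (p, q)))" for v X
    have F_add: "F v (X \<oplus>\<^bsub>matrix_space V n\<^esub> X') = F v X + F v X'"
      if "X \<in> carrier (matrix_space V n)" "X' \<in> carrier (matrix_space V n)" for v X X'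
      using matrix_spaceD[OF that(1)] matrix_spaceD[OF that(2)]
      by (simp add: F_def matrix_space_simps f.hom_add algebra_simps sum.distrib)
    have F_smult: "F v (c \<odot>\<^bsub>matrix_space V n\<^esub> X) = c * F v X"
      if "X \<in> carrier (matrix_space V n)" for v X c
      using matrix_spaceD[OF that]
      by (simp add: F_def matrix_space_simps f.hom_smult algebra_simps sum_distrib_left)
    \<comment> \<open>Although \<open>f\<close> lives on \<open>V\<close>, it vanishes on the kernel
      of \<open>q\<close>, so the form depends only on the image of \<open>X\<close> in the
      quotient.\<close>
    have F_cong: "F v X = F v X'"
      if X: "X \<in> carrier (matrix_space V n)" and X': "X' \<in> carrier (matrix_space V n)"
        and eq: "map_mat q X = map_mat q X'" for v X X'
    proof -
      have "f (X $$ (i, j)) = f (X' $$ (i, j))" if ij: "i < n" "j < n" for i j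
      proof -
        note x = matrix_spaceD(3)[OF X ij] matrix_spaceD(3)[OF X' ij]
        have "map_mat q X $$ (i, j) = map_mat q X' $$ (i, j)" using eq by simp
        then have "q (X $$ (i, j)) = q (X' $$ (i, j))"
          using ij matrix_spaceD(1,2)[OF X] matrix_spaceD(1,2)[OF X'] by simp
        then have "q (X $$ (i, j) \<oplus>\<^bsub>V\<^esub> (-1) \<odot>\<^bsub>V\<^esub> X' $$ (i, j)) = \<zero>\<^bsub>W\<^esub>"
          using x by (simp add: q.hom_add q.hom_smult)
        then have "f (X $$ (i, j) \<oplus>\<^bsub>V\<^esub> (-1) \<odot>\<^bsub>V\<^esub> X' $$ (i, j)) = 0"
          using f x by (subst (asm) kernel) simp_all
        then show ?thesis using x by (simp add: f.hom_add f.hom_smult)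
      qed
      then show ?thesis by (simp add: F_def)
    qed
    have F_cone: "F v X \<in> \<real>\<^sub>\<ge>\<^sub>0" if "X \<in> cone V n" for v X
      unfolding F_def by (rule V.state_cone[OF f that n])
    \<comment> \<open>For each \<open>r > 0\<close> the matrix \<open>r e + X\<close> has the same
      image as some positive \<open>C\<close>, whence \<open>r * F v (E n) + F v X = F v C\<close>
      is nonnegative. Then \<open>r\<close> tends to 0.\<close>
    have lim: "F v X \<in> \<real>\<^sub>\<ge>\<^sub>0"
      if X: "X \<in> carrier (matrix_space V n)" and XW: "map_mat q X \<in> cone W n" for v X
    proof (rule nonneg_Reals_limit)
      show "F v (E n) \<in> \<real>\<^sub>\<ge>\<^sub>0" by (rule F_cone[OF V.diag_ounit_cone[OF n]])
      fix r :: real assume "0 < r"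
      then obtain C where C: "C \<in> cone V n"
        "complex_of_real r \<odot>\<^bsub>matrix_space W n\<^esub> EW n \<oplus>\<^bsub>matrix_space W n\<^esub> map_mat q X = map_mat q C"
        using cone_W_D[OF n XW] by blast
      have "F v (complex_of_real r \<odot>\<^bsub>matrix_space V n\<^esub> E n \<oplus>\<^bsub>matrix_space V n\<^esub> X) = F v C"
        using C X V.cone_in[OF n C(1)]
        by (intro F_cong) (simp_all add: mq.hom_add mq.hom_smult map_mat_unit)
      then show "complex_of_real r * F v (E n) + F v X \<in> \<real>\<^sub>\<ge>\<^sub>0"
        using F_cone[OF C(1), of v] X by (simp add: F_add F_smult)
    qed
    have "F v Z = 0" for v
    proof -
      have "F v Z \<in> \<real>\<^sub>\<ge>\<^sub>0" using lim[OF Z] Y by (simp add: YZ)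
      moreover have "F v ((-1) \<odot>\<^bsub>matrix_space V n\<^esub> Z) \<in> \<real>\<^sub>\<ge>\<^sub>0"
        using Z Y' by (intro lim) (simp_all add: YZ mq.hom_smult)
      then have "- F v Z \<in> \<real>\<^sub>\<ge>\<^sub>0" using Z by (simp add: F_smult)
      ultimately show ?thesis by (simp add: complex_nonneg_Reals_iff complex_eq_iff)
    qed
    then show ?thesis
      unfolding F_def by (rule polarization[OF _ ij])
  qed
  have "q (Z $$ (i, j)) = \<zero>\<^bsub>W\<^esub>" if "i < n" "j < n" for i j
    using null that kernel[OF matrix_spaceD(3)[OF Z that]] by blast
  then show ?thesis
    using matrix_spaceD[OF Z] by (intro eq_matI) (auto simp: YZ matrix_space_simps)
qed

lemma operator_system_W: "operator_system W"
proof
  fix n :: nat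
  show "diag_of W 1 (ounit W) \<in> cone W 1"
    using map_cone_subset[OF _ V.unit_cone_1] by (simp flip: map_mat_unit)
  assume n: "0 < n"
  show "is_cone (matrix_space W n) (cone W n)"
    unfolding is_cone_def using cone_W_hermitian[OF n] cone_W_add[OF n] cone_W_smult[OF n] by blast
  have zero: "\<zero>\<^bsub>matrix_space W n\<^esub> \<in> cone W n"
    using map_cone_subset[OF n V.zero_cone[OF n]] by simp
  show "cone W n \<inter> (\<lambda>X. \<ominus>\<^bsub>matrix_space W n\<^esub> X) ` cone W n = {\<zero>\<^bsub>matrix_space W n\<^esub>}"
  proof (intro equalityI subsetI)
    fix Y assume "Y \<in> cone W n \<inter> (\<lambda>X. \<ominus>\<^bsub>matrix_space W n\<^esub> X) ` cone W n"
    then obtain X where X: "Y \<in> cone W n" "X \<in> cone W n" "Y = \<ominus>\<^bsub>matrix_space W n\<^esub> X" by blast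
    then have "(-1) \<odot>\<^bsub>matrix_space W n\<^esub> Y = X"
      using cone_W_in[OF n] by (simp add: MW.uminus_smult MW.smult_smult)
    then show "Y \<in> {\<zero>\<^bsub>matrix_space W n\<^esub>}" using cone_W_antisym[OF n] X by simp
  next
    fix Y assume "Y \<in> {\<zero>\<^bsub>matrix_space W n\<^esub>}"
    moreover have "\<zero>\<^bsub>matrix_space W n\<^esub> = \<ominus>\<^bsub>matrix_space W n\<^esub> \<zero>\<^bsub>matrix_space W n\<^esub>"
      by (simp add: MW.uminus_smult)
    ultimately show "Y \<in> cone W n \<inter> (\<lambda>X. \<ominus>\<^bsub>matrix_space W n\<^esub> X) ` cone W n"
      using zero by blast
  qed
  show "order_unit (matrix_space W n) (cone W n) (diag_of W n (ounit W))"
    unfolding order_unit_def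
  proof
    fix Y assume "Y \<in> hermitian (matrix_space W n)"
    then obtain Z where Z: "Z \<in> hermitian (matrix_space V n)" "Y = map_mat q Z"
      using hermitian_lift by blast
    note Zc = V.M.hermitianD(1)[OF Z(1)]
    obtain r where r: "0 < r"
      "complex_of_real r \<odot>\<^bsub>matrix_space V n\<^esub> E n \<oplus>\<^bsub>matrix_space V n\<^esub> (-1) \<odot>\<^bsub>matrix_space V n\<^esub> Z \<in> cone V n"
      using V.order_unitD[OF n Z(1)] by blast
    have "complex_of_real r \<odot>\<^bsub>matrix_space W n\<^esub> EW n \<ominus>\<^bsub>matrix_space W n\<^esub> Y \<in> cone W n"
      using map_cone_subset[OF n r(2)] Zc
      by (simp add: Z(2) MW.minus_smult mq.hom_add mq.hom_smult map_mat_unit)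
    then show "\<exists>r>0. complex_of_real r \<odot>\<^bsub>matrix_space W n\<^esub> EW n \<ominus>\<^bsub>matrix_space W n\<^esub> Y \<in> cone W n"
      using r(1) by blast
  qed
  show "archimedean (matrix_space W n) (cone W n) (diag_of W n (ounit W))"
    unfolding archimedean_def
  proof (intro equalityI subsetI CollectI conjI allI impI)
    fix Y assume Y: "Y \<in> cone W n"
    show "Y \<in> hermitian (matrix_space W n)" by (rule cone_W_hermitian[OF n Y])
    fix r :: real assume "0 < r"
    then show "complex_of_real r \<odot>\<^bsub>matrix_space W n\<^esub> EW n \<oplus>\<^bsub>matrix_space W n\<^esub> Y \<in> cone W n"
      using map_cone_subset[OF n V.diag_ounit_cone[OF n]]
      by (intro cone_W_add[OF n _ Y] cone_W_smult[OF n]) (simp_all add: map_mat_unit)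
  next
    fix Y assume "Y \<in> {Y \<in> hermitian (matrix_space W n). \<forall>r>0.
      complex_of_real r \<odot>\<^bsub>matrix_space W n\<^esub> EW n \<oplus>\<^bsub>matrix_space W n\<^esub> Y \<in> cone W n}"
    then have Y: "Y \<in> hermitian (matrix_space W n)"
      and *: "0 < r \<Longrightarrow> complex_of_real r \<odot>\<^bsub>matrix_space W n\<^esub> EW n \<oplus>\<^bsub>matrix_space W n\<^esub> Y \<in> cone W n"
      for r by auto
    note c = MW.hermitianD(1)[OF Y]
    show "Y \<in> cone W n"
      unfolding mem_cone_W[OF n]
    proof (intro conjI allI impI c)
      fix r :: real assume r: "0 < r"
      \<comment> \<open>One half of \<open>r\<close> brings \<open>Y\<close> into the cone of
        \<open>W\<close>, the other half brings the result into the image of the cone of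
        \<open>V\<close>.\<close>
      have "complex_of_real (r/2) \<odot>\<^bsub>matrix_space W n\<^esub> EW n \<oplus>\<^bsub>matrix_space W n\<^esub>
          (complex_of_real (r/2) \<odot>\<^bsub>matrix_space W n\<^esub> EW n \<oplus>\<^bsub>matrix_space W n\<^esub> Y) \<in> map_mat q ` cone V n"
        using r by (intro cone_W_D[OF n *]) simp_all
      then show "complex_of_real r \<odot>\<^bsub>matrix_space W n\<^esub> EW n \<oplus>\<^bsub>matrix_space W n\<^esub> Y \<in> map_mat q ` cone V n"
        using c by (simp flip: MW.add_assoc MW.smult_add_l of_real_add)
    qed
  qed
next
  fix n m :: nat and \<alpha> :: "complex mat" and X
  assume "0 < n" "0 < m" "\<alpha> \<in> carrier_mat n m" "X \<in> cone W n"
  then show "compression W n m \<alpha> X \<in> cone W m" by (rule cone_W_compression)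
qed

lemma ucp_map_q: "ucp_map V W q"
  unfolding ucp_map_def using q.hom ounit_W map_cone_subset by simp

text \<open>This is the existence half of the universal property of \<open>q\<close>; uniqueness is
  a matter of surjectivity and is settled at the end.\<close>

lemma universal:
  assumes B: "operator_system B" and \<beta>: "ucp_map V B \<beta>"
  obtains \<mu> where "\<mu> \<in> extensional (carrier W)" "ucp_map W B \<mu>" "\<And>x. x \<in> carrier V \<Longrightarrow> \<mu> (q x) = \<beta> x"
proof -
  interpret B: operator_system B by fact
  interpret \<beta>: entrywise_hom V B \<beta>
    by (rule ucp_map_entrywise_hom[OF \<beta> V.complex_vs_axioms B.complex_vs_axioms])
  have ker: "\<beta> x = \<zero>\<^bsub>B\<^esub>" if x: "x \<in> carrier V" "q x = \<zero>\<^bsub>W\<^esub>" for x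
  proof (rule B.states_separate)
    fix g assume "is_state B g"
    then have "is_state V (\<lambda>x. g (\<beta> x))"
      by (rule is_state_comp_ucp[OF \<beta> _ V.matrix_preordered_axioms B.matrix_preordered_axioms])
    then show "g (\<beta> x) = 0" using kernel[OF x(1)] x(2) by blast
  qed (use x in simp)
  have cong: "\<beta> x = \<beta> y" if xy: "x \<in> carrier V" "y \<in> carrier V" "q x = q y" for x y
    using ker[of "x \<oplus>\<^bsub>V\<^esub> (-1) \<odot>\<^bsub>V\<^esub> y"] xy B.eq_iff_diff_zero[of "\<beta> x" "\<beta> y"]
    by (simp add: q.hom_add q.hom_smult \<beta>.hom_add \<beta>.hom_smult)
  \<comment> \<open>By \<open>cong\<close> the chosen preimage does not affect the value. The
    restriction to the carrier gives the normal form in which uniqueness is an equality of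
    functions.\<close>
  define \<mu> where "\<mu> = (\<lambda>y\<in>carrier W. \<beta> (SOME x. x \<in> carrier V \<and> q x = y))"
  have \<mu>: "\<mu> (q x) = \<beta> x" if x: "x \<in> carrier V" for x
  proof -
    have "\<exists>x'. x' \<in> carrier V \<and> q x' = q x" using x by blast
    from someI_ex[OF this] have "\<beta> (SOME x'. x' \<in> carrier V \<and> q x' = q x) = \<beta> x"
      using x by (intro cong) auto
    then show ?thesis using x by (simp add: \<mu>_def)
  qed
  have hom: "\<mu> \<in> LinearCombinations.module_hom (class_ring :: complex ring) W B"
    unfolding class_ring_hom_iff carrier_W
    by (auto simp: \<mu> \<beta>.hom_add \<beta>.hom_smult simp flip: q.hom_add q.hom_smult)
  interpret \<mu>: entrywise_hom W B \<mu>
    by (intro entrywise_hom.intro complex_hom.intro complex_hom_axioms.intro hom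
        q.W.complex_vs_axioms B.complex_vs_axioms)
  interpret m\<mu>: complex_hom "matrix_space W n" "matrix_space B n" "map_mat \<mu>" for n
    by (rule \<mu>.complex_hom_map_mat)
  have unit: "\<mu> (ounit W) = ounit B" using \<mu>[of "ounit V"] ucp_mapD(2)[OF \<beta>] by (simp add: ounit_W)
  have "map_mat \<mu> Y \<in> cone B n" if n: "0 < n" and Y: "Y \<in> cone W n" for n Y
  proof -
    note c = cone_W_in[OF n Y]
    have *: "complex_of_real r \<odot>\<^bsub>matrix_space B n\<^esub> diag_of B n (ounit B) \<oplus>\<^bsub>matrix_space B n\<^esub> map_mat \<mu> Y \<in> cone B n"
      if r: "0 < r" for r
    proof -
      obtain C where C: "C \<in> cone V n"
        "complex_of_real r \<odot>\<^bsub>matrix_space W n\<^esub> EW n \<oplus>\<^bsub>matrix_space W n\<^esub> Y = map_mat q C"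
        using cone_W_D[OF n Y r] by blast
      have "map_mat \<mu> (map_mat q C) = map_mat \<beta> C"
        using matrix_spaceD[OF V.cone_in[OF n C(1)]] \<mu> by (intro eq_matI) auto
      then have "map_mat \<mu> (map_mat q C) \<in> cone B n"
        using ucp_mapD(3)[OF \<beta> n C(1)] by simp
      then show ?thesis
        using c by (simp add: m\<mu>.hom_add m\<mu>.hom_smult \<mu>.map_mat_diag_of unit flip: C(2))
    qed
    \<comment> \<open>The Archimedean property of \<open>B\<close> speaks of hermitian matrices; the
      case \<open>r = 1\<close> of the fact above supplies this.\<close>
    have "map_mat \<mu> Y \<in> hermitian (matrix_space B n)"
    proof (rule B.M.hermitian_cancel[OF _ B.diag_ounit_hermitian[OF n]])
      show "diag_of B n (ounit B) \<oplus>\<^bsub>matrix_space B n\<^esub> map_mat \<mu> Y \<in> hermitian (matrix_space B n)"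
        using B.cone_hermitian[OF n *[of 1]] by simp
    qed (use c in simp)
    then show ?thesis by (rule B.archimedeanD[OF n]) (rule *)
  qed
  then have "ucp_map W B \<mu>" unfolding ucp_map_def using hom unit by blast
  moreover have "\<mu> \<in> extensional (carrier W)" by (simp add: \<mu>_def)
  ultimately show ?thesis using that \<mu> by blast
qed

end

section \<open>The algebraic inductive limit\<close>

locale complex_subspace = complex_vs V
  for V :: "(complex, 'a, 'm) module_scheme" (structure) +
  fixes N :: "'a set"
  assumes sub: "x \<in> N \<Longrightarrow> x \<in> carrier V"
    and zero_sub: "\<zero> \<in> N"
    and add_sub: "x \<in> N \<Longrightarrow> y \<in> N \<Longrightarrow> x \<oplus> y \<in> N"
    and smult_sub: "x \<in> N \<Longrightarrow> c \<odot> x \<in> N"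
begin

lemma mem_coset_iff:
  assumes "y \<in> carrier V"
  shows "x \<in> N +> y \<longleftrightarrow> x \<in> carrier V \<and> x \<oplus> (-1) \<odot> y \<in> N"
proof
  assume "x \<in> N +> y"
  then obtain h where "h \<in> N" "x = h \<oplus> y" by (auto simp: a_r_coset_def')
  then show "x \<in> carrier V \<and> x \<oplus> (-1) \<odot> y \<in> N" using assms sub by (simp add: add_assoc)
next
  assume *: "x \<in> carrier V \<and> x \<oplus> (-1) \<odot> y \<in> N"
  then have "x = (x \<oplus> (-1) \<odot> y) \<oplus> y" using assms by (simp add: add_assoc)
  then show "x \<in> N +> y" using * unfolding a_r_coset_def' by blast
qed

lemma coset_self: "x \<in> carrier V \<Longrightarrow> x \<in> N +> x"
  by (simp add: mem_coset_iff zero_sub)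

lemma coset_eq_iff:
  assumes x: "x \<in> carrier V" and y: "y \<in> carrier V"
  shows "N +> x = N +> y \<longleftrightarrow> x \<oplus> (-1) \<odot> y \<in> N"
proof
  assume "N +> x = N +> y"
  then show "x \<oplus> (-1) \<odot> y \<in> N" using coset_self[OF x] mem_coset_iff[OF y] by auto
next
  assume d: "x \<oplus> (-1) \<odot> y \<in> N"
  have "z \<oplus> (-1) \<odot> x \<in> N \<longleftrightarrow> z \<oplus> (-1) \<odot> y \<in> N" if z: "z \<in> carrier V" for z
  proof
    assume "z \<oplus> (-1) \<odot> x \<in> N"
    then have "(z \<oplus> (-1) \<odot> x) \<oplus> (x \<oplus> (-1) \<odot> y) \<in> N" using d by (rule add_sub)
    then show "z \<oplus> (-1) \<odot> y \<in> N" using x y z by (simp add: add_assoc)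
  next
    assume "z \<oplus> (-1) \<odot> y \<in> N"
    moreover have "y \<oplus> (-1) \<odot> x \<in> N"
      using smult_sub[OF d, of "-1"] x y by (simp add: smult_add_r smult_smult add_comm)
    ultimately have "(z \<oplus> (-1) \<odot> y) \<oplus> (y \<oplus> (-1) \<odot> x) \<in> N" by (rule add_sub)
    then show "z \<oplus> (-1) \<odot> x \<in> N" using x y z by (simp add: add_assoc)
  qed
  then show "N +> x = N +> y" using x y by (auto simp: mem_coset_iff)
qed

lemma coset_zero: "N +> \<zero> = N"
  using sub by (auto simp: mem_coset_iff)

text \<open>Operations on the quotient are defined as unions over a coset. Such a union collapses to
  a single coset when \<open>g\<close> respects congruence modulo \<open>N\<close>; this serves
  scalar multiplication and the star alike.\<close>

lemma coset_UN:
  assumes x: "x \<in> carrier V" and g: "\<And>a. a \<in> carrier V \<Longrightarrow> g a \<in> carrier V"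
    and cong: "\<And>a. a \<in> carrier V \<Longrightarrow> a \<oplus> (-1) \<odot> x \<in> N \<Longrightarrow> g a \<oplus> (-1) \<odot> g x \<in> N"
  shows "(\<Union>a\<in>N +> x. N +> g a) = N +> g x"
proof -
  have "N +> g a = N +> g x" if "a \<in> N +> x" for a
    using that x g cong by (simp add: mem_coset_iff coset_eq_iff)
  then show ?thesis using coset_self[OF x] by blast
qed

lemma coset_add:
  assumes x: "x \<in> carrier V" and y: "y \<in> carrier V"
  shows "(N +> x) <+>\<^bsub>V\<^esub> (N +> y) = N +> (x \<oplus> y)"
proof (intro equalityI subsetI)
  fix z assume "z \<in> (N +> x) <+>\<^bsub>V\<^esub> (N +> y)"
  then obtain a b where ab: "a \<in> N" "b \<in> N" "z = (a \<oplus> x) \<oplus> (b \<oplus> y)"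
    by (auto simp: set_add_def' a_r_coset_def')
  then have "z = (a \<oplus> b) \<oplus> (x \<oplus> y)" using sub x y by (simp add: add_ac)
  then show "z \<in> N +> (x \<oplus> y)" using add_sub[OF ab(1,2)] unfolding a_r_coset_def' by blast
next
  fix z assume "z \<in> N +> (x \<oplus> y)"
  then obtain a where a: "a \<in> N" "z = a \<oplus> (x \<oplus> y)" by (auto simp: a_r_coset_def')
  then have "z = (a \<oplus> x) \<oplus> (\<zero> \<oplus> y)" using sub x y by (simp add: add_assoc)
  then show "z \<in> (N +> x) <+>\<^bsub>V\<^esub> (N +> y)"
    using a(1) zero_sub unfolding a_r_coset_def' set_add_def' by blast
qed

lemma coset_smult:
  assumes x: "x \<in> carrier V"
  shows "(\<Union>a\<in>N +> x. N +> (c \<odot> a)) = N +> (c \<odot> x)"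
proof (rule coset_UN[OF x])
  fix a assume "a \<in> carrier V" "a \<oplus> (-1) \<odot> x \<in> N"
  then show "c \<odot> a \<oplus> (-1) \<odot> (c \<odot> x) \<in> N"
    using x smult_sub[of "a \<oplus> (-1) \<odot> x" c] by (simp add: smult_add_r smult_smult)
qed simp

text \<open>\<open>W\<close> may be any record with the linear structure of the quotient, so one
  statement covers both quotients, which carry a star, cones and a unit in addition.\<close>

lemma complex_hom_coset:
  fixes W :: "(complex, 'a set, 'k) module_scheme"
  assumes carr: "carrier W = carrier (quotient_module V N)"
    and zero: "\<zero>\<^bsub>W\<^esub> = \<zero>\<^bsub>quotient_module V N\<^esub>"
    and add: "add W = add (quotient_module V N)"
    and smult: "smult W = smult (quotient_module V N)"
  shows "complex_hom V W ((+>) N)" "carrier W = (+>) N ` carrier V"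
proof -
  show c: "carrier W = (+>) N ` carrier V"
    unfolding carr by (auto simp: quotient_module_def A_RCOSETS_def')
  have a: "(N +> x) \<oplus>\<^bsub>W\<^esub> (N +> y) = N +> (x \<oplus> y)" if "x \<in> carrier V" "y \<in> carrier V" for x y
    using that by (simp add: add quotient_module_def coset_add)
  have s: "c \<odot>\<^bsub>W\<^esub> (N +> x) = N +> (c \<odot> x)" if "x \<in> carrier V" for c x
    using that by (simp add: smult quotient_module_def coset_smult)
  have "complex_vs W"
    by (rule complex_vs_image[OF complex_vs_axioms c _ a s])
      (simp_all add: zero quotient_module_def coset_zero)
  then show "complex_hom V W ((+>) N)"
    by (intro complex_hom.intro complex_hom_axioms.intro complex_vs_axioms)
      (auto simp: class_ring_hom_iff c a s)
qed

end

section \<open>The inductive system and its connecting maps\<close>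

locale os_inductive_system =
  fixes S :: "nat \<Rightarrow> 'a opsys" and \<phi> :: "nat \<Rightarrow> 'a \<Rightarrow> 'a"
  assumes system: "OS_inductive_system S \<phi>"
begin

lemma operator_system_S: "operator_system (S k)"
  and ucp_step: "ucp_map (S k) (S (Suc k)) (\<phi> k)"
  using system by (simp_all add: OS_inductive_system_def)

sublocale S: operator_system "S k" for k
  by (rule operator_system_S)

lemma connecting_self [simp]: "connecting \<phi> k k x = x"
  by (simp add: connecting_def)

lemma connecting_Suc: "k \<le> l \<Longrightarrow> connecting \<phi> k (Suc l) x = \<phi> l (connecting \<phi> k l x)"
  by (simp add: connecting_def)

lemma connecting_connecting:
  "k \<le> l \<Longrightarrow> l \<le> m \<Longrightarrow> connecting \<phi> l m (connecting \<phi> k l x) = connecting \<phi> k m x"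
proof (induction m)
  case (Suc m)
  then show ?case by (cases "l = Suc m") (auto simp: connecting_Suc)
qed simp

lemma ucp_connecting: "k \<le> l \<Longrightarrow> ucp_map (S k) (S l) (connecting \<phi> k l)"
proof (induction l rule: dec_induct)
  case base
  have "map_mat (\<lambda>a. a) X = X" for X :: "'a mat" by (rule eq_matI) auto
  then show ?case by (simp add: ucp_map_def class_ring_hom_iff)
next
  case (step l)
  have "connecting \<phi> k (Suc l) = (\<lambda>x. \<phi> l (connecting \<phi> k l x))"
    using step by (simp add: connecting_Suc fun_eq_iff)
  then show ?case using ucp_map_comp[OF step.IH ucp_step] by simp
qed

lemma hom_connecting: "k \<le> l \<Longrightarrow> entrywise_hom (S k) (S l) (connecting \<phi> k l)"
  by (rule ucp_map_entrywise_hom[OF ucp_connecting S.complex_vs_axioms S.complex_vs_axioms])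

lemma connecting_in [simp]: "k \<le> l \<Longrightarrow> x \<in> carrier (S k) \<Longrightarrow> connecting \<phi> k l x \<in> carrier (S l)"
  and connecting_zero [simp]: "k \<le> l \<Longrightarrow> connecting \<phi> k l \<zero>\<^bsub>S k\<^esub> = \<zero>\<^bsub>S l\<^esub>"
  and connecting_add: "k \<le> l \<Longrightarrow> x \<in> carrier (S k) \<Longrightarrow> y \<in> carrier (S k) \<Longrightarrow>
    connecting \<phi> k l (x \<oplus>\<^bsub>S k\<^esub> y) = connecting \<phi> k l x \<oplus>\<^bsub>S l\<^esub> connecting \<phi> k l y"
  and connecting_smult: "k \<le> l \<Longrightarrow> x \<in> carrier (S k) \<Longrightarrow>
    connecting \<phi> k l (c \<odot>\<^bsub>S k\<^esub> x) = c \<odot>\<^bsub>S l\<^esub> connecting \<phi> k l x"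
proof -
  assume kl: "k \<le> l"
  interpret c: entrywise_hom "S k" "S l" "connecting \<phi> k l" by (rule hom_connecting[OF kl])
  show "connecting \<phi> k l \<zero>\<^bsub>S k\<^esub> = \<zero>\<^bsub>S l\<^esub>" by simp
  assume x: "x \<in> carrier (S k)"
  then show "connecting \<phi> k l x \<in> carrier (S l)"
    "connecting \<phi> k l (c \<odot>\<^bsub>S k\<^esub> x) = c \<odot>\<^bsub>S l\<^esub> connecting \<phi> k l x"
    by (simp_all add: c.hom_smult)
  assume "y \<in> carrier (S k)"
  with x show "connecting \<phi> k l (x \<oplus>\<^bsub>S k\<^esub> y) = connecting \<phi> k l x \<oplus>\<^bsub>S l\<^esub> connecting \<phi> k l y"
    by (simp add: c.hom_add)
qed

lemma step_connecting: "\<phi> k x = connecting \<phi> k (Suc k) x"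
  by (simp add: connecting_Suc)

text \<open>A completely positive map sends positive elements to positive, hence hermitian ones, and
  these determine its behaviour under the star.\<close>

lemma ucp_star:
  assumes f: "ucp_map (S k) B f" and B: "matrix_preordered B" and x: "x \<in> carrier (S k)"
  shows "f (star (S k) x) = star B (f x)"
proof -
  interpret B: matrix_preordered B by fact
  interpret f: entrywise_hom "S k" B f
    by (rule ucp_map_entrywise_hom[OF f S.complex_vs_axioms B.complex_vs_axioms])
  show ?thesis
  proof (rule S.positive_hom_star[OF f.complex_hom_axioms _ _ _ x])
    fix p assume "p \<in> S.positives k"
    then have "f p \<in> B.positives"
      using ucp_mapD(3)[OF f, of 1 "diag_of (S k) 1 p"]
      unfolding S.positives_def B.positives_def f.map_mat_diag_of by simp
    then show "star B (f p) = f p" by (rule B.hermitianD(2)[OF B.positives_hermitian])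
  qed (simp_all add: B.star_add B.star_smult)
qed

section \<open>Eventually coherent sequences modulo null sequences\<close>

abbreviation "Q \<equiv> seq_module S \<phi>"
abbreviation "N0 \<equiv> null_seqs S \<phi>"

lemma seq_module_simps:
  "x \<in> carrier Q \<longleftrightarrow> (\<forall>k. x k \<in> carrier (S k)) \<and> (\<exists>K. \<forall>k\<ge>K. \<phi> k (x k) = x (Suc k))"
  "\<zero>\<^bsub>Q\<^esub> = (\<lambda>k. \<zero>\<^bsub>S k\<^esub>)"
  "x \<oplus>\<^bsub>Q\<^esub> y = (\<lambda>k. x k \<oplus>\<^bsub>S k\<^esub> y k)"
  "c \<odot>\<^bsub>Q\<^esub> x = (\<lambda>k. c \<odot>\<^bsub>S k\<^esub> x k)"
  by (simp_all add: seq_module_def)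

lemma complex_vs_seq_module: "complex_vs Q"
proof -
  have add: "x \<oplus>\<^bsub>Q\<^esub> y \<in> carrier Q" if "x \<in> carrier Q" "y \<in> carrier Q" for x y
  proof -
    from that obtain K L where x: "\<And>k. x k \<in> carrier (S k)" "\<And>k. k \<ge> K \<Longrightarrow> \<phi> k (x k) = x (Suc k)"
      and y: "\<And>k. y k \<in> carrier (S k)" "\<And>k. k \<ge> L \<Longrightarrow> \<phi> k (y k) = y (Suc k)"
      unfolding seq_module_simps by blast
    have "\<phi> k (x k \<oplus>\<^bsub>S k\<^esub> y k) = x (Suc k) \<oplus>\<^bsub>S (Suc k)\<^esub> y (Suc k)" if "max K L \<le> k" for k
      using x(2)[of k] y(2)[of k] that x(1)[of k] y(1)[of k] by (simp add: step_connecting connecting_add)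
    then have "\<exists>K. \<forall>k\<ge>K. \<phi> k (x k \<oplus>\<^bsub>S k\<^esub> y k) = x (Suc k) \<oplus>\<^bsub>S (Suc k)\<^esub> y (Suc k)" by blast
    then show ?thesis using x(1) y(1) unfolding seq_module_simps by simp
  qed
  have smult: "c \<odot>\<^bsub>Q\<^esub> x \<in> carrier Q" if "x \<in> carrier Q" for c x
  proof -
    from that obtain K where x: "\<And>k. x k \<in> carrier (S k)" "\<And>k. k \<ge> K \<Longrightarrow> \<phi> k (x k) = x (Suc k)"
      unfolding seq_module_simps by blast
    have "\<phi> k (c \<odot>\<^bsub>S k\<^esub> x k) = c \<odot>\<^bsub>S (Suc k)\<^esub> x (Suc k)" if "K \<le> k" for k
      using x(2)[of k] that x(1)[of k] by (simp add: step_connecting connecting_smult)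
    then show ?thesis using x(1) unfolding seq_module_simps by auto
  qed
  have zero: "\<zero>\<^bsub>Q\<^esub> \<in> carrier Q"
    by (simp add: seq_module_simps step_connecting)
  have c: "x k \<in> carrier (S k)" if "x \<in> carrier Q" for x k
    using that by (simp add: seq_module_simps)
  show ?thesis
    unfolding complex_vs_def
    by (rule complex_vectorspaceI, fact zero, fact add, fact smult)
      (simp_all add: fun_eq_iff seq_module_simps(2-4) c S.add_ac S.smult_add_l S.smult_add_r
        S.smult_smult)
qed

lemma null_seqs_iff: "x \<in> N0 \<longleftrightarrow> x \<in> carrier Q \<and> (\<exists>K. \<forall>k\<ge>K. x k = \<zero>\<^bsub>S k\<^esub>)"
  by (simp add: null_seqs_def)

sublocale Q: complex_subspace Q N0
proof -
  interpret complex_vs Q by (rule complex_vs_seq_module)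
  show "complex_subspace Q N0"
  proof
    fix x y c assume x: "x \<in> N0"
    then show "x \<in> carrier Q" by (simp add: null_seqs_iff)
    from x obtain K where K: "\<And>k. k \<ge> K \<Longrightarrow> x k = \<zero>\<^bsub>S k\<^esub>" by (auto simp: null_seqs_iff)
    show "c \<odot>\<^bsub>Q\<^esub> x \<in> N0"
    proof -
      have "(c \<odot>\<^bsub>Q\<^esub> x) k = \<zero>\<^bsub>S k\<^esub>" if "K \<le> k" for k
        using K[OF that] by (simp add: seq_module_simps)
      then have "\<exists>K. \<forall>k\<ge>K. (c \<odot>\<^bsub>Q\<^esub> x) k = \<zero>\<^bsub>S k\<^esub>" by blast
      then show ?thesis using x by (simp add: null_seqs_iff)
    qed
    assume y: "y \<in> N0"
    then obtain L where L: "\<And>k. k \<ge> L \<Longrightarrow> y k = \<zero>\<^bsub>S k\<^esub>" by (auto simp: null_seqs_iff)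
    have "(x \<oplus>\<^bsub>Q\<^esub> y) k = \<zero>\<^bsub>S k\<^esub>" if "max K L \<le> k" for k
      using that K[of k] L[of k] by (simp add: seq_module_simps)
    then have "\<exists>K. \<forall>k\<ge>K. (x \<oplus>\<^bsub>Q\<^esub> y) k = \<zero>\<^bsub>S k\<^esub>" by blast
    then show "x \<oplus>\<^bsub>Q\<^esub> y \<in> N0" using x y by (simp add: null_seqs_iff)
  next
    show "\<zero>\<^bsub>Q\<^esub> \<in> N0" using zero_in by (auto simp: null_seqs_iff seq_module_simps(2))
  qed
qed

definition tail_seq :: "nat \<Rightarrow> 'a \<Rightarrow> nat \<Rightarrow> 'a" where
  "tail_seq k x = (\<lambda>i. if i < k then \<zero>\<^bsub>S i\<^esub> else connecting \<phi> k i x)"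

lemma tail_seq_in: "x \<in> carrier (S k) \<Longrightarrow> tail_seq k x \<in> carrier Q"
  by (auto simp: seq_module_simps tail_seq_def connecting_Suc intro!: exI[of _ k])

lemma ddot_map_coset: "ddot_map S \<phi> k x = N0 +>\<^bsub>Q\<^esub> tail_seq k x"
  by (simp add: ddot_map_def tail_seq_def)

abbreviation "V \<equiv> ddot_system S \<phi>"
abbreviation "\<iota> \<equiv> ddot_map S \<phi>"

lemma ddot_system_simps:
  "carrier V = carrier (quotient_module Q N0)"
  "\<zero>\<^bsub>V\<^esub> = \<zero>\<^bsub>quotient_module Q N0\<^esub>"
  "add V = add (quotient_module Q N0)"
  "smult V = smult (quotient_module Q N0)"
  "star V = ddot_star S \<phi>"
  "cone V = ddot_cone S \<phi>"
  "ounit V = \<iota> 0 (ounit (S 0))"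
  by (simp_all add: ddot_system_def Let_def)

sublocale Qhom: complex_hom Q V "\<lambda>x. N0 +>\<^bsub>Q\<^esub> x"
  by (rule Q.complex_hom_coset(1)[OF ddot_system_simps(1-4)])

lemma carrier_V: "carrier V = (\<lambda>x. N0 +>\<^bsub>Q\<^esub> x) ` carrier Q"
  by (rule Q.complex_hom_coset(2)[OF ddot_system_simps(1-4)])

lemma complex_vs_V: "complex_vs V"
  by (rule Qhom.W.complex_vs_axioms)

lemma coset_eq_iff_eventually:
  assumes x: "x \<in> carrier Q" and y: "y \<in> carrier Q"
  shows "N0 +>\<^bsub>Q\<^esub> x = N0 +>\<^bsub>Q\<^esub> y \<longleftrightarrow> (\<exists>K. \<forall>k\<ge>K. x k = y k)"
proof -
  have "x k \<in> carrier (S k)" "y k \<in> carrier (S k)" for k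
    using x y by (simp_all add: seq_module_simps)
  then have "x k = y k \<longleftrightarrow> (x \<oplus>\<^bsub>Q\<^esub> (-1) \<odot>\<^bsub>Q\<^esub> y) k = \<zero>\<^bsub>S k\<^esub>" for k
    unfolding seq_module_simps by (rule S.eq_iff_diff_zero)
  then show ?thesis
    using x y unfolding Q.coset_eq_iff[OF x y] null_seqs_iff by simp
qed

text \<open>Agreement at one level \<open>l\<close> propagates to all later levels along the
  connecting maps, so eventual equality is equality at a single level.\<close>

lemma \<iota>_eq_iff:
  assumes x: "x \<in> carrier (S k)" and y: "y \<in> carrier (S m)"
  shows "\<iota> k x = \<iota> m y \<longleftrightarrow> (\<exists>l\<ge>max k m. connecting \<phi> k l x = connecting \<phi> m l y)"
  unfolding ddot_map_coset coset_eq_iff_eventually[OF tail_seq_in[OF x] tail_seq_in[OF y]]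
proof
  assume "\<exists>K. \<forall>i\<ge>K. tail_seq k x i = tail_seq m y i"
  then obtain K where "\<forall>i\<ge>K. tail_seq k x i = tail_seq m y i" by blast
  then have "tail_seq k x (max K (max k m)) = tail_seq m y (max K (max k m))" by simp
  then show "\<exists>l\<ge>max k m. connecting \<phi> k l x = connecting \<phi> m l y"
    by (intro exI[of _ "max K (max k m)"]) (simp add: tail_seq_def split: if_splits)
next
  assume "\<exists>l\<ge>max k m. connecting \<phi> k l x = connecting \<phi> m l y"
  then obtain l where l: "l \<ge> max k m" "connecting \<phi> k l x = connecting \<phi> m l y" by blast
  have "connecting \<phi> k i x = connecting \<phi> m i y" if "i \<ge> l" for i
    using l that connecting_connecting[of k l i x] connecting_connecting[of m l i y] by simp
  then show "\<exists>K. \<forall>i\<ge>K. tail_seq k x i = tail_seq m y i"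
    using l by (intro exI[of _ l]) (auto simp: tail_seq_def)
qed

lemma \<iota>_connecting: "k \<le> l \<Longrightarrow> x \<in> carrier (S k) \<Longrightarrow> \<iota> l (connecting \<phi> k l x) = \<iota> k x"
  by (subst \<iota>_eq_iff) (auto simp: connecting_connecting intro!: exI[of _ l])

lemma complex_hom_\<iota>: "complex_hom (S k) V (\<iota> k)"
proof (intro complex_hom.intro complex_hom_axioms.intro S.complex_vs_axioms complex_vs_V)
  have a: "tail_seq k (x \<oplus>\<^bsub>S k\<^esub> y) = tail_seq k x \<oplus>\<^bsub>Q\<^esub> tail_seq k y"
    if "x \<in> carrier (S k)" "y \<in> carrier (S k)" for x y
    using that by (auto simp: tail_seq_def seq_module_simps connecting_add fun_eq_iff)
  have s: "tail_seq k (c \<odot>\<^bsub>S k\<^esub> x) = c \<odot>\<^bsub>Q\<^esub> tail_seq k x" if "x \<in> carrier (S k)" for c x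
    using that by (auto simp: tail_seq_def seq_module_simps connecting_smult fun_eq_iff)
  show "\<iota> k \<in> LinearCombinations.module_hom (class_ring :: complex ring) (S k) V"
    unfolding class_ring_hom_iff ddot_map_coset
    by (auto simp: a s tail_seq_in Qhom.hom_add Qhom.hom_smult)
qed

sublocale \<iota>: entrywise_hom "S k" V "\<iota> k" for k
  by (intro entrywise_hom.intro complex_hom_\<iota>)

text \<open>A sequence that is coherent from index \<open>K\<close> on agrees from there with the
  forward orbit of its \<open>K\<close>-th entry.\<close>

lemma V_cases:
  assumes "s \<in> carrier V"
  obtains k x where "x \<in> carrier (S k)" "s = \<iota> k x"
proof -
  obtain y where y: "y \<in> carrier Q" "s = N0 +>\<^bsub>Q\<^esub> y" using assms unfolding carrier_V by blast
  then obtain K where K: "\<And>k. y k \<in> carrier (S k)" "\<And>k. k \<ge> K \<Longrightarrow> \<phi> k (y k) = y (Suc k)"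
    unfolding seq_module_simps by blast
  have "connecting \<phi> K i (y K) = y i" if "K \<le> i" for i
    using that by (induction i rule: dec_induct) (simp_all add: connecting_Suc K(2))
  then have "s = \<iota> K (y K)"
    unfolding y(2) ddot_map_coset coset_eq_iff_eventually[OF y(1) tail_seq_in[OF K(1)]]
    by (intro exI[of _ K]) (simp add: tail_seq_def)
  then show ?thesis using that K(1) by blast
qed

lemma V_lift:
  assumes "s \<in> carrier V"
  obtains k where "\<And>l. l \<ge> k \<Longrightarrow> s \<in> \<iota> l ` carrier (S l)"
proof -
  obtain k x where x: "x \<in> carrier (S k)" "s = \<iota> k x" by (rule V_cases[OF assms])
  have "s \<in> \<iota> l ` carrier (S l)" if "l \<ge> k" for l
    using x that \<iota>_connecting[OF that x(1)] by (intro image_eqI[of _ _ "connecting \<phi> k l x"]) auto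
  then show ?thesis using that by blast
qed

text \<open>Every entry lifts to all levels beyond some threshold, and there are finitely many
  entries.\<close>

lemma V_lift_matrix:
  assumes "Z \<in> carrier (matrix_space V n)"
  obtains k X where "X \<in> carrier (matrix_space (S k) n)" "Z = map_mat (\<iota> k) X"
proof -
  note Z = matrix_spaceD[OF assms]
  have "\<forall>ij\<in>{..<n} \<times> {..<n}. \<exists>k. \<forall>l\<ge>k. Z $$ ij \<in> \<iota> l ` carrier (S l)"
    using Z(3) V_lift by (smt (verit, best) SigmaE lessThan_iff)
  then obtain K where K: "\<And>ij l. ij \<in> {..<n} \<times> {..<n} \<Longrightarrow> l \<ge> K ij \<Longrightarrow> Z $$ ij \<in> \<iota> l ` carrier (S l)"
    by metis
  \<comment> \<open>The inserted 0 keeps the maximum meaningful for \<open>n = 0\<close>.\<close>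
  define k where "k = Max (insert 0 (K ` ({..<n} \<times> {..<n})))"
  have "Z $$ ij \<in> \<iota> k ` carrier (S k)" if "ij \<in> {..<n} \<times> {..<n}" for ij
    using that unfolding k_def by (intro K Max_ge) auto
  then have "\<forall>ij\<in>{..<n} \<times> {..<n}. \<exists>x. x \<in> carrier (S k) \<and> Z $$ ij = \<iota> k x" by blast
  then obtain g where g: "\<And>ij. ij \<in> {..<n} \<times> {..<n} \<Longrightarrow> g ij \<in> carrier (S k) \<and> Z $$ ij = \<iota> k (g ij)"
    by metis
  show ?thesis
  proof (rule that)
    show "mat n n g \<in> carrier (matrix_space (S k) n)" using g by (auto simp: mem_matrix_space_iff)
    show "Z = map_mat (\<iota> k) (mat n n g)" using g Z by (intro eq_matI) auto
  qed
qed

end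

section \<open>The limit in the category of operator systems\<close>

context os_inductive_system
begin

lemma connecting_star: "k \<le> l \<Longrightarrow> x \<in> carrier (S k) \<Longrightarrow>
    connecting \<phi> k l (star (S k) x) = star (S l) (connecting \<phi> k l x)"
  by (rule ucp_star[OF ucp_connecting S.matrix_preordered_axioms])

text \<open>\<open>ddot_star\<close> is a definite description over representatives. Two of them
  agree at a later level, and the connecting maps preserve the star, so the described element is
  unique.\<close>

lemma star_\<iota>:
  assumes x: "x \<in> carrier (S k)"
  shows "star V (\<iota> k x) = \<iota> k (star (S k) x)"
  unfolding ddot_system_simps ddot_star_def
proof (rule the_equality)
  show "\<exists>m. \<exists>y\<in>carrier (S m). \<iota> k x = \<iota> m y \<and> \<iota> k (star (S k) x) = \<iota> m (star (S m) y)"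
    using x by blast
next
  fix t assume "\<exists>m. \<exists>y\<in>carrier (S m). \<iota> k x = \<iota> m y \<and> t = \<iota> m (star (S m) y)"
  then obtain m y where y: "y \<in> carrier (S m)" "\<iota> k x = \<iota> m y" "t = \<iota> m (star (S m) y)" by blast
  then obtain l where l: "l \<ge> max k m" "connecting \<phi> k l x = connecting \<phi> m l y"
    using \<iota>_eq_iff[OF x y(1)] by blast
  then have "\<iota> m (star (S m) y) = \<iota> k (star (S k) x)"
    using x y(1) by (subst \<iota>_eq_iff) (auto simp: S.star_closed connecting_star intro!: exI[of _ l])
  then show "t = \<iota> k (star (S k) x)" using y(3) by simp
qed

lemma V_lift2:
  assumes "s \<in> carrier V" "t \<in> carrier V"
  obtains k x y where "x \<in> carrier (S k)" "y \<in> carrier (S k)" "s = \<iota> k x" "t = \<iota> k y"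
proof -
  obtain k where k: "\<And>l. l \<ge> k \<Longrightarrow> s \<in> \<iota> l ` carrier (S l)" by (rule V_lift[OF assms(1)]) blast
  obtain m where m: "\<And>l. l \<ge> m \<Longrightarrow> t \<in> \<iota> l ` carrier (S l)" by (rule V_lift[OF assms(2)]) blast
  show ?thesis using k[of "max k m"] m[of "max k m"] that by auto
qed

lemma star_vector_space_V: "star_vector_space V"
proof (intro star_vector_space.intro star_vector_space_axioms.intro)
  show "vectorspace class_ring V" using complex_vs_V by (simp add: complex_vs_def)
  fix s t c
  assume s: "s \<in> carrier V"
  obtain k x where x: "x \<in> carrier (S k)" "s = \<iota> k x" by (rule V_cases[OF s])
  show "star V s \<in> carrier V" "star V (star V s) = s"
    using x by (simp_all add: star_\<iota> S.star_closed S.star_star)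
  show "star V (c \<odot>\<^bsub>V\<^esub> s) = cnj c \<odot>\<^bsub>V\<^esub> star V s"
    using x by (simp add: star_\<iota> S.star_closed S.star_smult flip: \<iota>.hom_smult)
  assume t: "t \<in> carrier V"
  obtain m y z where "y \<in> carrier (S m)" "z \<in> carrier (S m)" "s = \<iota> m y" "t = \<iota> m z"
    by (rule V_lift2[OF s t])
  then show "star V (s \<oplus>\<^bsub>V\<^esub> t) = star V s \<oplus>\<^bsub>V\<^esub> star V t"
    by (simp add: star_\<iota> S.star_closed S.star_add flip: \<iota>.hom_add)
qed

lemma star_map_mat_\<iota>:
  assumes "X \<in> carrier (matrix_space (S k) n)"
  shows "star (matrix_space V n) (map_mat (\<iota> k) X) = map_mat (\<iota> k) (star (matrix_space (S k) n) X)"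
  using matrix_spaceD[OF assms] by (intro eq_matI) (auto simp: matrix_space_simps star_\<iota>)

lemma map_mat_\<iota>_connecting:
  assumes "k \<le> l" "X \<in> carrier (matrix_space (S k) n)"
  shows "map_mat (\<iota> l) (map_mat (connecting \<phi> k l) X) = map_mat (\<iota> k) X"
  using matrix_spaceD[OF assms(2)] assms(1) by (intro eq_matI) (auto simp: \<iota>_connecting)

text \<open>A matrix that becomes positive at level \<open>m\<close> may be replaced by its image
  there, which is a representative that is already positive.\<close>

lemma mem_cone_V_iff:
  assumes n: "0 < n"
  shows "Z \<in> cone V n \<longleftrightarrow> (\<exists>k. Z \<in> map_mat (\<iota> k) ` cone (S k) n)"
proof
  assume "Z \<in> cone V n"
  then obtain k X m where "Z = map_mat (\<iota> k) X" "X \<in> carrier (matrix_space (S k) n)" "k \<le> m"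
    "map_mat (connecting \<phi> k m) X \<in> cone (S m) n"
    unfolding ddot_system_simps ddot_cone_def by blast
  then have "Z \<in> map_mat (\<iota> m) ` cone (S m) n"
    using map_mat_\<iota>_connecting[of k m X n] by (intro image_eqI[of _ _ "map_mat (connecting \<phi> k m) X"]) simp_all
  then show "\<exists>k. Z \<in> map_mat (\<iota> k) ` cone (S k) n" by blast
next
  assume "\<exists>k. Z \<in> map_mat (\<iota> k) ` cone (S k) n"
  then obtain k X where X: "X \<in> cone (S k) n" "Z = map_mat (\<iota> k) X" by blast
  moreover have "map_mat (connecting \<phi> k k) X = X" by (rule eq_matI) auto
  ultimately have "map_mat (connecting \<phi> k k) X \<in> cone (S k) n" by simp
  then show "Z \<in> cone V n"
    unfolding ddot_system_simps ddot_cone_def using X(2) S.cone_in[OF n X(1)] by blast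
qed

text \<open>Positive lifts exist at all late levels, so that two positive matrices can be added at a
  common one.\<close>

lemma cone_V_lift:
  assumes n: "0 < n" and Z: "Z \<in> cone V n"
  obtains k where "\<And>l. k \<le> l \<Longrightarrow> Z \<in> map_mat (\<iota> l) ` cone (S l) n"
proof -
  obtain k X where X: "X \<in> cone (S k) n" "Z = map_mat (\<iota> k) X"
    using Z mem_cone_V_iff[OF n] by blast
  have "Z \<in> map_mat (\<iota> l) ` cone (S l) n" if l: "k \<le> l" for l
    using ucp_mapD(3)[OF ucp_connecting[OF l] n X(1)] map_mat_\<iota>_connecting[OF l S.cone_in[OF n X(1)]]
    by (intro image_eqI[of _ _ "map_mat (connecting \<phi> k l) X"]) (simp_all add: X(2))
  then show ?thesis using that by blast
qed

lemma ounit_V: "ounit V = \<iota> k (ounit (S k))"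
  using \<iota>_connecting[of 0 k "ounit (S 0)"] ucp_mapD(2)[OF ucp_connecting[of 0 k]]
  by (simp add: ddot_system_simps(7))

lemma ucp_map_\<iota>: "ucp_map (S k) V (\<iota> k)"
  unfolding ucp_map_def using \<iota>.hom ounit_V mem_cone_V_iff by blast

sublocale m\<iota>: complex_hom "matrix_space (S k) n" "matrix_space V n" "map_mat (\<iota> k)" for k n
  by (rule \<iota>.complex_hom_map_mat)

lemma map_mat_\<iota>_ounit: "map_mat (\<iota> k) (diag_of (S k) n (ounit (S k))) = diag_of V n (ounit V)"
  by (simp add: \<iota>.map_mat_diag_of flip: ounit_V)

text \<open>Each of these axioms concerns finitely many matrices and is inherited from a level where
  all of them are represented. The Archimedean property is not of this kind.\<close>

lemma matrix_preordered_V: "matrix_preordered V"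
proof (intro matrix_preordered.intro matrix_preordered_axioms.intro star_vector_space_V)
  interpret V: star_vector_space V by (rule star_vector_space_V)
  interpret MV: star_vector_space "matrix_space V n" for n
    by (rule star_vector_space_matrix_space[OF star_vector_space_V])
  show "diag_of V 1 (ounit V) \<in> cone V 1"
    using ucp_mapD(3)[OF ucp_map_\<iota> _ S.unit_cone_1] by (simp add: map_mat_\<iota>_ounit)
  fix n :: nat assume n: "0 < n"
  show "is_cone (matrix_space V n) (cone V n)"
    unfolding is_cone_def
  proof (intro conjI subsetI ballI allI impI)
    fix Z assume Z: "Z \<in> cone V n"
    obtain k X where X: "X \<in> cone (S k) n" "Z = map_mat (\<iota> k) X"
      using Z mem_cone_V_iff[OF n] by blast
    have "star (matrix_space (S k) n) X = X" "X \<in> carrier (matrix_space (S k) n)"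
      using S.cone_hermitian[OF n X(1)] S.cone_in[OF n X(1)] by (simp_all add: S.M.hermitianD)
    then show "Z \<in> hermitian (matrix_space V n)"
      by (simp add: hermitian_def X(2) star_map_mat_\<iota>)
    show "complex_of_real r \<odot>\<^bsub>matrix_space V n\<^esub> Z \<in> cone V n" if "0 \<le> r" for r
      using S.cone_smult[OF n that X(1)] S.cone_in[OF n X(1)] mem_cone_V_iff[OF n]
      by (auto simp: X(2) simp flip: m\<iota>.hom_smult)
    fix Z' assume Z': "Z' \<in> cone V n"
    obtain a where a: "\<And>l. a \<le> l \<Longrightarrow> Z \<in> map_mat (\<iota> l) ` cone (S l) n" by (rule cone_V_lift[OF n Z]) blast
    obtain b where b: "\<And>l. b \<le> l \<Longrightarrow> Z' \<in> map_mat (\<iota> l) ` cone (S l) n" by (rule cone_V_lift[OF n Z']) blast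
    define l where "l = max a b"
    obtain A B where AB: "A \<in> cone (S l) n" "B \<in> cone (S l) n" "Z = map_mat (\<iota> l) A" "Z' = map_mat (\<iota> l) B"
      using a[of l] b[of l] unfolding l_def by auto
    then show "Z \<oplus>\<^bsub>matrix_space V n\<^esub> Z' \<in> cone V n"
      using S.cone_add[OF n AB(1,2)] S.cone_in[OF n AB(1)] S.cone_in[OF n AB(2)] mem_cone_V_iff[OF n]
      by (auto simp flip: m\<iota>.hom_add)
  qed
  show "order_unit (matrix_space V n) (cone V n) (diag_of V n (ounit V))"
    unfolding order_unit_def
  proof
    fix Z assume Z: "Z \<in> hermitian (matrix_space V n)"
    obtain k Y where Y: "Y \<in> carrier (matrix_space (S k) n)" "Z = map_mat (\<iota> k) Y"
      by (rule V_lift_matrix[OF MV.hermitianD(1)[OF Z]])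
    \<comment> \<open>A representative of a hermitian matrix need not be hermitian at its own level;
      its real part is, and it represents the same matrix.\<close>
    define X where "X = S.M.re_part k n Y"
    have X: "X \<in> hermitian (matrix_space (S k) n)"
      unfolding X_def by (rule S.M.re_im_hermitian(1)[OF Y(1)])
    note Xc = S.M.hermitianD(1)[OF X]
    have "map_mat (\<iota> k) X = MV.re_part n Z"
      using Y S.M.star_closed
      by (simp add: X_def S.M.re_part_def MV.re_part_def m\<iota>.hom_add m\<iota>.hom_smult star_map_mat_\<iota>)
    then have ZX: "Z = map_mat (\<iota> k) X" using MV.re_part_hermitian[OF Z] by simp
    obtain r where r: "0 < r" "complex_of_real r \<odot>\<^bsub>matrix_space (S k) n\<^esub> diag_of (S k) n (ounit (S k))
        \<oplus>\<^bsub>matrix_space (S k) n\<^esub> (-1) \<odot>\<^bsub>matrix_space (S k) n\<^esub> X \<in> cone (S k) n"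
      using S.order_unitD[OF n X] by blast
    have "complex_of_real r \<odot>\<^bsub>matrix_space V n\<^esub> diag_of V n (ounit V) \<ominus>\<^bsub>matrix_space V n\<^esub> Z \<in> cone V n"
      using ucp_mapD(3)[OF ucp_map_\<iota> n r(2)] Xc
      by (simp add: ZX m\<iota>.W.minus_smult m\<iota>.hom_add m\<iota>.hom_smult flip: map_mat_\<iota>_ounit[of k])
    then show "\<exists>r>0. complex_of_real r \<odot>\<^bsub>matrix_space V n\<^esub> diag_of V n (ounit V)
        \<ominus>\<^bsub>matrix_space V n\<^esub> Z \<in> cone V n"
      using r(1) by blast
  qed
  fix m :: nat and \<alpha> :: "complex mat" and Z
  assume m: "0 < m" and \<alpha>: "\<alpha> \<in> carrier_mat n m" and Z: "Z \<in> cone V n"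
  obtain k X where X: "X \<in> cone (S k) n" "Z = map_mat (\<iota> k) X"
    using Z mem_cone_V_iff[OF n] by blast
  show "compression V n m \<alpha> Z \<in> cone V m"
    using ucp_mapD(3)[OF ucp_map_\<iota> m S.compression_cone[OF n m \<alpha> X(1)]]
    by (simp add: X(2) \<iota>.map_mat_compression[OF S.cone_in[OF n X(1)]])
qed

sublocale V: matrix_preordered V
  by (rule matrix_preordered_V)

text \<open>The algebraic limit already factors compatible families of completely positive maps.
  Values at representatives are consistent because these become equal at a later level.\<close>

lemma V_universal:
  assumes B: "operator_system B"
    and ucp: "\<And>k. ucp_map (S k) B (\<beta> k)"
    and compat: "\<And>k x. x \<in> carrier (S k) \<Longrightarrow> \<beta> (Suc k) (\<phi> k x) = \<beta> k x"
  obtains \<gamma> where "ucp_map V B \<gamma>" "\<And>k x. x \<in> carrier (S k) \<Longrightarrow> \<gamma> (\<iota> k x) = \<beta> k x"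
proof -
  interpret B: operator_system B by fact
  interpret \<beta>: entrywise_hom "S k" B "\<beta> k" for k
    by (rule ucp_map_entrywise_hom[OF ucp S.complex_vs_axioms B.complex_vs_axioms])
  have compat': "\<beta> l (connecting \<phi> k l x) = \<beta> k x" if "k \<le> l" "x \<in> carrier (S k)" for k l x
    using that by (induction l rule: dec_induct) (simp_all add: connecting_Suc compat)
  have cong: "\<beta> k x = \<beta> m y" if x: "x \<in> carrier (S k)" and y: "y \<in> carrier (S m)" and eq: "\<iota> k x = \<iota> m y"
    for k m x y
  proof -
    obtain l where l: "l \<ge> max k m" "connecting \<phi> k l x = connecting \<phi> m l y"
      using \<iota>_eq_iff[OF x y] eq by blast
    then show ?thesis using compat'[of k l x] compat'[of m l y] x y by simp
  qed
  define \<gamma> where "\<gamma> s = (SOME b. \<exists>k. \<exists>x\<in>carrier (S k). s = \<iota> k x \<and> b = \<beta> k x)" for s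
  have \<gamma>: "\<gamma> (\<iota> k x) = \<beta> k x" if x: "x \<in> carrier (S k)" for k x
    unfolding \<gamma>_def
  proof (rule some_equality)
    show "\<exists>m. \<exists>y\<in>carrier (S m). \<iota> k x = \<iota> m y \<and> \<beta> k x = \<beta> m y" using x by blast
    fix b assume "\<exists>m. \<exists>y\<in>carrier (S m). \<iota> k x = \<iota> m y \<and> b = \<beta> m y"
    then obtain m y where "y \<in> carrier (S m)" "\<iota> k x = \<iota> m y" "b = \<beta> m y" by blast
    then show "b = \<beta> k x" using cong[OF x, of y m] by simp
  qed
  have "\<gamma> \<in> LinearCombinations.module_hom (class_ring :: complex ring) V B"
    unfolding class_ring_hom_iff
  proof (intro conjI ballI allI)
    fix s c assume s: "s \<in> carrier V"
    obtain k x where x: "x \<in> carrier (S k)" "s = \<iota> k x" by (rule V_cases[OF s])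
    show "\<gamma> s \<in> carrier B" using x by (simp add: \<gamma>)
    show "\<gamma> (c \<odot>\<^bsub>V\<^esub> s) = c \<odot>\<^bsub>B\<^esub> \<gamma> s"
      using x by (simp add: \<gamma> \<beta>.hom_smult flip: \<iota>.hom_smult)
    fix t assume t: "t \<in> carrier V"
    obtain m y z where "y \<in> carrier (S m)" "z \<in> carrier (S m)" "s = \<iota> m y" "t = \<iota> m z"
      by (rule V_lift2[OF s t])
    then show "\<gamma> (s \<oplus>\<^bsub>V\<^esub> t) = \<gamma> s \<oplus>\<^bsub>B\<^esub> \<gamma> t"
      by (simp add: \<gamma> \<beta>.hom_add flip: \<iota>.hom_add)
  qed
  moreover have "\<gamma> (ounit V) = ounit B"
    using \<gamma>[of "ounit (S 0)" 0] ucp_mapD(2)[OF ucp[of 0]] by (simp flip: ounit_V)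
  moreover have "map_mat \<gamma> Z \<in> cone B n" if n: "0 < n" and Z: "Z \<in> cone V n" for n Z
  proof -
    obtain k X where X: "X \<in> cone (S k) n" "Z = map_mat (\<iota> k) X"
      using Z mem_cone_V_iff[OF n] by blast
    have "map_mat \<gamma> (map_mat (\<iota> k) X) = map_mat (\<beta> k) X"
      using matrix_spaceD[OF S.cone_in[OF n X(1)]] by (intro eq_matI) (auto simp: \<gamma>)
    then show ?thesis using ucp_mapD(3)[OF ucp n X(1)] by (simp add: X(2))
  qed
  ultimately have "ucp_map V B \<gamma>" unfolding ucp_map_def by blast
  then show ?thesis using that \<gamma> by blast
qed

section \<open>The quotient by the null space of the states\<close>

abbreviation "N \<equiv> state_null S \<phi>"
abbreviation "W \<equiv> lim_system S \<phi>"
abbreviation "q \<equiv> \<lambda>s. N +>\<^bsub>V\<^esub> s"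

lemma state_null_iff: "s \<in> N \<longleftrightarrow> s \<in> carrier V \<and> (\<forall>f. is_state V f \<longrightarrow> f s = 0)"
  by (simp add: state_null_def)

sublocale N: complex_subspace V N
proof
  fix s t c assume s: "s \<in> N"
  then show sc: "s \<in> carrier V" by (simp add: state_null_iff)
  show "c \<odot>\<^bsub>V\<^esub> s \<in> N"
    unfolding state_null_iff
  proof (intro conjI allI impI)
    fix f assume f: "is_state V f"
    interpret f: complex_hom V complex_module f by (rule V.complex_hom_state[OF f])
    show "f (c \<odot>\<^bsub>V\<^esub> s) = 0" using s sc f by (simp add: f.hom_smult state_null_iff)
  qed (use sc in simp)
  assume t: "t \<in> N"
  then have tc: "t \<in> carrier V" by (simp add: state_null_iff)
  show "s \<oplus>\<^bsub>V\<^esub> t \<in> N"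
    unfolding state_null_iff
  proof (intro conjI allI impI)
    fix f assume f: "is_state V f"
    interpret f: complex_hom V complex_module f by (rule V.complex_hom_state[OF f])
    have "f s = 0" "f t = 0" using s t f unfolding state_null_iff by blast+
    then show "f (s \<oplus>\<^bsub>V\<^esub> t) = 0" using sc tc by (simp add: f.hom_add)
  qed (use sc tc in simp)
next
  show "\<zero>\<^bsub>V\<^esub> \<in> N"
    unfolding state_null_iff
  proof (intro conjI allI impI)
    fix f assume f: "is_state V f"
    interpret f: complex_hom V complex_module f by (rule V.complex_hom_state[OF f])
    show "f \<zero>\<^bsub>V\<^esub> = 0" using f.hom_zero by simp
  qed simp
qed

text \<open>States satisfy \<open>f (star V s) = cnj (f s)\<close>. This makes the star of the
  quotient well defined.\<close>

lemma star_N: "s \<in> N \<Longrightarrow> star V s \<in> N"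
  by (simp add: state_null_iff V.star_closed V.state_star)

lemma lim_system_simps:
  "carrier W = carrier (quotient_module V N)"
  "\<zero>\<^bsub>W\<^esub> = \<zero>\<^bsub>quotient_module V N\<^esub>"
  "add W = add (quotient_module V N)"
  "smult W = smult (quotient_module V N)"
  "star W = (\<lambda>A. \<Union>s\<in>A. q (star V s))"
  "cone W = lim_cone S \<phi>"
  "ounit W = lim_map S \<phi> 0 (ounit (S 0))"
  by (simp_all add: lim_system_def lim_star_space_def Let_def)

lemma lim_map_q: "lim_map S \<phi> k x = q (\<iota> k x)"
  by (simp add: lim_map_def)

lemma map_mat_lim_map: "map_mat (lim_map S \<phi> k) X = map_mat q (map_mat (\<iota> k) X)"
  by (rule eq_matI) (auto simp: lim_map_q)

text \<open>The cones are defined before the record that contains them and so refer to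
  \<open>lim_star_space\<close>, which shares its linear structure and star.\<close>

lemma matrix_space_lim: "matrix_space (lim_star_space S \<phi>) n = matrix_space W n"
  by (simp add: matrix_space_def lim_system_def Let_def)

sublocale lim: state_quotient V W q
proof (intro state_quotient.intro state_quotient_axioms.intro entrywise_hom.intro V.matrix_preordered_axioms)
  show "complex_hom V W q" by (rule N.complex_hom_coset(1)[OF lim_system_simps(1-4)])
  show "carrier W = q ` carrier V" by (rule N.complex_hom_coset(2)[OF lim_system_simps(1-4)])
  show "ounit W = q (ounit V)" by (simp add: lim_system_simps(7) lim_map_q ddot_system_simps(7))
  fix s assume s: "s \<in> carrier V"
  show "star W (q s) = q (star V s)"
    unfolding lim_system_simps(5)
  proof (rule N.coset_UN[OF s V.star_closed])
    fix a assume a: "a \<in> carrier V" "a \<oplus>\<^bsub>V\<^esub> (-1) \<odot>\<^bsub>V\<^esub> s \<in> N"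
    then show "star V a \<oplus>\<^bsub>V\<^esub> (-1) \<odot>\<^bsub>V\<^esub> star V s \<in> N"
      using star_N[OF a(2)] s by (simp add: V.star_add V.star_smult)
  qed
  have "q s = \<zero>\<^bsub>W\<^esub> \<longleftrightarrow> q s = q \<zero>\<^bsub>V\<^esub>"
    by (simp add: lim_system_simps(2) quotient_module_def N.coset_zero)
  also have "\<dots> \<longleftrightarrow> s \<in> N" using s by (simp add: N.coset_eq_iff)
  finally show "q s = \<zero>\<^bsub>W\<^esub> \<longleftrightarrow> (\<forall>f. is_state V f \<longrightarrow> f s = 0)"
    using s by (simp add: state_null_iff)
qed

lemma q_zero_iff: "s \<in> carrier V \<Longrightarrow> q s = \<zero>\<^bsub>W\<^esub> \<longleftrightarrow> s \<in> N"
  by (simp add: lim.kernel state_null_iff)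

lemma map_mat_q_zero_iff:
  assumes "Z \<in> carrier (matrix_space V n)"
  shows "map_mat q Z = \<zero>\<^bsub>matrix_space W n\<^esub> \<longleftrightarrow> elements_mat Z \<subseteq> N"
proof
  note Z = matrix_spaceD[OF assms]
  assume eq: "map_mat q Z = \<zero>\<^bsub>matrix_space W n\<^esub>"
  have "Z $$ (i, j) \<in> N" if "i < n" "j < n" for i j
  proof -
    have "map_mat q Z $$ (i, j) = \<zero>\<^bsub>W\<^esub>" using that unfolding eq matrix_space_simps by simp
    then show ?thesis using that Z by (simp add: q_zero_iff)
  qed
  then show "elements_mat Z \<subseteq> N" using Z by (simp add: elements_mat_subset_iff)
next
  note Z = matrix_spaceD[OF assms]
  assume "elements_mat Z \<subseteq> N"
  then show "map_mat q Z = \<zero>\<^bsub>matrix_space W n\<^esub>"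
    using Z by (intro eq_matI) (auto simp: matrix_space_simps elements_mat_subset_iff q_zero_iff)
qed

text \<open>The correction \<open>T\<close> has entries in the null space and disappears under
  \<open>q\<close>. Conversely, if \<open>r e + Y\<close> is the image of a positive matrix, that
  matrix differs from the lift of \<open>r e + Y\<close> through \<open>X\<close> by a matrix over
  the null space, which serves as \<open>T\<close>. The lift \<open>X\<close> of \<open>Y\<close> is
  fixed, whereas \<open>l\<close> and \<open>T\<close> vary with \<open>r\<close>.\<close>

lemma mem_lim_cone_iff:
  assumes n: "0 < n"
  shows "Y \<in> cone W n \<longleftrightarrow> Y \<in> carrier (matrix_space W n) \<and>
      (\<forall>r::real. 0 < r \<longrightarrow> complex_of_real r \<odot>\<^bsub>matrix_space W n\<^esub> diag_of W n (ounit W)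
        \<oplus>\<^bsub>matrix_space W n\<^esub> Y \<in> map_mat q ` cone V n)"
proof (intro iffI conjI allI impI)
  assume "Y \<in> cone W n"
  then obtain k X where Y: "Y = map_mat q (map_mat (\<iota> k) X)"
    and X: "X \<in> carrier (matrix_space (S k) n)"
    and *: "\<And>r::real. 0 < r \<Longrightarrow> \<exists>l T. T \<in> carrier (matrix_space (S l) n) \<and>
       elements_mat (map_mat (\<iota> l) T) \<subseteq> N \<and>
       map_mat (\<iota> k) ((complex_of_real r \<odot>\<^bsub>matrix_space (S k) n\<^esub> diag_of (S k) n (ounit (S k)))
            \<oplus>\<^bsub>matrix_space (S k) n\<^esub> X) \<oplus>\<^bsub>matrix_space V n\<^esub> map_mat (\<iota> l) T \<in> cone V n"
    unfolding lim_system_simps lim_cone_def map_mat_lim_map by blast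
  show "Y \<in> carrier (matrix_space W n)" using X by (simp add: Y)
  fix r :: real assume "0 < r"
  then obtain l T where T: "T \<in> carrier (matrix_space (S l) n)" "elements_mat (map_mat (\<iota> l) T) \<subseteq> N"
    and c: "map_mat (\<iota> k) ((complex_of_real r \<odot>\<^bsub>matrix_space (S k) n\<^esub> diag_of (S k) n (ounit (S k)))
            \<oplus>\<^bsub>matrix_space (S k) n\<^esub> X) \<oplus>\<^bsub>matrix_space V n\<^esub> map_mat (\<iota> l) T \<in> cone V n"
    using * by blast
  have "map_mat q (map_mat (\<iota> l) T) = \<zero>\<^bsub>matrix_space W n\<^esub>"
    using T by (simp only: map_mat_q_zero_iff m\<iota>.hom_in)
  then show "complex_of_real r \<odot>\<^bsub>matrix_space W n\<^esub> diag_of W n (ounit W)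
        \<oplus>\<^bsub>matrix_space W n\<^esub> Y \<in> map_mat q ` cone V n"
    using imageI[OF c, of "map_mat q"] X T(1)
    by (simp add: Y m\<iota>.hom_add m\<iota>.hom_smult lim.mq.hom_add lim.mq.hom_smult map_mat_\<iota>_ounit
        lim.map_mat_unit)
next
  assume *: "Y \<in> carrier (matrix_space W n) \<and>
      (\<forall>r::real. 0 < r \<longrightarrow> complex_of_real r \<odot>\<^bsub>matrix_space W n\<^esub> diag_of W n (ounit W)
        \<oplus>\<^bsub>matrix_space W n\<^esub> Y \<in> map_mat q ` cone V n)"
  obtain Z where Z: "Z \<in> carrier (matrix_space V n)" "Y = map_mat q Z"
    using lim.map_mat_surj * by blast
  obtain k X where X: "X \<in> carrier (matrix_space (S k) n)" "Z = map_mat (\<iota> k) X"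
    by (rule V_lift_matrix[OF Z(1)])
  have "Y \<in> hermitian (matrix_space (lim_star_space S \<phi>) n)"
    unfolding matrix_space_lim using * by (intro lim.hermitian_if_image_cone[OF n]) auto
  moreover have "\<exists>l T. T \<in> carrier (matrix_space (S l) n) \<and>
       elements_mat (map_mat (\<iota> l) T) \<subseteq> N \<and>
       map_mat (\<iota> k) ((complex_of_real r \<odot>\<^bsub>matrix_space (S k) n\<^esub> diag_of (S k) n (ounit (S k)))
            \<oplus>\<^bsub>matrix_space (S k) n\<^esub> X) \<oplus>\<^bsub>matrix_space V n\<^esub> map_mat (\<iota> l) T \<in> cone V n"
    if r: "0 < r" for r :: real
  proof -
    obtain C where C: "C \<in> cone V n" and eq: "complex_of_real r \<odot>\<^bsub>matrix_space W n\<^esub> diag_of W n (ounit W)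
        \<oplus>\<^bsub>matrix_space W n\<^esub> Y = map_mat q C"
      using * r by blast
    note Cc = V.cone_in[OF n C]
    define A where "A = map_mat (\<iota> k) ((complex_of_real r \<odot>\<^bsub>matrix_space (S k) n\<^esub> diag_of (S k) n (ounit (S k)))
            \<oplus>\<^bsub>matrix_space (S k) n\<^esub> X)"
    have A: "A \<in> carrier (matrix_space V n)" using X by (simp add: A_def)
    have qA: "map_mat q A = map_mat q C"
      using X(1) by (simp add: A_def m\<iota>.hom_add m\<iota>.hom_smult lim.mq.hom_add lim.mq.hom_smult
          map_mat_\<iota>_ounit lim.map_mat_unit Z(2) X(2) flip: eq)
    \<comment> \<open>The difference between the positive lift \<open>C\<close> and the lift
      \<open>A\<close> obtained from \<open>X\<close>; it has to be represented at some level to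
      become \<open>T\<close>.\<close>
    define D where "D = (-1) \<odot>\<^bsub>matrix_space V n\<^esub> A \<oplus>\<^bsub>matrix_space V n\<^esub> C"
    have D: "D \<in> carrier (matrix_space V n)" using A Cc by (simp add: D_def)
    have "map_mat q D = \<zero>\<^bsub>matrix_space W n\<^esub>"
      using A Cc by (simp add: D_def lim.mq.hom_add lim.mq.hom_smult qA)
    then have DN: "elements_mat D \<subseteq> N" by (simp only: map_mat_q_zero_iff[OF D])
    obtain l T where T: "T \<in> carrier (matrix_space (S l) n)" "D = map_mat (\<iota> l) T"
      by (rule V_lift_matrix[OF D])
    have "A \<oplus>\<^bsub>matrix_space V n\<^esub> D = C" using A Cc by (simp add: D_def)
    then show ?thesis using T DN C unfolding A_def by blast
  qed
  ultimately show "Y \<in> cone W n"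
    unfolding lim_system_simps lim_cone_def map_mat_lim_map using X Z(2) by blast
qed

sublocale lim: archimedeanization V W q
  by unfold_locales (rule mem_lim_cone_iff)

text \<open>The mediating map is obtained in two stages, through the algebraic limit and then
  through \<open>q\<close>.\<close>

lemma inductive_limit: "OS_inductive_limit TYPE('c) S \<phi> W (lim_map S \<phi>)"
  unfolding OS_inductive_limit_def
proof (intro conjI allI ballI impI)
  show "operator_system W" by (rule lim.operator_system_W)
  show "ucp_map (S k) W (lim_map S \<phi> k)" for k
    using ucp_map_comp[OF ucp_map_\<iota> lim.ucp_map_q] unfolding lim_map_q[abs_def] .
  show "lim_map S \<phi> (Suc k) (\<phi> k x) = lim_map S \<phi> k x" if "x \<in> carrier (S k)" for k x
    using \<iota>_connecting[of k "Suc k" x] that by (simp add: lim_map_q connecting_Suc)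
  fix B :: "'c opsys" and \<beta>
  assume *: "operator_system B \<and> (\<forall>k. ucp_map (S k) B (\<beta> k)) \<and>
        (\<forall>k. \<forall>x\<in>carrier (S k). \<beta> (Suc k) (\<phi> k x) = \<beta> k x)"
  then have B: "operator_system B" by blast
  obtain \<gamma> where \<gamma>: "ucp_map V B \<gamma>" "\<And>k x. x \<in> carrier (S k) \<Longrightarrow> \<gamma> (\<iota> k x) = \<beta> k x"
    by (rule V_universal[OF B, of \<beta>]) (use * in blast)+
  obtain \<mu> where \<mu>: "\<mu> \<in> extensional (carrier W)" "ucp_map W B \<mu>" "\<And>s. s \<in> carrier V \<Longrightarrow> \<mu> (q s) = \<gamma> s"
    by (rule lim.universal[OF B \<gamma>(1)]) blast
  show "\<exists>!\<mu>. \<mu> \<in> extensional (carrier W) \<and> ucp_map W B \<mu> \<and>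
      (\<forall>k. \<forall>x\<in>carrier (S k). \<mu> (lim_map S \<phi> k x) = \<beta> k x)"
  proof (rule ex1I[of _ \<mu>])
    show "\<mu> \<in> extensional (carrier W) \<and> ucp_map W B \<mu> \<and>
      (\<forall>k. \<forall>x\<in>carrier (S k). \<mu> (lim_map S \<phi> k x) = \<beta> k x)"
      using \<mu> \<gamma>(2) by (simp add: lim_map_q)
    fix \<nu> assume \<nu>: "\<nu> \<in> extensional (carrier W) \<and> ucp_map W B \<nu> \<and>
      (\<forall>k. \<forall>x\<in>carrier (S k). \<nu> (lim_map S \<phi> k x) = \<beta> k x)"
    \<comment> \<open>Every element of the limit comes from some \<open>x\<close> at a finite level,
      where both maps are prescribed.\<close>
    show "\<nu> = \<mu>"
    proof (rule extensionalityI[of _ "carrier W"])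
      fix y assume "y \<in> carrier W"
      then obtain s where s: "s \<in> carrier V" "y = q s" unfolding lim.carrier_W by blast
      obtain k x where x: "x \<in> carrier (S k)" "s = \<iota> k x" by (rule V_cases[OF s(1)])
      have "\<nu> (q (\<iota> k x)) = \<beta> k x" using \<nu> x(1) by (simp add: lim_map_q)
      then show "\<nu> y = \<mu> y" using \<mu>(3)[of "\<iota> k x"] \<gamma>(2)[OF x(1)] x(1) by (simp add: s(2) x(2))
    qed (use \<nu> \<mu>(1) in blast)+
  qed
qed

end

theorem theorem4p11:
  fixes S :: "nat \<Rightarrow> 'a opsys" and \<phi> :: "nat \<Rightarrow> 'a \<Rightarrow> 'a"
  assumes "OS_inductive_system S \<phi>"
  shows "OS_inductive_limit TYPE('c) S \<phi> (lim_system S \<phi>) (lim_map S \<phi>)"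
proof -
  interpret os_inductive_system S \<phi> by (rule os_inductive_system.intro) fact
  show ?thesis by (rule inductive_limit)
qed

end
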